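(* Let $\mathcal M$ be a compact manifold with boundary, $\mathcal N$ a connected component of $\partial\mathcal M$, and let $$\cdots\to C^\infty(\mathcal M;E^q)\xrightarrow{A_q}C^\infty(\mathcal M;E^{q+1})\to\cdots,\qquad A_q\in\operatorname{Diff}^1_b(\mathcal M;E^q,E^{q+1}),\ q=0,\dots,r,$$ be a $b$-elliptic complex of first order totally characteristic operators between sections of vector bundles over $\mathcal M$. Fix a smooth positive $b$-density on $\mathcal M$ and a Hermitian metric on each $E^q$, and let $\square_q=A_q^\star A_q+A_{q-1}A_{q-1}^\star$ be the resulting Laplacian in degree $q$. Then for each $q$, $\operatorname{spec}^q_{b,\mathcal N}(A)\subset\operatorname{spec}_{b,\mathcal N}(\square_q)$.
   Context: A defining function $\mathfrak r$ is a smooth real function on $\mathcal M$, positive in the interior, vanishing exactly on $\partial\mathcal M$ with nonvanishing differential there. $\operatorname{Diff}^m_b(\mathcal M;E,F)$ is the space of differential operators $P:C^\infty(\mathcal M;E)\to C^\infty(\mathcal M;F)$ of order $m$ with coefficients smooth up to the boundary such that $\mathfrak r^{-\nu}P\mathfrak r^\nu$ has coefficients smooth up to the boundary for $\nu=1,\dots,m$. Let ${}^bT\mathcal M$ be Melrose's $b$-tangent bundle, with evaluation map $\mathrm{ev}:{}^bT\mathcal M\to T\mathcal M$ (inducing an isomorphism from sections onto vector fields tangent to $\partial\mathcal M$). The principal $b$-symbol of $P$ is the smooth section ${}^b\sigma(P)$ over ${}^bT^*\mathcal M$ with ${}^b\sigma(P)(\mathrm{ev}^*\xi)=\sigma(P)(\xi)$,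 where $\sigma(P)$ is the usual principal symbol. The complex is $b$-elliptic if $A_{q+1}A_q=0$ and the sequence of maps ${}^b\sigma(A_q)(\xi):E^q_x\to E^{q+1}_x$ is exact for every $x\in\mathcal M$ and every nonzero real $\xi\in{}^bT_x^*\mathcal M$. A $b$-density is a density of the form $\mathfrak r^{-1}$ times a smooth density; formal adjoints $A_q^\star$ are taken with respect to the chosen $b$-density and Hermitian metrics. For $P\in\operatorname{Diff}^m_b(\mathcal M;E,F)$ and $\sigma\in\mathbb C$, the indicial family at $\mathcal N$ is $\widehat P(\sigma):C^\infty(\mathcal N;E_{\mathcal N})\to C^\infty(\mathcal N;F_{\mathcal N})$, $\widehat P(\sigma)\phi=(\mathfrak r^{-i\sigma}P\mathfrak r^{i\sigma}\tilde\phi)|_{\mathcal N}$, where $\tilde\phi$ is any smooth extension of $\phi$ to $\mathcal M$. Write $\mathcal A_q(\sigma)=\widehat{A_q}(\sigma)$. For each $\sigma$ the operators $\mathcal A_q(\sigma)$ form an elliptic complex on $\mathcal N$, with cohomology $H^q_{\mathcal A(\sigma)}(\mathcal N)$ in degree $q$ (up to isomorphism independent of $\mathfrak r$). Define $$\operatorname{spec}^q_{b,\mathcal N}(A)=\{\sigma\in\mathbb C:H^q_{\mathcal A(\sigma)}(\mathcal N)\ne0\},$$ $$\operatorname{spec}_{b,\mathcal N}(\square_q)=\{\sigma\in\mathbb C:\widehat\square_q(\sigma):C^\infty(\mathcal N;E^q_{\mathcal N})\to C^\infty(\mathcal N;E^q_{\mathcal N})\text{ is not invertible}\}.$$ *)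

theory Defs
  imports "HOL-Analysis.Analysis"
begin

section \<open>Complex vector spaces\<close>

class complex_vector = ab_group_add +
  fixes scaleC :: "complex \<Rightarrow> 'a \<Rightarrow> 'a"  (infixr "*\<^sub>C" 75)
  assumes scaleC_add_right: "c *\<^sub>C (x + y) = c *\<^sub>C x + c *\<^sub>C y"
    and scaleC_add_left: "(c + d) *\<^sub>C x = c *\<^sub>C x + d *\<^sub>C x"
    and scaleC_scaleC: "c *\<^sub>C d *\<^sub>C x = (c * d) *\<^sub>C x"
    and scaleC_one: "1 *\<^sub>C x = x"

global_interpretation complex_vector:
  vector_space "scaleC :: complex \<Rightarrow> 'a \<Rightarrow> 'a::complex_vector"
  by unfold_locales
    (simp_all add: scaleC_add_right scaleC_add_left scaleC_scaleC scaleC_one)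


section \<open>Smooth functions on subsets of Euclidean space\<close>

primrec Ck_on :: "nat \<Rightarrow> 'v::euclidean_space set \<Rightarrow> ('v \<Rightarrow> 'b::real_normed_vector) \<Rightarrow> bool" where
  "Ck_on 0 U f \<longleftrightarrow> continuous_on U f"
| "Ck_on (Suc k) U f \<longleftrightarrow> (\<forall>x\<in>U. f differentiable (at x)) \<and>
     (\<forall>b\<in>Basis. Ck_on k U (\<lambda>x. frechet_derivative f (at x) b))"

text \<open>On a set that need not be open (e.g. a relatively open subset of a half-space, or of its
  boundary hyperplane), smooth means: locally the restriction of a smooth function on an open set.\<close>

definition smooth_on :: "'v::euclidean_space set \<Rightarrow> ('v \<Rightarrow> 'b::real_normed_vector) \<Rightarrow> bool" where
  "smooth_on S f \<longleftrightarrow> (\<forall>x\<in>S. \<exists>U g. open U \<and> x \<in> U \<and> (\<forall>k. Ck_on k U g) \<and> (\<forall>y\<in>S \<inter> U. f y = g y))"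

text \<open>\<open>pderivs S [b\<^sub>1, \<dots>, b\<^sub>k] f\<close> is the iterated partial derivative of \<open>f\<close> along \<open>b\<^sub>k, \<dots>, b\<^sub>1\<close>.
  The derivatives are taken within \<open>S\<close>; they are unique when \<open>S\<close> is relatively open in a half-space.\<close>

primrec pderivs ::
    "'v::euclidean_space set \<Rightarrow> 'v list \<Rightarrow> ('v \<Rightarrow> 'b::real_normed_vector) \<Rightarrow> 'v \<Rightarrow> 'b" where
  "pderivs S [] f = f"
| "pderivs S (b # bs) f = (\<lambda>x. frechet_derivative (pderivs S bs f) (at x within S) b)"


section \<open>Manifolds with boundary\<close>

text \<open>The manifold is the universe of a Hausdorff type \<open>'a\<close>; its smooth structure is an atlas of
  charts \<open>(U, \<phi>)\<close> with values in a half-space of the model space \<open>'v\<close>, of dimension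
  \<open>DIM('v) \<ge> 1\<close>. The coordinate normal to the bounding hyperplane is an arbitrary but fixed one.\<close>

definition normal_dir :: "'v::euclidean_space" where
  "normal_dir = (SOME b. b \<in> Basis)"

definition half_space :: "'v::euclidean_space set" where
  "half_space = {y. 0 \<le> y \<bullet> normal_dir}"

type_synonym ('a, 'v) chart = "'a set \<times> ('a \<Rightarrow> 'v)"
type_synonym ('a, 'v) atlas = "('a, 'v) chart set"

definition smooth_atlas :: "('a::t2_space, 'v::euclidean_space) atlas \<Rightarrow> bool" where
  "smooth_atlas \<A> \<longleftrightarrow>
     \<Union> (fst ` \<A>) = UNIV \<and>
     (\<forall>(U, \<phi>)\<in>\<A>. open U \<and> openin (top_of_set half_space) (\<phi> ` U) \<and>
        homeomorphism U (\<phi> ` U) \<phi> (inv_into U \<phi>)) \<and>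
     (\<forall>(U, \<phi>)\<in>\<A>. \<forall>(V, \<psi>)\<in>\<A>. smooth_on (\<phi> ` (U \<inter> V)) (\<psi> \<circ> inv_into U \<phi>))"

definition mboundary :: "('a, 'v::euclidean_space) atlas \<Rightarrow> 'a set" where
  "mboundary \<A> = {p. \<exists>(U, \<phi>)\<in>\<A>. p \<in> U \<and> \<phi> p \<bullet> normal_dir = 0}"

text \<open>Smoothness along a subset \<open>S\<close> of the manifold, which is either open or (part of) the
  boundary.\<close>

definition msmooth_on ::
    "('a, 'v::euclidean_space) atlas \<Rightarrow> 'a set \<Rightarrow> ('a \<Rightarrow> 'b::real_normed_vector) \<Rightarrow> bool" where
  "msmooth_on \<A> S f \<longleftrightarrow> (\<forall>(U, \<phi>)\<in>\<A>. smooth_on (\<phi> ` (U \<inter> S)) (f \<circ> inv_into U \<phi>))"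

definition defining_function ::
    "('a, 'v::euclidean_space) atlas \<Rightarrow> ('a \<Rightarrow> real) \<Rightarrow> bool" where
  "defining_function \<A> \<rho> \<longleftrightarrow>
     msmooth_on \<A> UNIV \<rho> \<and>
     (\<forall>p. p \<notin> mboundary \<A> \<longrightarrow> \<rho> p > 0) \<and>
     (\<forall>p\<in>mboundary \<A>. \<rho> p = 0) \<and>
     (\<forall>(U, \<phi>)\<in>\<A>. \<forall>p \<in> U \<inter> mboundary \<A>.
        \<not> ((\<rho> \<circ> inv_into U \<phi>) has_derivative (\<lambda>_. 0)) (at (\<phi> p) within \<phi> ` U))"


section \<open>Complex vector bundles\<close>

text \<open>A bundle is a family of finite-dimensional subspaces of a vector space \<open>'e\<close> (which carries no
  topology and only serves as a common type for the fibres), together with local frames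
  \<open>(W, [e\<^sub>1, \<dots>, e\<^sub>k])\<close> over open sets \<open>W\<close> that cover the manifold and are smoothly related.\<close>

record ('a, 'e) vbundle =
  fiber :: "'a \<Rightarrow> 'e set"
  frames :: "('a set \<times> ('a \<Rightarrow> 'e) list) set"

definition coord :: "('a \<Rightarrow> 'e::complex_vector) list \<Rightarrow> 'a \<Rightarrow> 'e \<Rightarrow> nat \<Rightarrow> complex" where
  "coord es x w = (SOME c. w = (\<Sum>i<length es. c i *\<^sub>C (es ! i) x))"

definition vector_bundle ::
    "('a::topological_space, 'v::euclidean_space) atlas \<Rightarrow> ('a, 'e::complex_vector) vbundle \<Rightarrow> bool" where
  "vector_bundle \<A> E \<longleftrightarrow>
     \<Union> (fst ` frames E) = UNIV \<and>
     (\<forall>x. complex_vector.subspace (fiber E x)) \<and>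
     (\<forall>(W, es)\<in>frames E. open W \<and> (\<forall>x\<in>W.
        distinct (map (\<lambda>e. e x) es) \<and>
        complex_vector.independent (set (map (\<lambda>e. e x) es)) \<and>
        complex_vector.span (set (map (\<lambda>e. e x) es)) = fiber E x)) \<and>
     (\<forall>(W, es)\<in>frames E. \<forall>(W', fs)\<in>frames E. \<forall>i<length es. \<forall>j<length fs.
        msmooth_on \<A> (W \<inter> W') (\<lambda>x. coord fs x ((es ! i) x) j))"

text \<open>Smooth sections over \<open>S\<close> (the whole manifold, or a boundary component) are extended by zero
  outside \<open>S\<close>, so that two sections over \<open>S\<close> are equal iff they are equal as functions.\<close>

definition smooth_sections ::
    "('a, 'v::euclidean_space) atlas \<Rightarrow> ('a, 'e::complex_vector) vbundle \<Rightarrow> 'a set \<Rightarrow> ('a \<Rightarrow> 'e) set" where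
  "smooth_sections \<A> E S =
     {s. (\<forall>x\<in>S. s x \<in> fiber E x) \<and> (\<forall>x. x \<notin> S \<longrightarrow> s x = 0) \<and>
         (\<forall>(W, es)\<in>frames E. \<forall>i<length es. msmooth_on \<A> (W \<inter> S) (\<lambda>x. coord es x (s x) i))}"

definition hermitian_metric ::
    "('a, 'v::euclidean_space) atlas \<Rightarrow> ('a, 'e::complex_vector) vbundle \<Rightarrow>
     ('a \<Rightarrow> 'e \<Rightarrow> 'e \<Rightarrow> complex) \<Rightarrow> bool" where
  "hermitian_metric \<A> E h \<longleftrightarrow>
     (\<forall>x. \<forall>u\<in>fiber E x. \<forall>v\<in>fiber E x. \<forall>w\<in>fiber E x. \<forall>c.
        h x (u + v) w = h x u w + h x v w \<and>
        h x (c *\<^sub>C u) w = c * h x u w \<and>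
        h x u w = cnj (h x w u) \<and>
        (u \<noteq> 0 \<longrightarrow> Re (h x u u) > 0)) \<and>
     (\<forall>(W, es)\<in>frames E. \<forall>i<length es. \<forall>j<length es.
        msmooth_on \<A> W (\<lambda>x. h x ((es ! i) x) ((es ! j) x)))"


section \<open>Densities and formal adjoints\<close>

text \<open>A positive density is identified with the measure it defines: in every chart a smooth
  positive multiple of Lebesgue measure.\<close>

definition smooth_positive_density ::
    "('a::topological_space, 'v::euclidean_space) atlas \<Rightarrow> 'a measure \<Rightarrow> bool" where
  "smooth_positive_density \<A> \<nu> \<longleftrightarrow>
     sets \<nu> = sets borel \<and>
     (\<forall>(U, \<phi>)\<in>\<A>. \<exists>\<delta>::'v \<Rightarrow> real. smooth_on (\<phi> ` U) \<delta> \<and> (\<forall>y\<in>\<phi> ` U. \<delta> y > 0) \<and>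
        (\<forall>B\<in>sets borel. B \<subseteq> U \<longrightarrow>
           emeasure \<nu> B = (\<integral>\<^sup>+y\<in>\<phi> ` B. ennreal (\<delta> y) \<partial>lborel)))"

text \<open>The value \<open>1 / 0 = 0\<close> on the boundary is immaterial, the boundary being a null set.\<close>

definition smooth_positive_b_density ::
    "('a::topological_space, 'v::euclidean_space) atlas \<Rightarrow> ('a \<Rightarrow> real) \<Rightarrow> 'a measure \<Rightarrow> bool" where
  "smooth_positive_b_density \<A> \<rho> \<mu> \<longleftrightarrow>
     (\<exists>\<nu>. smooth_positive_density \<A> \<nu> \<and> \<mu> = density \<nu> (\<lambda>x. ennreal (1 / \<rho> x)))"

text \<open>Integration by parts is against sections with (compact) support in the interior; this
  determines the adjoint on smooth sections in the interior, hence everywhere by continuity.\<close>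

definition is_formal_adjoint ::
    "('a::topological_space, 'v::euclidean_space) atlas \<Rightarrow> 'a measure \<Rightarrow>
     ('a, 'e::complex_vector) vbundle \<Rightarrow> ('a \<Rightarrow> 'e \<Rightarrow> 'e \<Rightarrow> complex) \<Rightarrow>
     ('a, 'e) vbundle \<Rightarrow> ('a \<Rightarrow> 'e \<Rightarrow> 'e \<Rightarrow> complex) \<Rightarrow>
     (('a \<Rightarrow> 'e) \<Rightarrow> ('a \<Rightarrow> 'e)) \<Rightarrow> (('a \<Rightarrow> 'e) \<Rightarrow> ('a \<Rightarrow> 'e)) \<Rightarrow> bool" where
  "is_formal_adjoint \<A> \<mu> E hE F hF P Q \<longleftrightarrow>
     (\<forall>v\<in>smooth_sections \<A> F UNIV. Q v \<in> smooth_sections \<A> E UNIV) \<and>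
     (\<forall>u\<in>smooth_sections \<A> E UNIV. \<forall>v\<in>smooth_sections \<A> F UNIV.
        closure {x. u x \<noteq> 0} \<inter> mboundary \<A> = {} \<longrightarrow>
        (\<integral>x. hF x (P u x) (v x) \<partial>\<mu>) = (\<integral>x. hE x (u x) (Q v x) \<partial>\<mu>))"

definition formal_adjoint ::
    "('a::topological_space, 'v::euclidean_space) atlas \<Rightarrow> 'a measure \<Rightarrow>
     ('a, 'e::complex_vector) vbundle \<Rightarrow> ('a \<Rightarrow> 'e \<Rightarrow> 'e \<Rightarrow> complex) \<Rightarrow>
     ('a, 'e) vbundle \<Rightarrow> ('a \<Rightarrow> 'e \<Rightarrow> 'e \<Rightarrow> complex) \<Rightarrow>
     (('a \<Rightarrow> 'e) \<Rightarrow> ('a \<Rightarrow> 'e)) \<Rightarrow> (('a \<Rightarrow> 'e) \<Rightarrow> ('a \<Rightarrow> 'e))" where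
  "formal_adjoint \<A> \<mu> E hE F hF P = (SOME Q. is_formal_adjoint \<A> \<mu> E hE F hF P Q)"


section \<open>Totally characteristic differential operators\<close>

text \<open>An operator is a map on functions \<open>'a \<Rightarrow> 'e\<close> of which only the restriction to smooth sections
  matters. In a chart and local frames it is a sum, over words of length at most \<open>m\<close> in the
  coordinate directions, of smooth matrix coefficients times iterated partial derivatives.\<close>

definition diff_operator ::
    "('a, 'v::euclidean_space) atlas \<Rightarrow> ('a, 'e::complex_vector) vbundle \<Rightarrow> ('a, 'e) vbundle \<Rightarrow>
     nat \<Rightarrow> (('a \<Rightarrow> 'e) \<Rightarrow> ('a \<Rightarrow> 'e)) \<Rightarrow> bool" where
  "diff_operator \<A> E F m P \<longleftrightarrow>
     (\<forall>u\<in>smooth_sections \<A> E UNIV. P u \<in> smooth_sections \<A> F UNIV) \<and>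
     (\<forall>(U, \<phi>)\<in>\<A>. \<forall>(W, es)\<in>frames E. \<forall>(W', fs)\<in>frames F.
        let V = \<phi> ` (U \<inter> W \<inter> W') in
        \<exists>a :: 'v list \<Rightarrow> nat \<Rightarrow> nat \<Rightarrow> 'v \<Rightarrow> complex.
          (\<forall>bs j i. smooth_on V (a bs j i)) \<and>
          (\<forall>u\<in>smooth_sections \<A> E UNIV. \<forall>p\<in>U \<inter> W \<inter> W'. \<forall>j<length fs.
             coord fs p (P u p) j =
               (\<Sum>bs\<in>{bs. set bs \<subseteq> Basis \<and> length bs \<le> m}. \<Sum>i<length es.
                  a bs j i (\<phi> p) *
                  pderivs V bs ((\<lambda>x. coord es x (u x) i) \<circ> inv_into U \<phi>) (\<phi> p))))"

text \<open>That \<open>\<rho>\<^sup>-\<^sup>\<nu> P \<rho>\<^sup>\<nu>\<close>, a priori defined over the interior, has coefficients smooth up to the boundary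
  means that it is the restriction to the interior of some \<open>Q\<close> with smooth coefficients.\<close>

definition b_diff_operator ::
    "('a, 'v::euclidean_space) atlas \<Rightarrow> ('a \<Rightarrow> real) \<Rightarrow>
     ('a, 'e::complex_vector) vbundle \<Rightarrow> ('a, 'e) vbundle \<Rightarrow>
     nat \<Rightarrow> (('a \<Rightarrow> 'e) \<Rightarrow> ('a \<Rightarrow> 'e)) \<Rightarrow> bool" where
  "b_diff_operator \<A> \<rho> E F m P \<longleftrightarrow>
     diff_operator \<A> E F m P \<and>
     (\<forall>\<nu>\<in>{1..m}. \<exists>Q. diff_operator \<A> E F m Q \<and>
        (\<forall>u\<in>smooth_sections \<A> E UNIV. \<forall>x. x \<notin> mboundary \<A> \<longrightarrow>
           Q u x = inverse (of_real (\<rho> x ^ \<nu>)) *\<^sub>C P (\<lambda>y. of_real (\<rho> y ^ \<nu>) *\<^sub>C u y) x))"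


section \<open>Principal symbols and \<open>b\<close>-ellipticity\<close>

text \<open>The usual principal symbol at \<open>p\<close>, applied to \<open>w\<close> in the fibre over \<open>p\<close>:
  \<open>\<sigma>(P)(df\<^sub>p) u(p) = P ((\<i> f)\<^sup>m / m! u) (p)\<close> for real \<open>f\<close> with \<open>f p = 0\<close>, i.e. \<open>\<partial>\<^sub>j\<close> has symbol \<open>\<i> \<xi>\<^sub>j\<close>.
  The covector \<open>\<xi>\<close> is given by its components in the chart \<open>(U, \<phi>)\<close>.\<close>

definition principal_symbol ::
    "('a, 'v::euclidean_space) atlas \<Rightarrow> ('a, 'e::complex_vector) vbundle \<Rightarrow> nat \<Rightarrow>
     (('a \<Rightarrow> 'e) \<Rightarrow> ('a \<Rightarrow> 'e)) \<Rightarrow> ('a, 'v) chart \<Rightarrow> 'a \<Rightarrow> 'v \<Rightarrow> 'e \<Rightarrow> 'e" where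
  "principal_symbol \<A> E m P = (\<lambda>(U, \<phi>) p \<xi> w.
     SOME z. \<exists>(f::'a \<Rightarrow> real) u.
       msmooth_on \<A> UNIV f \<and> f p = 0 \<and>
       ((f \<circ> inv_into U \<phi>) has_derivative (\<lambda>v. \<xi> \<bullet> v)) (at (\<phi> p) within \<phi> ` U) \<and>
       u \<in> smooth_sections \<A> E UNIV \<and> u p = w \<and>
       z = P (\<lambda>x. ((\<i> * of_real (f x)) ^ m / fact m) *\<^sub>C u x) p)"

text \<open>In a chart with coordinates \<open>(x, y)\<close>, \<open>x\<close> being the normal coordinate, the \<open>b\<close>-tangent bundle has
  the smooth frame \<open>x \<partial>\<^sub>x, \<partial>\<^sub>y\<close>. We describe \<open>b\<close>-tangent vectors and \<open>b\<close>-covectors over the chart by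
  their components in this frame and in the dual one, \<open>dx / x, dy\<close>. The function \<open>b_ev\<close> is the
  evaluation map from these components to components with respect to \<open>\<partial>\<^sub>x, \<partial>\<^sub>y\<close>, and its
  \<^const>\<open>adjoint\<close> is the pullback \<open>ev\<^sup>*\<close> of covectors.\<close>

definition b_ev :: "'v::euclidean_space \<Rightarrow> 'v \<Rightarrow> 'v" where
  "b_ev y v = (\<Sum>b\<in>Basis. (if b = normal_dir then (y \<bullet> normal_dir) * (v \<bullet> b) else v \<bullet> b) *\<^sub>R b)"

text \<open>\<open>\<sigma> p \<eta>\<close> is a linear map between the fibres over \<open>p\<close>, depending smoothly on \<open>(p, \<eta>)\<close> up to the
  boundary, with \<open>\<sigma> p (ev\<^sup>* \<xi>)\<close> the principal symbol at \<open>\<xi>\<close>; such \<open>\<sigma>\<close> is unique.\<close>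

definition is_b_symbol ::
    "('a, 'v::euclidean_space) atlas \<Rightarrow> ('a, 'e::complex_vector) vbundle \<Rightarrow> ('a, 'e) vbundle \<Rightarrow> nat \<Rightarrow>
     (('a \<Rightarrow> 'e) \<Rightarrow> ('a \<Rightarrow> 'e)) \<Rightarrow> ('a, 'v) chart \<Rightarrow> ('a \<Rightarrow> 'v \<Rightarrow> 'e \<Rightarrow> 'e) \<Rightarrow> bool" where
  "is_b_symbol \<A> E F m P = (\<lambda>(U, \<phi>) \<sigma>.
     (\<forall>p\<in>U. \<forall>\<eta>. \<forall>w\<in>fiber E p. \<sigma> p \<eta> w \<in> fiber F p) \<and>
     (\<forall>p\<in>U. \<forall>\<eta>. \<forall>w\<in>fiber E p. \<forall>w'\<in>fiber E p. \<forall>c.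
        \<sigma> p \<eta> (w + w') = \<sigma> p \<eta> w + \<sigma> p \<eta> w' \<and> \<sigma> p \<eta> (c *\<^sub>C w) = c *\<^sub>C \<sigma> p \<eta> w) \<and>
     (\<forall>(W, es)\<in>frames E. \<forall>(W', fs)\<in>frames F. \<forall>i<length es. \<forall>j<length fs.
        smooth_on ((\<phi> ` (U \<inter> W \<inter> W')) \<times> UNIV)
          (\<lambda>(y, \<eta>). let p = inv_into U \<phi> y in coord fs p (\<sigma> p \<eta> ((es ! i) p)) j)) \<and>
     (\<forall>p\<in>U. \<forall>\<xi>. \<forall>w\<in>fiber E p.
        \<sigma> p (adjoint (b_ev (\<phi> p)) \<xi>) w = principal_symbol \<A> E m P (U, \<phi>) p \<xi> w))"

definition b_symbol ::
    "('a, 'v::euclidean_space) atlas \<Rightarrow> ('a, 'e::complex_vector) vbundle \<Rightarrow> ('a, 'e) vbundle \<Rightarrow> nat \<Rightarrow>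
     (('a \<Rightarrow> 'e) \<Rightarrow> ('a \<Rightarrow> 'e)) \<Rightarrow> ('a, 'v) chart \<Rightarrow> 'a \<Rightarrow> 'v \<Rightarrow> 'e \<Rightarrow> 'e" where
  "b_symbol \<A> E F m P ch = (SOME \<sigma>. is_b_symbol \<A> E F m P ch \<sigma>)"

text \<open>Complexes of first order operators are indexed by all integers, with zero bundles outside a
  finite range, so exactness at the two ends is included.\<close>

definition b_elliptic_complex ::
    "('a, 'v::euclidean_space) atlas \<Rightarrow> (int \<Rightarrow> ('a, 'e::complex_vector) vbundle) \<Rightarrow>
     (int \<Rightarrow> ('a \<Rightarrow> 'e) \<Rightarrow> ('a \<Rightarrow> 'e)) \<Rightarrow> bool" where
  "b_elliptic_complex \<A> E A \<longleftrightarrow>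
     (\<forall>q. \<forall>u\<in>smooth_sections \<A> (E q) UNIV. A (q + 1) (A q u) = (\<lambda>_. 0)) \<and>
     (\<forall>(U, \<phi>)\<in>\<A>. \<forall>p\<in>U. \<forall>\<eta>. \<eta> \<noteq> 0 \<longrightarrow> (\<forall>q.
        b_symbol \<A> (E (q - 1)) (E q) 1 (A (q - 1)) (U, \<phi>) p \<eta> ` fiber (E (q - 1)) p =
        {w \<in> fiber (E q) p. b_symbol \<A> (E q) (E (q + 1)) 1 (A q) (U, \<phi>) p \<eta> w = 0}))"


section \<open>Indicial families and boundary spectra\<close>

text \<open>Extension, by locality, of a differential operator to sections \<open>w\<close> that are smooth only near
  the point \<open>x\<close>.\<close>

definition apply_local ::
    "('a::topological_space, 'v::euclidean_space) atlas \<Rightarrow> ('a, 'e::complex_vector) vbundle \<Rightarrow>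
     (('a \<Rightarrow> 'e) \<Rightarrow> ('a \<Rightarrow> 'e)) \<Rightarrow> ('a \<Rightarrow> 'e) \<Rightarrow> 'a \<Rightarrow> 'e" where
  "apply_local \<A> E P w x =
     (SOME z. \<exists>u\<in>smooth_sections \<A> E UNIV. \<exists>V. open V \<and> x \<in> V \<and> (\<forall>y\<in>V. u y = w y) \<and> z = P u x)"

text \<open>Below, \<open>\<Phi>\<close> is a smooth extension of \<open>\<phi>\<close>, and \<open>\<Psi>\<close> is \<open>\<rho>\<^sup>-\<^sup>i\<^sup>\<sigma> P \<rho>\<^sup>i\<^sup>\<sigma> \<Phi>\<close>, given in the interior and extended
  smoothly to the boundary.\<close>

definition indicial_family ::
    "('a::topological_space, 'v::euclidean_space) atlas \<Rightarrow> ('a \<Rightarrow> real) \<Rightarrow> 'a set \<Rightarrow>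
     ('a, 'e::complex_vector) vbundle \<Rightarrow> ('a, 'e) vbundle \<Rightarrow>
     (('a \<Rightarrow> 'e) \<Rightarrow> ('a \<Rightarrow> 'e)) \<Rightarrow> complex \<Rightarrow> ('a \<Rightarrow> 'e) \<Rightarrow> ('a \<Rightarrow> 'e)" where
  "indicial_family \<A> \<rho> N E F P \<sigma> \<phi> =
     (SOME g. \<exists>\<Phi>\<in>smooth_sections \<A> E UNIV. \<exists>\<Psi>\<in>smooth_sections \<A> F UNIV.
        (\<forall>p\<in>N. \<Phi> p = \<phi> p) \<and>
        (\<forall>x. x \<notin> mboundary \<A> \<longrightarrow>
           \<Psi> x = (of_real (\<rho> x) powr (- \<i> * \<sigma>)) *\<^sub>C
                 apply_local \<A> E P (\<lambda>y. (of_real (\<rho> y) powr (\<i> * \<sigma>)) *\<^sub>C \<Phi> y) x) \<and>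
        g = (\<lambda>p. if p \<in> N then \<Psi> p else 0))"

definition cocycles ::
    "('a::topological_space, 'v::euclidean_space) atlas \<Rightarrow> ('a \<Rightarrow> real) \<Rightarrow> 'a set \<Rightarrow>
     (int \<Rightarrow> ('a, 'e::complex_vector) vbundle) \<Rightarrow> (int \<Rightarrow> ('a \<Rightarrow> 'e) \<Rightarrow> ('a \<Rightarrow> 'e)) \<Rightarrow>
     complex \<Rightarrow> int \<Rightarrow> ('a \<Rightarrow> 'e) set" where
  "cocycles \<A> \<rho> N E A \<sigma> q =
     {\<phi> \<in> smooth_sections \<A> (E q) N. indicial_family \<A> \<rho> N (E q) (E (q + 1)) (A q) \<sigma> \<phi> = (\<lambda>_. 0)}"

definition coboundaries ::
    "('a::topological_space, 'v::euclidean_space) atlas \<Rightarrow> ('a \<Rightarrow> real) \<Rightarrow> 'a set \<Rightarrow>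
     (int \<Rightarrow> ('a, 'e::complex_vector) vbundle) \<Rightarrow> (int \<Rightarrow> ('a \<Rightarrow> 'e) \<Rightarrow> ('a \<Rightarrow> 'e)) \<Rightarrow>
     complex \<Rightarrow> int \<Rightarrow> ('a \<Rightarrow> 'e) set" where
  "coboundaries \<A> \<rho> N E A \<sigma> q =
     indicial_family \<A> \<rho> N (E (q - 1)) (E q) (A (q - 1)) \<sigma> ` smooth_sections \<A> (E (q - 1)) N"

definition cohomologous ::
    "('a::topological_space, 'v::euclidean_space) atlas \<Rightarrow> ('a \<Rightarrow> real) \<Rightarrow> 'a set \<Rightarrow>
     (int \<Rightarrow> ('a, 'e::complex_vector) vbundle) \<Rightarrow> (int \<Rightarrow> ('a \<Rightarrow> 'e) \<Rightarrow> ('a \<Rightarrow> 'e)) \<Rightarrow>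
     complex \<Rightarrow> int \<Rightarrow> ('a \<Rightarrow> 'e) rel" where
  "cohomologous \<A> \<rho> N E A \<sigma> q =
     {(\<phi>, \<psi>). \<phi> \<in> cocycles \<A> \<rho> N E A \<sigma> q \<and> \<psi> \<in> cocycles \<A> \<rho> N E A \<sigma> q \<and>
        (\<lambda>x. \<phi> x - \<psi> x) \<in> coboundaries \<A> \<rho> N E A \<sigma> q}"

definition cohomology ::
    "('a::topological_space, 'v::euclidean_space) atlas \<Rightarrow> ('a \<Rightarrow> real) \<Rightarrow> 'a set \<Rightarrow>
     (int \<Rightarrow> ('a, 'e::complex_vector) vbundle) \<Rightarrow> (int \<Rightarrow> ('a \<Rightarrow> 'e) \<Rightarrow> ('a \<Rightarrow> 'e)) \<Rightarrow>
     complex \<Rightarrow> int \<Rightarrow> ('a \<Rightarrow> 'e) set set" where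
  "cohomology \<A> \<rho> N E A \<sigma> q = cocycles \<A> \<rho> N E A \<sigma> q // cohomologous \<A> \<rho> N E A \<sigma> q"

text \<open>The cohomology is nonzero iff it has an element other than the class of \<open>0\<close>.\<close>

definition b_spec_complex ::
    "('a::topological_space, 'v::euclidean_space) atlas \<Rightarrow> ('a \<Rightarrow> real) \<Rightarrow> 'a set \<Rightarrow>
     (int \<Rightarrow> ('a, 'e::complex_vector) vbundle) \<Rightarrow> (int \<Rightarrow> ('a \<Rightarrow> 'e) \<Rightarrow> ('a \<Rightarrow> 'e)) \<Rightarrow>
     int \<Rightarrow> complex set" where
  "b_spec_complex \<A> \<rho> N E A q =
     {\<sigma>. \<exists>c \<in> cohomology \<A> \<rho> N E A \<sigma> q. c \<noteq> cohomologous \<A> \<rho> N E A \<sigma> q `` {\<lambda>_. 0}}"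

text \<open>Invertibility on smooth sections of an operator \<open>P\<close> of \<open>E\<close> to itself.\<close>

definition b_spec_operator ::
    "('a::topological_space, 'v::euclidean_space) atlas \<Rightarrow> ('a \<Rightarrow> real) \<Rightarrow> 'a set \<Rightarrow>
     ('a, 'e::complex_vector) vbundle \<Rightarrow> (('a \<Rightarrow> 'e) \<Rightarrow> ('a \<Rightarrow> 'e)) \<Rightarrow> complex set" where
  "b_spec_operator \<A> \<rho> N E P =
     {\<sigma>. \<not> bij_betw (indicial_family \<A> \<rho> N E E P \<sigma>) (smooth_sections \<A> E N) (smooth_sections \<A> E N)}"

definition laplacian ::
    "('a::topological_space, 'v::euclidean_space) atlas \<Rightarrow> 'a measure \<Rightarrow>
     (int \<Rightarrow> ('a, 'e::complex_vector) vbundle) \<Rightarrow> (int \<Rightarrow> 'a \<Rightarrow> 'e \<Rightarrow> 'e \<Rightarrow> complex) \<Rightarrow>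
     (int \<Rightarrow> ('a \<Rightarrow> 'e) \<Rightarrow> ('a \<Rightarrow> 'e)) \<Rightarrow> int \<Rightarrow> ('a \<Rightarrow> 'e) \<Rightarrow> ('a \<Rightarrow> 'e)" where
  "laplacian \<A> \<mu> E h A q =
     (\<lambda>u x. formal_adjoint \<A> \<mu> (E q) (h q) (E (q + 1)) (h (q + 1)) (A q) (A q u) x +
        A (q - 1) (formal_adjoint \<A> \<mu> (E (q - 1)) (h (q - 1)) (E q) (h q) (A (q - 1)) u) x)"

end

theory Submission
  imports Defs
begin

text \<open>
  Fix \<open>\<sigma>\<close> and write \<open>T\<^sub>q\<close> and \<open>S\<^sub>q\<close> for the indicial families of \<open>A\<^sub>q\<close> and of its formal adjoint at \<open>\<sigma>\<close>.
  Indicial families are multiplicative, so \<open>T\<^sub>q T\<^sub>q\<^sub>-\<^sub>1 = 0\<close>, \<open>S\<^sub>q\<^sub>-\<^sub>1 S\<^sub>q = 0\<close>, and the indicial family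
  of the Laplacian is \<open>L = S\<^sub>q T\<^sub>q + T\<^sub>q\<^sub>-\<^sub>1 S\<^sub>q\<^sub>-\<^sub>1\<close>. For nonreal \<open>\<sigma>\<close> the operators \<open>S\<^sub>q\<close> and \<open>T\<^sub>q\<close> are in general
  not adjoint to each other, so that the usual argument with \<open>\<langle>L \<phi>, \<phi>\<rangle>\<close> is not at hand, but algebra suffices. Suppose that
  \<open>L\<close> is bijective, let \<open>T\<^sub>q \<phi> = 0\<close> and write \<open>\<phi> = L \<psi>\<close>. Then \<open>T\<^sub>q S\<^sub>q T\<^sub>q \<psi> = T\<^sub>q \<phi> = 0\<close>, whence
  \<open>L (S\<^sub>q T\<^sub>q \<psi>) = 0\<close> and \<open>S\<^sub>q T\<^sub>q \<psi> = 0\<close>. So \<open>\<phi> = T\<^sub>q\<^sub>-\<^sub>1 S\<^sub>q\<^sub>-\<^sub>1 \<psi>\<close> is a coboundary (\<open>cocycle_is_coboundary\<close>).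

  The analytic part consists in showing that formal adjoints exist and are totally characteristic, and that
  indicial families are well defined and multiplicative. It rests on a description of first order operators
  by commutators: \<open>P\<close> is of first order if it commutes at \<open>p\<close> with multiplication by functions whose
  differential vanishes at \<open>p\<close>, and totally characteristic if \<open>[P, \<rho>] = \<rho> B\<close> with \<open>B\<close> smooth up to the boundary
  (\<open>b_first_order\<close>). From this, \<open>\<rho>\<^sup>-\<^sup>i\<^sup>\<sigma> P \<rho>\<^sup>i\<^sup>\<sigma> = P + i\<sigma> B\<close> (\<open>bfo_conjugated\<close>), and on a boundary component both \<open>P u\<close>
  and \<open>B u\<close> depend only on the restriction of \<open>u\<close> to it (\<open>bfo_vanish\<close>), because a function vanishing
  on the component has a differential proportional to \<open>d \<rho>\<close> there.

  The formal adjoint is constructed in small patches, from a smooth Riesz representation in the fibres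
  (\<open>riesz_section\<close>) and the divergence theorem (\<open>chart_divergence\<close>). The factor \<open>\<rho>\<^sup>-\<^sup>1\<close> in the density does no
  harm, since the vector fields \<open>X\<close> that occur satisfy \<open>X \<rho> = \<rho> \<beta>\<close> with smooth \<open>\<beta>\<close>. The properties
  of the adjoint \<open>P\<^sup>*\<close> are then read off from the identity between \<open>[P\<^sup>*, f]\<close> and the pointwise adjoint of
  \<open>- [P, cnj f]\<close> (\<open>adj_commutator\<close>), which follows from the fundamental lemma of the calculus of variations.
\<close>

section \<open>Calculus of smooth functions on Euclidean space\<close>

lemma Ck_on_subset: "Ck_on k U f \<Longrightarrow> V \<subseteq> U \<Longrightarrow> Ck_on k V f"
  by (induction k arbitrary: f) (auto intro: continuous_on_subset)

lemma frechet_derivative_cong_open: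
  assumes "open U" "x \<in> U" "\<And>y. y \<in> U \<Longrightarrow> f y = g y"
  shows "frechet_derivative f (at x) = frechet_derivative g (at x)"
proof -
  have "(f has_derivative D) (at x) \<longleftrightarrow> (g has_derivative D) (at x)" for D
    using assms by (metis has_derivative_transform_within_open)
  then show ?thesis unfolding frechet_derivative_def by presburger
qed

lemma Ck_on_cong:
  assumes "open U" "\<And>y. y \<in> U \<Longrightarrow> f y = g y" "Ck_on k U f"
  shows "Ck_on k U g"
  using assms(2,3)
proof (induction k arbitrary: f g)
  case 0
  then show ?case by (simp cong: continuous_on_cong)
next
  case (Suc k)
  have "g differentiable (at x)" if "x \<in> U" for x
    using Suc.prems that assms(1) unfolding differentiable_def
    by (simp, metis has_derivative_transform_within_open differentiable_def)
  moreover have "Ck_on k U (\<lambda>x. frechet_derivative g (at x) b)" if "b \<in> Basis" for b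
  proof (rule Suc.IH)
    show "frechet_derivative f (at y) b = frechet_derivative g (at y) b" if "y \<in> U" for y
      using frechet_derivative_cong_open[OF assms(1) that, of f g] Suc.prems by simp
    show "Ck_on k U (\<lambda>x. frechet_derivative f (at x) b)" using Suc.prems that by simp
  qed
  ultimately show ?case by simp
qed

lemma Ck_on_SucI:
  assumes "open U" "\<And>x. x \<in> U \<Longrightarrow> (f has_derivative D x) (at x)"
    and "\<And>b. b \<in> Basis \<Longrightarrow> Ck_on k U (\<lambda>x. D x b)"
  shows "Ck_on (Suc k) U f"
proof -
  have "Ck_on k U (\<lambda>x. frechet_derivative f (at x) b)" if "b \<in> Basis" for b
    by (rule Ck_on_cong[OF assms(1) _ assms(3)[OF that]])
      (use assms(2) frechet_derivative_at in force)
  then show ?thesis using assms(2) by (auto simp: differentiable_def)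
qed

lemma Ck_on_Suc_has_derivative:
  "Ck_on (Suc k) U f \<Longrightarrow> x \<in> U \<Longrightarrow> (f has_derivative frechet_derivative f (at x)) (at x)"
  by (simp add: frechet_derivative_works)

lemma Ck_on_SucD: "Ck_on (Suc k) U f \<Longrightarrow> Ck_on k U f"
proof (induction k arbitrary: f)
  case 0
  then show ?case
    by (simp add: continuous_at_imp_continuous_on differentiable_imp_continuous_within)
next
  case (Suc k)
  from Suc.prems show ?case using Suc.IH by (subst Ck_on.simps(2)) (simp del: Ck_on.simps(2) add: Ck_on.simps(2)[of "Suc k"])
qed

lemma Ck_on_imp_continuous: "Ck_on k U f \<Longrightarrow> continuous_on U f"
  by (induction k) (auto dest: Ck_on_SucD simp del: Ck_on.simps(2))

lemma Ck_on_const: "open U \<Longrightarrow> Ck_on k U (\<lambda>_. c)"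
proof (induction k arbitrary: c)
  case (Suc k)
  show ?case by (rule Ck_on_SucI[where D = "\<lambda>_ _. 0"]) (use Suc in auto)
qed simp

lemma Ck_on_bounded_linear:
  assumes "open U" "bounded_linear L"
  shows "Ck_on k U L"
proof (cases k)
  case 0
  then show ?thesis using assms by (simp add: linear_continuous_on)
next
  case (Suc n)
  show ?thesis unfolding Suc
    by (rule Ck_on_SucI[where D = "\<lambda>_. L"])
      (use assms in \<open>auto intro: bounded_linear_imp_has_derivative Ck_on_const\<close>)
qed

lemma Ck_on_ident: "open U \<Longrightarrow> Ck_on k U (\<lambda>x. x)"
  by (rule Ck_on_bounded_linear) (auto intro: bounded_linear_ident)

lemma Ck_on_add:
  assumes "open U" "Ck_on k U f" "Ck_on k U g"
  shows "Ck_on k U (\<lambda>x. f x + g x)"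
  using assms(2,3)
proof (induction k arbitrary: f g)
  case 0
  then show ?case by (auto intro: continuous_intros)
next
  case (Suc k)
  show ?case
  proof (rule Ck_on_SucI[OF assms(1)])
    show "((\<lambda>x. f x + g x) has_derivative
        (\<lambda>h. frechet_derivative f (at x) h + frechet_derivative g (at x) h)) (at x)" if "x \<in> U" for x
      using that Suc.prems by (intro has_derivative_add Ck_on_Suc_has_derivative)
    show "Ck_on k U (\<lambda>x. frechet_derivative f (at x) b + frechet_derivative g (at x) b)"
      if "b \<in> Basis" for b
      using Suc.prems that by (intro Suc.IH) simp_all
  qed
qed

lemma Ck_on_sum:
  assumes "open U" "\<And>i. i \<in> I \<Longrightarrow> Ck_on k U (f i)"
  shows "Ck_on k U (\<lambda>x. \<Sum>i\<in>I. f i x)"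
  using assms(2)
  by (induction I rule: infinite_finite_induct) (auto intro: Ck_on_const Ck_on_add assms(1))

lemma Ck_on_linear_comp:
  assumes "open U" "bounded_linear L" "Ck_on k U f"
  shows "Ck_on k U (\<lambda>x. L (f x))"
  using assms(3)
proof (induction k arbitrary: f)
  case 0
  then show ?case using assms(2) by (auto intro: bounded_linear.continuous_on)
next
  case (Suc k)
  show ?case
    by (rule Ck_on_SucI[OF assms(1), where D = "\<lambda>x h. L (frechet_derivative f (at x) h)"])
      (use Suc in \<open>auto intro!: bounded_linear.has_derivative[OF assms(2)] simp: frechet_derivative_works\<close>)
qed

lemma Ck_on_bilinear:
  assumes "open U" "bounded_bilinear B" "Ck_on k U f" "Ck_on k U g"
  shows "Ck_on k U (\<lambda>x. B (f x) (g x))"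
  using assms(3,4)
proof (induction k arbitrary: f g)
  case 0
  then show ?case using assms(2) by (auto intro: bounded_bilinear.continuous_on)
next
  case (Suc k)
  show ?case
  proof (rule Ck_on_SucI[OF assms(1)])
    show "((\<lambda>x. B (f x) (g x)) has_derivative
        (\<lambda>h. B (f x) (frechet_derivative g (at x) h) + B (frechet_derivative f (at x) h) (g x))) (at x)"
      if "x \<in> U" for x
      using that Suc.prems
      by (intro bounded_bilinear.FDERIV[OF assms(2)] Ck_on_Suc_has_derivative)
    show "Ck_on k U (\<lambda>x. B (f x) (frechet_derivative g (at x) b) + B (frechet_derivative f (at x) b) (g x))"
      if "b \<in> Basis" for b
      using Suc.prems that Ck_on_SucD[OF Suc.prems(1)] Ck_on_SucD[OF Suc.prems(2)]
      by (intro Ck_on_add assms(1) Suc.IH) simp_all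
  qed
qed

text \<open>The derivative of a composite is \<open>\<Sum>\<^sub>c (\<partial>\<^sub>b f)\<^sub>c (\<partial>\<^sub>c g) \<circ> f\<close>, in which each factor
  is as smooth as the induction provides.\<close>

lemma Ck_on_compose:
  fixes f :: "'v::euclidean_space \<Rightarrow> 'w::euclidean_space" and g :: "'w \<Rightarrow> 'b::real_normed_vector"
  assumes "open U" "open V" "f ` U \<subseteq> V" "Ck_on k U f" "Ck_on k V g"
  shows "Ck_on k U (\<lambda>x. g (f x))"
  using assms(4,5)
proof (induction k arbitrary: g)
  case 0
  then show ?case using assms(3) by (auto intro: continuous_on_compose2)
next
  case (Suc k)
  let ?f' = "\<lambda>x. frechet_derivative f (at x)" and ?g' = "\<lambda>x. frechet_derivative g (at x)"
  have fU: "f x \<in> V" if "x \<in> U" for x using that assms(3) by blast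
  show ?case
  proof (rule Ck_on_SucI[OF assms(1)])
    fix x assume x: "x \<in> U"
    have "((g \<circ> f) has_derivative (?g' (f x) \<circ> ?f' x)) (at x)"
      using x fU Suc.prems by (intro diff_chain_at Ck_on_Suc_has_derivative)
    moreover have "?g' (f x) \<circ> ?f' x = (\<lambda>h. \<Sum>c\<in>Basis. (?f' x h \<bullet> c) *\<^sub>R ?g' (f x) c)"
    proof
      fix h
      interpret L: linear "?g' (f x)"
        using Suc.prems(2) fU[OF x] by (simp add: linear_frechet_derivative)
      have "?g' (f x) (\<Sum>c\<in>Basis. (?f' x h \<bullet> c) *\<^sub>R c) = (\<Sum>c\<in>Basis. (?f' x h \<bullet> c) *\<^sub>R ?g' (f x) c)"
        by (simp add: L.sum L.scale)
      then show "(?g' (f x) \<circ> ?f' x) h = (\<Sum>c\<in>Basis. (?f' x h \<bullet> c) *\<^sub>R ?g' (f x) c)"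
        by (simp add: euclidean_representation)
    qed
    ultimately show "((\<lambda>x. g (f x)) has_derivative (\<lambda>h. \<Sum>c\<in>Basis. (?f' x h \<bullet> c) *\<^sub>R ?g' (f x) c)) (at x)"
      by (simp add: o_def)
  next
    fix b :: 'v assume b: "b \<in> Basis"
    have "Ck_on k U (\<lambda>x. ?g' (f x) c)" if "c \<in> Basis" for c
      using Suc.prems that Ck_on_SucD[OF Suc.prems(1)] by (intro Suc.IH) simp_all
    then show "Ck_on k U (\<lambda>x. \<Sum>c\<in>Basis. (?f' x b \<bullet> c) *\<^sub>R ?g' (f x) c)"
      using Suc.prems(1) b
      by (intro Ck_on_sum Ck_on_bilinear[OF _ bounded_bilinear_scaleR]
          Ck_on_linear_comp[OF _ bounded_linear_inner_left] assms(1)) simp_all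
  qed
qed

lemma Ck_on_inverse:
  "Ck_on k (- {0}) (inverse :: 'a::{real_normed_field,euclidean_space} \<Rightarrow> 'a)"
proof (induction k)
  case 0
  then show ?case by (auto intro!: continuous_intros)
next
  case (Suc k)
  show ?case
  proof (rule Ck_on_SucI)
    show "(inverse has_derivative (\<lambda>h. - (inverse x * h * inverse x))) (at x)" if "x \<in> - {0}" for x :: 'a
      using has_derivative_inverse'[of x] that by simp
    show "Ck_on k (- {0}) (\<lambda>x::'a. - (inverse x * b * inverse x))" for b
      by (intro Ck_on_linear_comp[OF _ bounded_linear_minus[OF bounded_linear_ident]]
          Ck_on_bilinear[OF _ bounded_bilinear_mult] Ck_on_const Suc) auto
  qed auto
qed

lemma Ck_on_exp: "Ck_on k UNIV (exp :: complex \<Rightarrow> complex)"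
proof (induction k)
  case 0
  then show ?case by (auto intro!: continuous_intros)
next
  case (Suc k)
  show ?case
  proof (rule Ck_on_SucI)
    show "(exp has_derivative (\<lambda>h. exp x * h)) (at x)" for x :: complex
      using DERIV_exp[of x] by (simp add: has_field_derivative_def)
    show "Ck_on k UNIV (\<lambda>x::complex. exp x * b)" for b
      by (intro Ck_on_bilinear[OF _ bounded_bilinear_mult] Ck_on_const Suc) auto
  qed auto
qed

lemma Ck_on_ln: "Ck_on k {0<..} (ln :: real \<Rightarrow> real)"
proof (cases k)
  case 0
  then show ?thesis by (auto intro!: continuous_intros)
next
  case (Suc n)
  show ?thesis unfolding Suc
  proof (rule Ck_on_SucI)
    show "(ln has_derivative (\<lambda>h. inverse x * h)) (at x)" if "x \<in> {0<..}" for x :: real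
      using DERIV_ln[of x] that by (simp add: has_field_derivative_def)
    show "Ck_on n {0<..} (\<lambda>x::real. inverse x * b)" for b
      by (intro Ck_on_bilinear[OF _ bounded_bilinear_mult] Ck_on_const
          Ck_on_subset[OF Ck_on_inverse]) auto
  qed auto
qed

subsection \<open>Smooth cut-off functions\<close>

text \<open>The functions \<open>t\<^sup>-\<^sup>n exp (- 1 / t)\<close>, extended by \<open>0\<close> to \<open>t \<le> 0\<close>, form a family closed under
  differentiation, which is why each of them is smooth, also at \<open>0\<close>.\<close>

definition flat_exp :: "nat \<Rightarrow> real \<Rightarrow> real" where
  "flat_exp n t = (if t > 0 then inverse t ^ n * exp (- inverse t) else 0)"

text \<open>At \<open>0\<close> the difference quotient from the right is \<open>s\<^sup>n\<^sup>+\<^sup>1 / exp s\<close> with \<open>s = 1 / h \<rightarrow> \<infinity>\<close>.\<close>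

lemma has_derivative_flat_exp:
  "(flat_exp n has_real_derivative (flat_exp (n + 2) t - real n * flat_exp (n + 1) t)) (at t)"
proof -
  consider "t > 0" | "t < 0" | "t = 0" by linarith
  then show ?thesis
  proof cases
    case 1
    have "n = 0 \<or> inverse t ^ (n - Suc 0) * inverse t = inverse t ^ n"
      by (cases n) auto
    then have "((\<lambda>t. inverse t ^ n * exp (- inverse t)) has_real_derivative
        (inverse t ^ (n+2) * exp (- inverse t) - real n * (inverse t ^ (n+1) * exp (- inverse t)))) (at t)"
      using 1 by (auto intro!: derivative_eq_intros simp: power2_eq_square algebra_simps)
    then show ?thesis
      by (rule has_field_derivative_transform_within_open[of _ _ _ "{0<..}", THEN DERIV_cong])
        (use 1 in \<open>auto simp: flat_exp_def algebra_simps\<close>)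
  next
    case 2
    have "((\<lambda>t. 0) has_real_derivative 0) (at t)" by simp
    then show ?thesis
      by (rule has_field_derivative_transform_within_open[of _ _ _ "{..<0}", THEN DERIV_cong])
        (use 2 in \<open>auto simp: flat_exp_def\<close>)
  next
    case 3
    have "((\<lambda>h. inverse h ^ (n + 1) / exp (inverse h)) \<longlongrightarrow> 0) (at_right (0::real))"
      using filterlim_compose[OF tendsto_power_div_exp_0 filterlim_inverse_at_top_right] .
    then have R: "((\<lambda>h. flat_exp n h / h) \<longlongrightarrow> 0) (at_right 0)"
      by (rule Lim_transform_eventually)
        (auto simp: eventually_at_filter flat_exp_def exp_minus field_simps)
    have "((\<lambda>h. flat_exp n h / h) \<longlongrightarrow> 0) (at_left 0)"
      by (rule Lim_transform_eventually[OF tendsto_const])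
        (auto simp: eventually_at_filter flat_exp_def)
    with R have "((\<lambda>h. flat_exp n h / h) \<longlongrightarrow> 0) (at 0)"
      by (simp add: filterlim_split_at)
    then show ?thesis unfolding 3 DERIV_def by (simp add: flat_exp_def)
  qed
qed

lemma Ck_on_flat_exp: "Ck_on k UNIV (flat_exp n)"
proof (induction k arbitrary: n)
  case 0
  then show ?case
    using has_derivative_flat_exp
    by (auto intro!: continuous_at_imp_continuous_on DERIV_isCont)
next
  case (Suc k)
  show ?case
  proof (rule Ck_on_SucI)
    show "(flat_exp n has_derivative (\<lambda>h. (flat_exp (n + 2) t + (- real n) * flat_exp (n + 1) t) * h)) (at t)" for t
      using has_derivative_flat_exp[of n t] by (simp add: has_field_derivative_def)
    show "Ck_on k UNIV (\<lambda>t. (flat_exp (n + 2) t + (- real n) * flat_exp (n + 1) t) * b)" for b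
      by (intro Ck_on_bilinear[OF _ bounded_bilinear_mult] Ck_on_add Ck_on_const Suc) auto
  qed auto
qed

definition smooth_step :: "real \<Rightarrow> real" where
  "smooth_step t = flat_exp 0 t * inverse (flat_exp 0 t + flat_exp 0 (1 - t))"

lemma flat_exp_sum_pos: "flat_exp 0 t + flat_exp 0 (1 - t) > 0"
  by (auto simp: flat_exp_def add_pos_pos)

lemma smooth_step_range: "0 \<le> smooth_step t" "smooth_step t \<le> 1"
  using flat_exp_sum_pos[of t]
  by (auto simp: smooth_step_def flat_exp_def field_simps)

lemma smooth_step_0: "t \<le> 0 \<Longrightarrow> smooth_step t = 0"
  by (simp add: smooth_step_def flat_exp_def)

lemma smooth_step_1: "t \<ge> 1 \<Longrightarrow> smooth_step t = 1"
  by (simp add: smooth_step_def flat_exp_def)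

lemma Ck_on_smooth_step: "Ck_on k UNIV smooth_step"
proof -
  have 1: "Ck_on k UNIV (\<lambda>t. flat_exp 0 (1 - t))"
    using Ck_on_compose[OF open_UNIV open_UNIV _ Ck_on_add[OF open_UNIV Ck_on_const[OF open_UNIV, of k 1]
          Ck_on_bounded_linear[OF open_UNIV bounded_linear_minus[OF bounded_linear_ident]]] Ck_on_flat_exp[of k 0]]
    by simp
  have "Ck_on k UNIV (\<lambda>t. inverse (flat_exp 0 t + flat_exp 0 (1 - t)))"
  proof (rule Ck_on_compose[of UNIV "-{0::real}" "\<lambda>t. flat_exp 0 t + flat_exp 0 (1 - t)" k inverse])
    show "range (\<lambda>t. flat_exp 0 t + flat_exp 0 (1 - t)) \<subseteq> - {0}"
      using flat_exp_sum_pos by (metis (no_types, lifting) ComplI empty_iff image_subsetI insert_iff less_irrefl)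
    show "Ck_on k UNIV (\<lambda>t. flat_exp 0 t + flat_exp 0 (1 - t))"
      by (rule Ck_on_add[OF open_UNIV Ck_on_flat_exp 1])
  qed (auto intro: Ck_on_inverse)
  then show ?thesis
    unfolding smooth_step_def[abs_def]
    by (intro Ck_on_bilinear[OF _ bounded_bilinear_mult] Ck_on_flat_exp) auto
qed

text \<open>Equal to \<open>1\<close> on the ball of radius \<open>r\<close> about \<open>a\<close> and to \<open>0\<close> outside the ball of radius \<open>2 r\<close>.\<close>

definition cutoff :: "'v::euclidean_space \<Rightarrow> real \<Rightarrow> 'v \<Rightarrow> real" where
  "cutoff a r y = smooth_step (2 - (y - a) \<bullet> (y - a) / r\<^sup>2)"

lemma Ck_on_cutoff: "Ck_on k UNIV (cutoff a r)"
proof -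
  have d: "Ck_on k UNIV (\<lambda>y. y + (- a))"
    by (intro Ck_on_add Ck_on_ident Ck_on_const) auto
  have "Ck_on k UNIV (\<lambda>y. 2 + (- inverse (r\<^sup>2)) * ((y + (- a)) \<bullet> (y + (- a))))"
    by (intro Ck_on_add Ck_on_bilinear[OF _ bounded_bilinear_mult]
        Ck_on_bilinear[OF _ bounded_bilinear_inner] d Ck_on_const) auto
  from Ck_on_compose[OF _ _ _ this Ck_on_smooth_step] show ?thesis
    unfolding cutoff_def[abs_def] by (simp add: divide_inverse mult.commute)
qed

lemma cutoff_eq_1: "r > 0 \<Longrightarrow> dist y a \<le> r \<Longrightarrow> cutoff a r y = 1"
proof -
  assume "r > 0" "dist y a \<le> r"
  then have "(y - a) \<bullet> (y - a) \<le> r\<^sup>2"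
    by (metis dist_norm norm_ge_zero power2_norm_eq_inner power_mono)
  then show ?thesis unfolding cutoff_def using \<open>r > 0\<close> by (intro smooth_step_1) (simp add: field_simps)
qed

lemma cutoff_eq_0: "r > 0 \<Longrightarrow> dist y a \<ge> 2 * r \<Longrightarrow> cutoff a r y = 0"
proof -
  assume "r > 0" "dist y a \<ge> 2 * r"
  then have "(y - a) \<bullet> (y - a) \<ge> (2 * r)\<^sup>2"
    by (metis dist_norm power2_norm_eq_inner power_mono mult_nonneg_nonneg zero_le_numeral less_imp_le)
  then have "(y - a) \<bullet> (y - a) \<ge> 2 * r\<^sup>2"
    using zero_le_power2[of r] by (auto simp: power_mult_distrib intro: order_trans[of _ "4 * r\<^sup>2"])
  then show ?thesis unfolding cutoff_def using \<open>r > 0\<close> by (intro smooth_step_0) (simp add: field_simps)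
qed

lemma cutoff_range: "0 \<le> cutoff a r y" "cutoff a r y \<le> 1"
  by (simp_all add: cutoff_def smooth_step_range)

subsection \<open>Smoothness at a point, relative to a set\<close>

definition smooth_at :: "'v::euclidean_space set \<Rightarrow> ('v \<Rightarrow> 'b::real_normed_vector) \<Rightarrow> 'v \<Rightarrow> bool" where
  "smooth_at S f x \<longleftrightarrow> (\<exists>U g. open U \<and> x \<in> U \<and> (\<forall>k. Ck_on k U g) \<and> (\<forall>y\<in>S \<inter> U. f y = g y))"

lemma smooth_on_iff_smooth_at: "smooth_on S f \<longleftrightarrow> (\<forall>x\<in>S. smooth_at S f x)"
  by (simp add: smooth_on_def smooth_at_def)

lemma smooth_atI:
  "open U \<Longrightarrow> x \<in> U \<Longrightarrow> (\<And>k. Ck_on k U g) \<Longrightarrow> (\<And>y. y \<in> S \<Longrightarrow> y \<in> U \<Longrightarrow> f y = g y) \<Longrightarrow> smooth_at S f x"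
  unfolding smooth_at_def by blast

lemma smooth_atE:
  assumes "smooth_at S f x"
  obtains U g where "open U" "x \<in> U" "\<And>k. Ck_on k U g" "\<And>y. y \<in> S \<Longrightarrow> y \<in> U \<Longrightarrow> f y = g y"
  using assms unfolding smooth_at_def by blast

lemma smooth_at_cong:
  assumes "smooth_at S f x" "open O'" "x \<in> O'" "\<And>y. y \<in> T \<Longrightarrow> y \<in> O' \<Longrightarrow> y \<in> S \<and> f y = g y"
  shows "smooth_at T g x"
proof -
  from assms(1) obtain U f' where "open U" "x \<in> U" "\<And>k. Ck_on k U f'" "\<And>y. y \<in> S \<Longrightarrow> y \<in> U \<Longrightarrow> f y = f' y"
    by (elim smooth_atE) blast
  then show ?thesis using assms(2-4)
    by (intro smooth_atI[of "U \<inter> O'" x f'])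
      (auto intro: Ck_on_subset[of _ U], metis)
qed

lemma smooth_at_Ck: "open U \<Longrightarrow> x \<in> U \<Longrightarrow> (\<And>k. Ck_on k U f) \<Longrightarrow> smooth_at S f x"
  by (rule smooth_atI[of U x f]) auto

lemma smooth_at_const: "smooth_at S (\<lambda>_. c) x"
  by (rule smooth_at_Ck[of UNIV]) (auto intro: Ck_on_const)

lemma smooth_at_bilinear:
  assumes "bounded_bilinear B" "smooth_at S f x" "smooth_at S g x"
  shows "smooth_at S (\<lambda>y. B (f y) (g y)) x"
proof -
  from assms(2) obtain U f' where U: "open U" "x \<in> U" "\<And>k. Ck_on k U f'" "\<And>y. y \<in> S \<Longrightarrow> y \<in> U \<Longrightarrow> f y = f' y"
    by (elim smooth_atE) blast
  from assms(3) obtain V g' where V: "open V" "x \<in> V" "\<And>k. Ck_on k V g'" "\<And>y. y \<in> S \<Longrightarrow> y \<in> V \<Longrightarrow> g y = g' y"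
    by (elim smooth_atE) blast
  show ?thesis
  proof (rule smooth_atI[of "U \<inter> V" x "\<lambda>y. B (f' y) (g' y)"])
    show "Ck_on k (U \<inter> V) (\<lambda>y. B (f' y) (g' y))" for k
      by (rule Ck_on_bilinear[OF open_Int[OF U(1) V(1)] assms(1) Ck_on_subset[OF U(3)] Ck_on_subset[OF V(3)]]) auto
  qed (use U(1,2,4) V(1,2,4) in auto)
qed

lemma smooth_at_add:
  assumes "smooth_at S f x" "smooth_at S g x"
  shows "smooth_at S (\<lambda>y. f y + g y) x"
proof -
  from assms(1) obtain U f' where U: "open U" "x \<in> U" "\<And>k. Ck_on k U f'" "\<And>y. y \<in> S \<Longrightarrow> y \<in> U \<Longrightarrow> f y = f' y"
    by (elim smooth_atE) blast
  from assms(2) obtain V g' where V: "open V" "x \<in> V" "\<And>k. Ck_on k V g'" "\<And>y. y \<in> S \<Longrightarrow> y \<in> V \<Longrightarrow> g y = g' y"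
    by (elim smooth_atE) blast
  show ?thesis
  proof (rule smooth_atI[of "U \<inter> V" x "\<lambda>y. f' y + g' y"])
    show "Ck_on k (U \<inter> V) (\<lambda>y. f' y + g' y)" for k
      by (rule Ck_on_add[OF open_Int[OF U(1) V(1)] Ck_on_subset[OF U(3)] Ck_on_subset[OF V(3)]]) auto
  qed (use U(1,2,4) V(1,2,4) in auto)
qed

lemma smooth_at_linear_comp:
  assumes "bounded_linear L" "smooth_at S f x"
  shows "smooth_at S (\<lambda>y. L (f y)) x"
proof -
  from assms(2) obtain U f' where U: "open U" "x \<in> U" "\<And>k. Ck_on k U f'" "\<And>y. y \<in> S \<Longrightarrow> y \<in> U \<Longrightarrow> f y = f' y"
    by (elim smooth_atE) blast
  show ?thesis
    by (rule smooth_atI[OF U(1,2) Ck_on_linear_comp[OF U(1) assms(1) U(3)]]) (simp add: U(4))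
qed

lemma smooth_at_compose:
  fixes f :: "'v::euclidean_space \<Rightarrow> 'w::euclidean_space"
  assumes "smooth_at S f x" "smooth_at T g (f x)" "x \<in> S" "\<And>y. y \<in> S \<Longrightarrow> f y \<in> T"
  shows "smooth_at S (\<lambda>y. g (f y)) x"
proof -
  from assms(1) obtain U f' where U: "open U" "x \<in> U" "\<And>k. Ck_on k U f'" "\<And>y. y \<in> S \<Longrightarrow> y \<in> U \<Longrightarrow> f y = f' y"
    by (elim smooth_atE) blast
  from assms(2) obtain V g' where V: "open V" "f x \<in> V" "\<And>k. Ck_on k V g'" "\<And>y. y \<in> T \<Longrightarrow> y \<in> V \<Longrightarrow> g y = g' y"
    by (elim smooth_atE) blast
  define W where "W = U \<inter> f' -` V"
  have "open W" unfolding W_def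
    using Ck_on_imp_continuous[OF U(3)] U(1) V(1) by (metis continuous_open_preimage)
  moreover have "x \<in> W" using U V assms(3) by (auto simp: W_def)
  moreover have "Ck_on k W (\<lambda>y. g' (f' y))" for k
    by (rule Ck_on_compose[OF \<open>open W\<close> V(1)]) (auto simp: W_def intro!: V(3) Ck_on_subset[OF U(3)])
  ultimately show ?thesis
    by (rule smooth_atI) (use U(4) V(4) assms(4) in \<open>fastforce simp: W_def\<close>)
qed

lemma smooth_at_imp_continuous:
  assumes "smooth_at S f x" "x \<in> S"
  shows "continuous (at x within S) f"
proof -
  from assms(1) obtain U g where U: "open U" "x \<in> U" "\<And>k. Ck_on k U g" "\<And>y. y \<in> S \<Longrightarrow> y \<in> U \<Longrightarrow> f y = g y"
    by (elim smooth_atE) blast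
  have "continuous (at x within S) g"
    using Ck_on_imp_continuous[OF U(3)] U(1,2) by (metis continuous_on_eq_continuous_at continuous_at_imp_continuous_at_within)
  moreover have "eventually (\<lambda>y. g y = f y) (at x within S)"
    using U by (auto simp: eventually_at_topological)
  ultimately show ?thesis
    unfolding continuous_within U(4)[OF assms(2) U(2)] by (rule Lim_transform_eventually)
qed

lemma smooth_at_imp_has_derivative:
  assumes "smooth_at S f x" "x \<in> S"
  shows "(f has_derivative frechet_derivative f (at x within S)) (at x within S)"
proof -
  from assms(1) obtain U g where U: "open U" "x \<in> U" "\<And>k. Ck_on k U g" "\<And>y. y \<in> S \<Longrightarrow> y \<in> U \<Longrightarrow> f y = g y"
    by (elim smooth_atE) blast
  have "(g has_derivative frechet_derivative g (at x)) (at x within S)"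
    using Ck_on_Suc_has_derivative[OF U(3) U(2)] has_derivative_at_withinI by blast
  moreover obtain e where "e > 0" "ball x e \<subseteq> U" using U(1,2) openE by blast
  ultimately have "(f has_derivative frechet_derivative g (at x)) (at x within S)"
    by (elim has_derivative_transform_within[where d=e])
      (use U(4) assms(2) \<open>ball x e \<subseteq> U\<close> in \<open>auto simp: subset_iff dist_commute\<close>)
  then show ?thesis unfolding frechet_derivative_works[symmetric] differentiable_def by blast
qed

section \<open>The half-space\<close>

lemma normal_dir_Basis: "normal_dir \<in> (Basis :: 'v::euclidean_space set)"
  unfolding normal_dir_def using nonempty_Basis by (metis all_not_in_conv someI_ex)

lemma inner_normal_dir_Basis: "b \<in> Basis \<Longrightarrow> b \<bullet> normal_dir = (if b = normal_dir then 1 else 0)"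
  by (simp add: inner_Basis normal_dir_Basis)

abbreviation rel_open :: "'v::euclidean_space set \<Rightarrow> bool" where
  "rel_open T \<equiv> openin (top_of_set half_space) T"

lemma rel_open_subset: "rel_open T \<Longrightarrow> y \<in> T \<Longrightarrow> 0 \<le> y \<bullet> normal_dir"
  by (auto simp: half_space_def dest!: openin_imp_subset)

lemma rel_openE:
  assumes "rel_open T" "y \<in> T"
  obtains O' where "open O'" "y \<in> O'" "half_space \<inter> O' = T"
proof -
  obtain O' where O: "open O'" "T = half_space \<inter> O'"
    using assms(1) unfolding openin_open by blast
  with assms(2) show thesis by (intro that[of O']) blast+
qed

lemma rel_open_shift:
  assumes "rel_open T" "y \<in> T" "b \<in> Basis"
  shows "\<exists>e>0. \<forall>t. 0 \<le> t \<and> t < e \<longrightarrow> y + t *\<^sub>R b \<in> T"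
proof -
  obtain O' where O: "open O'" "y \<in> O'" "half_space \<inter> O' = T"
    using rel_openE[OF assms(1,2)] .
  obtain e where e: "e > 0" "ball y e \<subseteq> O'" using O(1,2) openE by blast
  have "y + t *\<^sub>R b \<in> T" if "0 \<le> t" "t < e" for t
  proof -
    have "y + t *\<^sub>R b \<in> ball y e" using that assms(3) by (simp add: dist_norm)
    moreover have "y + t *\<^sub>R b \<in> half_space"
      using rel_open_subset[OF assms(1,2)] that
      by (simp add: half_space_def inner_add_left inner_normal_dir_Basis[OF assms(3)])
    ultimately show ?thesis using e O by blast
  qed
  then show ?thesis using e(1) by blast
qed

text \<open>At a point of the bounding hyperplane only inward steps are available in the normal direction, but
  each coordinate direction still has small steps of one sign, which is enough for uniqueness.\<close>

lemma rel_open_has_derivative_unique: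
  assumes "rel_open T" "y \<in> T" "(f has_derivative D) (at y within T)" "(f has_derivative D') (at y within T)"
  shows "D = D'"
proof (rule frechet_derivative_unique_within[OF assms(3,4)])
  fix b :: 'a and e :: real assume b: "b \<in> Basis" "e > 0"
  obtain e' where "e' > 0" "\<And>t. 0 \<le> t \<and> t < e' \<Longrightarrow> y + t *\<^sub>R b \<in> T"
    using rel_open_shift[OF assms(1,2) b(1)] by blast
  then show "\<exists>d. 0 < \<bar>d\<bar> \<and> \<bar>d\<bar> < e \<and> y + d *\<^sub>R b \<in> T"
    using b(2) by (intro exI[of _ "min e e' / 2"]) auto
qed

lemma rel_open_frechet_derivative:
  assumes "rel_open T" "y \<in> T" "(f has_derivative D) (at y within T)"
  shows "frechet_derivative f (at y within T) = D"
proof -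
  have "f differentiable (at y within T)" using assms(3) by (rule differentiableI)
  then show ?thesis
    using rel_open_has_derivative_unique[OF assms(1,2) _ assms(3)] by (simp add: frechet_derivative_works)
qed

lemma rel_open_interior:
  assumes "rel_open T" "y \<in> T" "0 < y \<bullet> normal_dir"
  obtains O' where "open O'" "y \<in> O'" "O' \<subseteq> T" "\<And>z. z \<in> O' \<Longrightarrow> 0 < z \<bullet> normal_dir"
proof -
  obtain O' where O: "open O'" "y \<in> O'" "half_space \<inter> O' = T"
    using rel_openE[OF assms(1,2)] .
  have "open {z::'a. 0 < z \<bullet> normal_dir}"
    using open_halfspace_gt[of 0 normal_dir] by (simp add: inner_commute)
  then show thesis
    by (intro that[of "O' \<inter> {z. 0 < z \<bullet> normal_dir}"]) (use O assms in \<open>auto simp: half_space_def\<close>)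
qed

text \<open>By uniqueness, the derivative within a relatively open set agrees with that of any smooth extension,
  so smoothness up to the boundary passes to derivatives.\<close>

lemma smooth_at_frechet_derivative:
  assumes "rel_open T" "y \<in> T" "smooth_at T f y" "b \<in> Basis"
  shows "smooth_at T (\<lambda>z. frechet_derivative f (at z within T) b) y"
proof -
  obtain U g where U: "open U" "y \<in> U" "\<And>k. Ck_on k U g" "\<And>z. z \<in> T \<Longrightarrow> z \<in> U \<Longrightarrow> f z = g z"
    using assms(3) by (elim smooth_atE) blast
  show ?thesis
  proof (rule smooth_atI[OF U(1,2)])
    show "Ck_on k U (\<lambda>z. frechet_derivative g (at z) b)" for k
      using U(3)[of "Suc k"] assms(4) by simp
    fix z assume z: "z \<in> T" "z \<in> U"
    obtain e where e: "e > 0" "ball z e \<subseteq> U" using U(1) z(2) openE by blast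
    have "(g has_derivative frechet_derivative g (at z)) (at z within T)"
      using Ck_on_Suc_has_derivative[OF U(3) z(2)] has_derivative_at_withinI by blast
    then have "(f has_derivative frechet_derivative g (at z)) (at z within T)"
      by (rule has_derivative_transform_within[OF _ e(1) z(1)])
        (use U(4) e in \<open>auto simp: subset_iff dist_commute\<close>)
    then show "frechet_derivative f (at z within T) b = frechet_derivative g (at z) b"
      using rel_open_frechet_derivative[OF assms(1) z(1)] by metis
  qed
qed

section \<open>Smooth functions on the manifold\<close>

locale bmanifold =
  fixes \<A> :: "('a::t2_space, 'v::euclidean_space) atlas" and \<rho> :: "'a \<Rightarrow> real"
  assumes compact_UNIV: "compact (UNIV :: 'a set)"
    and atlas: "smooth_atlas \<A>"
    and defining: "defining_function \<A> \<rho>"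
begin

abbreviation bd :: "'a set" where "bd \<equiv> mboundary \<A>"

lemma chart_exists: obtains U \<phi> where "(U, \<phi>) \<in> \<A>" "p \<in> U"
proof -
  have "p \<in> \<Union> (fst ` \<A>)" using atlas by (simp add: smooth_atlas_def)
  then show thesis using that by auto
qed

lemma
  assumes "(U, \<phi>) \<in> \<A>"
  shows chart_open: "open U"
    and chart_rel_open: "rel_open (\<phi> ` U)"
    and chart_homeo: "homeomorphism U (\<phi> ` U) \<phi> (inv_into U \<phi>)"
    and chart_inj: "inj_on \<phi> U"
    and chart_inv[simp]: "x \<in> U \<Longrightarrow> inv_into U \<phi> (\<phi> x) = x"
proof -
  show h: "homeomorphism U (\<phi> ` U) \<phi> (inv_into U \<phi>)" and "open U" "rel_open (\<phi> ` U)"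
    using assms atlas by (auto simp: smooth_atlas_def)
  show i: "x \<in> U \<Longrightarrow> inv_into U \<phi> (\<phi> x) = x" for x
    using h by (simp add: homeomorphism_def)
  then show "inj_on \<phi> U" by (metis inj_onI)
qed

lemma chart_rel_open_Int:
  assumes "(U, \<phi>) \<in> \<A>" "open W"
  shows "rel_open (\<phi> ` (U \<inter> W))"
proof -
  have "openin (top_of_set U) (U \<inter> W)" using assms(2) by (simp add: openin_open_Int)
  then have "openin (top_of_set (\<phi> ` U)) (\<phi> ` (U \<inter> W))"
    using chart_homeo[OF assms(1)] homeomorphism_imp_open_map by blast
  then show ?thesis using chart_rel_open[OF assms(1)] openin_trans by blast
qed

lemma chart_preimage_open:
  assumes "(U, \<phi>) \<in> \<A>" "open W"
  shows "open {x \<in> U. \<phi> x \<in> W}"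
proof -
  have "continuous_on U \<phi>" using chart_homeo[OF assms(1)] by (simp add: homeomorphism_def)
  then have "open (U \<inter> \<phi> -` W)" using chart_open[OF assms(1)] assms(2) continuous_open_preimage by blast
  moreover have "U \<inter> \<phi> -` W = {x \<in> U. \<phi> x \<in> W}" by auto
  ultimately show ?thesis by simp
qed

lemma chart_nbhd:
  assumes "(U, \<phi>) \<in> \<A>" "open W" "p \<in> U" "p \<in> W"
  obtains O' where "open O'" "\<phi> p \<in> O'" "\<And>y. y \<in> \<phi> ` U \<Longrightarrow> y \<in> O' \<Longrightarrow> inv_into U \<phi> y \<in> W"
    "half_space \<inter> O' = \<phi> ` (U \<inter> W)"
proof -
  obtain O' where O: "open O'" "\<phi> p \<in> O'" "half_space \<inter> O' = \<phi> ` (U \<inter> W)"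
    using rel_openE[OF chart_rel_open_Int[OF assms(1,2)], of "\<phi> p"] assms(3,4) by blast
  have "inv_into U \<phi> y \<in> W" if "y \<in> \<phi> ` U" "y \<in> O'" for y
  proof -
    have "y \<in> half_space" using that openin_imp_subset[OF chart_rel_open[OF assms(1)]] by blast
    then have "y \<in> \<phi> ` (U \<inter> W)" using that O(3) by blast
    then show ?thesis using assms(1) by auto
  qed
  then show thesis using that O by blast
qed

lemma chart_transition:
  assumes "(U, \<phi>) \<in> \<A>" "(V, \<psi>) \<in> \<A>"
  shows "smooth_on (\<phi> ` (U \<inter> V)) (\<psi> \<circ> inv_into U \<phi>)"
proof -
  have "\<forall>(U, \<phi>)\<in>\<A>. \<forall>(V, \<psi>)\<in>\<A>. smooth_on (\<phi> ` (U \<inter> V)) (\<psi> \<circ> inv_into U \<phi>)"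
    using atlas unfolding smooth_atlas_def by blast
  from bspec[OF this assms(1)] have "\<forall>(V, \<psi>)\<in>\<A>. smooth_on (\<phi> ` (U \<inter> V)) (\<psi> \<circ> inv_into U \<phi>)" by simp
  from bspec[OF this assms(2)] show ?thesis by simp
qed

text \<open>Smoothness as a pointwise notion, tested in one chart. The transition maps make the choice of the chart
  irrelevant, and constructions by gluing become local.\<close>

definition msmooth_at :: "'a set \<Rightarrow> ('a \<Rightarrow> 'b::real_normed_vector) \<Rightarrow> 'a \<Rightarrow> bool" where
  "msmooth_at S f p \<longleftrightarrow> (\<exists>(U, \<phi>)\<in>\<A>. p \<in> U \<and> smooth_at (\<phi> ` (U \<inter> S)) (f \<circ> inv_into U \<phi>) (\<phi> p))"

lemma msmooth_atI: "(U, \<phi>) \<in> \<A> \<Longrightarrow> p \<in> U \<Longrightarrow> smooth_at (\<phi> ` (U \<inter> S)) (f \<circ> inv_into U \<phi>) (\<phi> p) \<Longrightarrow> msmooth_at S f p"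
  unfolding msmooth_at_def by blast

lemma msmooth_at_cong:
  assumes "msmooth_at S f p" "open W" "p \<in> W" "\<And>x. x \<in> T \<Longrightarrow> x \<in> W \<Longrightarrow> x \<in> S \<and> f x = g x"
  shows "msmooth_at T g p"
proof -
  obtain U \<phi> where c: "(U, \<phi>) \<in> \<A>" "p \<in> U" "smooth_at (\<phi> ` (U \<inter> S)) (f \<circ> inv_into U \<phi>) (\<phi> p)"
    using assms(1) unfolding msmooth_at_def by blast
  obtain O' where O: "open O'" "\<phi> p \<in> O'" "\<And>y. y \<in> \<phi> ` U \<Longrightarrow> y \<in> O' \<Longrightarrow> inv_into U \<phi> y \<in> W"
    using chart_nbhd[OF c(1) assms(2) c(2) assms(3)] by metis
  show ?thesis
  proof (rule msmooth_atI[OF c(1,2)], rule smooth_at_cong[OF c(3) O(1,2)])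
    fix y assume y: "y \<in> \<phi> ` (U \<inter> T)" "y \<in> O'"
    then obtain x where x: "x \<in> U" "x \<in> T" "y = \<phi> x" by blast
    then have "x \<in> W" using O(3)[of y] y(2) c(1) by auto
    then show "y \<in> \<phi> ` (U \<inter> S) \<and> (f \<circ> inv_into U \<phi>) y = (g \<circ> inv_into U \<phi>) y"
      using assms(4)[of x] x c(1) by auto
  qed
qed

lemma msmooth_at_chart:
  assumes "msmooth_at S f p" "p \<in> S" "(V, \<psi>) \<in> \<A>" "p \<in> V"
  shows "smooth_at (\<psi> ` (V \<inter> S)) (f \<circ> inv_into V \<psi>) (\<psi> p)"
proof -
  obtain U \<phi> where c: "(U, \<phi>) \<in> \<A>" "p \<in> U" "smooth_at (\<phi> ` (U \<inter> S)) (f \<circ> inv_into U \<phi>) (\<phi> p)"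
    using assms(1) unfolding msmooth_at_def by blast
  obtain O' where O: "open O'" "\<psi> p \<in> O'" "\<And>y. y \<in> \<psi> ` V \<Longrightarrow> y \<in> O' \<Longrightarrow> inv_into V \<psi> y \<in> U"
    using chart_nbhd[OF assms(3) chart_open[OF c(1)] assms(4) c(2)] by metis
  let ?T = "\<psi> ` (V \<inter> U \<inter> S)"
  have "smooth_at (\<psi> ` (V \<inter> U)) (\<phi> \<circ> inv_into V \<psi>) (\<psi> p)"
    using chart_transition[OF assms(3) c(1)] assms(4) c(2) by (auto simp: smooth_on_iff_smooth_at)
  then have 1: "smooth_at ?T (\<phi> \<circ> inv_into V \<psi>) (\<psi> p)"
    by (rule smooth_at_cong[of _ _ _ UNIV]) auto
  have "smooth_at ?T (\<lambda>y. (f \<circ> inv_into U \<phi>) ((\<phi> \<circ> inv_into V \<psi>) y)) (\<psi> p)"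
    by (rule smooth_at_compose[OF 1, where T = "\<phi> ` (U \<inter> S)"])
      (use c assms(2-4) in \<open>auto simp: o_def\<close>)
  then show ?thesis
  proof (rule smooth_at_cong[OF _ O(1,2)])
    fix y assume y: "y \<in> \<psi> ` (V \<inter> S)" "y \<in> O'"
    then obtain x where x: "x \<in> V" "x \<in> S" "y = \<psi> x" by blast
    then have "x \<in> U" using O(3)[of y] y(2) assms(3) by auto
    then show "y \<in> ?T \<and> (f \<circ> inv_into U \<phi>) ((\<phi> \<circ> inv_into V \<psi>) y) = (f \<circ> inv_into V \<psi>) y"
      using x c(1) assms(3) by auto
  qed
qed

lemma msmooth_on_iff_msmooth_at: "msmooth_on \<A> S f \<longleftrightarrow> (\<forall>p\<in>S. msmooth_at S f p)"
proof
  assume f: "msmooth_on \<A> S f"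
  show "\<forall>p\<in>S. msmooth_at S f p"
  proof
    fix p assume p: "p \<in> S"
    obtain U \<phi> where c: "(U, \<phi>) \<in> \<A>" "p \<in> U" by (rule chart_exists)
    then show "msmooth_at S f p" using f p
      by (intro msmooth_atI[OF c]) (auto simp: msmooth_on_def smooth_on_iff_smooth_at)
  qed
next
  assume "\<forall>p\<in>S. msmooth_at S f p"
  then show "msmooth_on \<A> S f"
    using msmooth_at_chart by (fastforce simp: msmooth_on_def smooth_on_iff_smooth_at)
qed

lemma msmooth_at_const: "msmooth_at S (\<lambda>_. c) p"
proof -
  obtain U \<phi> where "(U, \<phi>) \<in> \<A>" "p \<in> U" by (rule chart_exists)
  then show ?thesis by (rule msmooth_atI) (simp add: o_def smooth_at_const)
qed

lemma msmooth_at_bilinear: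
  assumes "bounded_bilinear B" "msmooth_at S f p" "msmooth_at S g p" "p \<in> S"
  shows "msmooth_at S (\<lambda>x. B (f x) (g x)) p"
proof -
  obtain U \<phi> where c: "(U, \<phi>) \<in> \<A>" "p \<in> U" by (rule chart_exists)
  show ?thesis
    using smooth_at_bilinear[OF assms(1) msmooth_at_chart[OF assms(2,4) c] msmooth_at_chart[OF assms(3,4) c]]
    by (intro msmooth_atI[OF c]) (simp add: o_def)
qed

lemma msmooth_at_add:
  assumes "msmooth_at S f p" "msmooth_at S g p" "p \<in> S"
  shows "msmooth_at S (\<lambda>x. f x + g x) p"
proof -
  obtain U \<phi> where c: "(U, \<phi>) \<in> \<A>" "p \<in> U" by (rule chart_exists)
  show ?thesis
    using smooth_at_add[OF msmooth_at_chart[OF assms(1,3) c] msmooth_at_chart[OF assms(2,3) c]]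
    by (intro msmooth_atI[OF c]) (simp add: o_def)
qed

lemma msmooth_at_linear:
  assumes "bounded_linear L" "msmooth_at S f p"
  shows "msmooth_at S (\<lambda>x. L (f x)) p"
proof -
  obtain U \<phi> where c: "(U, \<phi>) \<in> \<A>" "p \<in> U" "smooth_at (\<phi> ` (U \<inter> S)) (f \<circ> inv_into U \<phi>) (\<phi> p)"
    using assms(2) unfolding msmooth_at_def by blast
  show ?thesis
    using smooth_at_linear_comp[OF assms(1) c(3)] by (intro msmooth_atI[OF c(1,2)]) (simp add: o_def)
qed

lemma msmooth_at_compose:
  fixes f :: "'a \<Rightarrow> 'w::euclidean_space"
  assumes "msmooth_at S f p" "smooth_at UNIV g (f p)" "p \<in> S"
  shows "msmooth_at S (\<lambda>x. g (f x)) p"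
proof -
  obtain U \<phi> where c: "(U, \<phi>) \<in> \<A>" "p \<in> U" "smooth_at (\<phi> ` (U \<inter> S)) (f \<circ> inv_into U \<phi>) (\<phi> p)"
    using assms(1) unfolding msmooth_at_def by blast
  have "smooth_at (\<phi> ` (U \<inter> S)) (\<lambda>y. g ((f \<circ> inv_into U \<phi>) y)) (\<phi> p)"
    by (rule smooth_at_compose[OF c(3), of UNIV]) (use assms c in auto)
  then show ?thesis by (intro msmooth_atI[OF c(1,2)]) (simp add: o_def)
qed

lemma msmooth_at_mult: "msmooth_at S f p \<Longrightarrow> msmooth_at S g p \<Longrightarrow> p \<in> S \<Longrightarrow> msmooth_at S (\<lambda>x. f x * g x :: 'c::real_normed_algebra) p"
  by (rule msmooth_at_bilinear[OF bounded_bilinear_mult])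

lemma msmooth_at_uminus: "msmooth_at S f p \<Longrightarrow> msmooth_at S (\<lambda>x. - f x) p"
  by (rule msmooth_at_linear[OF bounded_linear_minus[OF bounded_linear_ident]])

lemma msmooth_at_diff: "msmooth_at S f p \<Longrightarrow> msmooth_at S g p \<Longrightarrow> p \<in> S \<Longrightarrow> msmooth_at S (\<lambda>x. f x - g x) p"
  using msmooth_at_add[of S f p "\<lambda>x. - g x"] msmooth_at_uminus[of S g p] by simp

lemma msmooth_at_cnj: "msmooth_at S f p \<Longrightarrow> msmooth_at S (\<lambda>x. cnj (f x)) p"
  by (rule msmooth_at_linear[OF bounded_linear_cnj])

lemma msmooth_at_of_real: "msmooth_at S f p \<Longrightarrow> msmooth_at S (\<lambda>x. complex_of_real (f x)) p"
  by (rule msmooth_at_linear[OF bounded_linear_of_real])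

lemma msmooth_at_sum: "(\<And>i. i \<in> I \<Longrightarrow> msmooth_at S (f i) p) \<Longrightarrow> p \<in> S \<Longrightarrow> msmooth_at S (\<lambda>x. \<Sum>i\<in>I. f i x) p"
  by (induction I rule: infinite_finite_induct) (auto intro: msmooth_at_const msmooth_at_add)

lemma msmooth_at_inverse:
  fixes f :: "'a \<Rightarrow> 'c::{real_normed_field,euclidean_space}"
  shows "msmooth_at S f p \<Longrightarrow> p \<in> S \<Longrightarrow> f p \<noteq> 0 \<Longrightarrow> msmooth_at S (\<lambda>x. inverse (f x)) p"
  by (rule msmooth_at_compose) (auto intro: smooth_at_Ck[of "-{0}"] Ck_on_inverse)

lemma msmooth_at_isCont:
  assumes "msmooth_at S f p" "open S" "p \<in> S"
  shows "isCont f p"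
proof -
  obtain U \<phi> where c: "(U, \<phi>) \<in> \<A>" "p \<in> U" "smooth_at (\<phi> ` (U \<inter> S)) (f \<circ> inv_into U \<phi>) (\<phi> p)"
    using assms(1) unfolding msmooth_at_def by blast
  have oS: "open (U \<inter> S)" using c(1) assms(2) chart_open by blast
  have "continuous_on U \<phi>" using chart_homeo[OF c(1)] by (simp add: homeomorphism_def)
  then have 1: "continuous (at p within U \<inter> S) \<phi>"
    using c(2) assms(3) by (meson IntI continuous_on_eq_continuous_within continuous_on_subset inf_le1)
  have 2: "continuous (at (\<phi> p) within \<phi> ` (U \<inter> S)) (f \<circ> inv_into U \<phi>)"
    using smooth_at_imp_continuous[OF c(3)] c(2) assms(3) by blast
  have "continuous (at p within U \<inter> S) ((f \<circ> inv_into U \<phi>) \<circ> \<phi>)"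
    by (rule continuous_within_compose[OF 1 2])
  then have "isCont ((f \<circ> inv_into U \<phi>) \<circ> \<phi>) p"
    using at_within_open[OF _ oS, of p] c(2) assms(3) by simp
  moreover have "\<forall>\<^sub>F x in nhds p. ((f \<circ> inv_into U \<phi>) \<circ> \<phi>) x = f x"
    unfolding eventually_nhds by (rule exI[of _ "U \<inter> S"]) (use oS c(1,2) assms(3) in simp)
  ultimately show ?thesis using isCont_cong by blast
qed

lemma rho_smooth: "msmooth_at UNIV \<rho> p"
  using defining by (simp add: defining_function_def msmooth_on_iff_msmooth_at)

lemma rho_isCont: "isCont \<rho> p"
  using msmooth_at_isCont[OF rho_smooth] by simp

lemma rho_bd: "\<rho> p = 0 \<longleftrightarrow> p \<in> bd"
  and rho_pos: "p \<notin> bd \<Longrightarrow> \<rho> p > 0"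
proof -
  have *: "\<forall>p. p \<notin> bd \<longrightarrow> \<rho> p > 0" "\<forall>p\<in>bd. \<rho> p = 0"
    using defining unfolding defining_function_def by blast+
  show "p \<notin> bd \<Longrightarrow> \<rho> p > 0" using *(1) by blast
  show "\<rho> p = 0 \<longleftrightarrow> p \<in> bd" using * less_irrefl by metis
qed

lemma rho_nonneg: "\<rho> p \<ge> 0"
  using rho_bd[of p] rho_pos[of p] by fastforce

lemma closed_bd: "closed bd"
proof -
  have "bd = \<rho> -` {0}" using rho_bd by auto
  moreover have "continuous_on UNIV \<rho>" using rho_isCont by (simp add: continuous_at_imp_continuous_on)
  ultimately show ?thesis by (metis closed_singleton closed_vimage)
qed

text \<open>At a boundary point \<open>\<rho>\<close> has a minimum. If a chart mapped the point into the open half-space, the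
  derivative of \<open>\<rho>\<close> would therefore vanish there.\<close>

lemma bd_chart:
  assumes "(U, \<phi>) \<in> \<A>" "p \<in> U"
  shows "p \<in> bd \<longleftrightarrow> \<phi> p \<bullet> normal_dir = 0"
proof
  assume "\<phi> p \<bullet> normal_dir = 0" then show "p \<in> bd" using assms unfolding mboundary_def by blast
next
  assume p: "p \<in> bd"
  show "\<phi> p \<bullet> normal_dir = 0"
  proof (rule ccontr)
    assume "\<phi> p \<bullet> normal_dir \<noteq> 0"
    moreover have y: "\<phi> p \<in> \<phi> ` U" using assms by blast
    ultimately have "0 < \<phi> p \<bullet> normal_dir" using rel_open_subset[OF chart_rel_open[OF assms(1)] y] by simp
    then obtain O' where O: "open O'" "\<phi> p \<in> O'" "O' \<subseteq> \<phi> ` U"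
      using rel_open_interior[OF chart_rel_open[OF assms(1)] y] by metis
    let ?g = "\<rho> \<circ> inv_into U \<phi>"
    define D where "D = frechet_derivative ?g (at (\<phi> p) within \<phi> ` U)"
    have D: "(?g has_derivative D) (at (\<phi> p) within \<phi> ` U)"
      unfolding D_def using msmooth_at_chart[OF rho_smooth _ assms] y by (intro smooth_at_imp_has_derivative) auto
    then have "(?g has_derivative D) (at (\<phi> p))"
      using has_derivative_subset[OF D O(3)] at_within_open[OF O(2,1)] by metis
    then have "D = (\<lambda>_. 0)"
      by (rule differential_zero_maxmin[OF O(2,1)])
        (use p assms rho_nonneg rho_bd[of p] in auto)
    then show False using D defining assms p unfolding defining_function_def by fastforce
  qed
qed

lemma interior_dense:
  assumes "open W" "p \<in> W"
  obtains x where "x \<in> W" "x \<notin> bd"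
proof -
  obtain U \<phi> where c: "(U, \<phi>) \<in> \<A>" "p \<in> U" by (rule chart_exists)
  obtain e where e: "e > 0" "\<And>t. 0 \<le> t \<and> t < e \<Longrightarrow> \<phi> p + t *\<^sub>R normal_dir \<in> \<phi> ` (U \<inter> W)"
    using rel_open_shift[OF chart_rel_open_Int[OF c(1) assms(1)] _ normal_dir_Basis, of "\<phi> p"] c(2) assms(2) by blast
  from e(2)[of "e/2"] e(1) obtain x where x: "x \<in> U" "x \<in> W" "\<phi> x = \<phi> p + (e/2) *\<^sub>R normal_dir" by auto
  have "\<phi> x \<bullet> normal_dir > 0"
    using x(3) e(1) rel_open_subset[OF chart_rel_open[OF c(1)], of "\<phi> p"] c(2)
    by (simp add: inner_add_left inner_normal_dir_Basis[OF normal_dir_Basis])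
  then show thesis using that[of x] x bd_chart[OF c(1) x(1)] by auto
qed

text \<open>Identities proved in the interior extend to the boundary by continuity, since the interior is dense.\<close>

lemma zero_by_density:
  fixes f :: "'a \<Rightarrow> 'b::real_normed_vector"
  assumes "open W" "p \<in> W" "isCont f p" "\<And>x. x \<in> W \<Longrightarrow> x \<notin> bd \<Longrightarrow> f x = 0"
  shows "f p = 0"
proof (rule ccontr)
  assume n: "f p \<noteq> 0"
  then have "eventually (\<lambda>x. f x \<noteq> 0) (at p)"
    using assms(3) tendsto_imp_eventually_ne unfolding isCont_def by blast
  then obtain V where V: "open V" "p \<in> V" "\<And>x. x \<in> V \<Longrightarrow> x \<noteq> p \<Longrightarrow> f x \<noteq> 0"
    unfolding eventually_at_topological by blast
  obtain x where "x \<in> V \<inter> W" "x \<notin> bd"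
    using interior_dense[of "V \<inter> W" p] V assms(1,2) by blast
  then show False using V(3)[of x] assms(4)[of x] n by auto
qed

subsection \<open>Bump functions and partitions of unity\<close>

text \<open>A cut-off function in a chart extends smoothly by \<open>0\<close> because its support in the chart is compact,
  hence closed in the Hausdorff space \<open>'a\<close>.\<close>

lemma bump:
  assumes "open W" "p \<in> W"
  obtains \<eta> :: "'a \<Rightarrow> real" and V where "\<And>x. msmooth_at UNIV \<eta> x" "\<And>x. 0 \<le> \<eta> x"
    "open V" "p \<in> V" "V \<subseteq> W" "\<And>x. x \<in> V \<Longrightarrow> \<eta> x = 1" "closure {x. \<eta> x \<noteq> 0} \<subseteq> W"
proof -
  obtain U \<phi> where c: "(U, \<phi>) \<in> \<A>" "p \<in> U" by (rule chart_exists)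
  obtain O' where O: "open O'" "\<phi> p \<in> O'" "half_space \<inter> O' = \<phi> ` (U \<inter> W)"
    using chart_nbhd[OF c(1) assms(1) c(2) assms(2)] by metis
  obtain e where e: "e > 0" "ball (\<phi> p) e \<subseteq> O'" using O openE by blast
  define r where "r = e / 3"
  have r: "r > 0" "cball (\<phi> p) (2 * r) \<subseteq> O'" using e by (auto simp: r_def)
  define \<eta> where "\<eta> x = (if x \<in> U then cutoff (\<phi> p) r (\<phi> x) else 0)" for x
  define K where "K = inv_into U \<phi> ` (half_space \<inter> cball (\<phi> p) (2 * r))"
  have sub: "half_space \<inter> cball (\<phi> p) (2 * r) \<subseteq> \<phi> ` (U \<inter> W)" using O r by blast
  have "closed (half_space :: 'v set)"
    using closed_halfspace_ge[of 0 normal_dir] by (simp add: half_space_def inner_commute)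
  then have "compact (half_space \<inter> cball (\<phi> p) (2 * r))" by (rule closed_Int_compact) auto
  moreover have "continuous_on (half_space \<inter> cball (\<phi> p) (2 * r)) (inv_into U \<phi>)"
    by (rule continuous_on_subset[of "\<phi> ` U"]) (use chart_homeo[OF c(1)] sub in \<open>auto simp: homeomorphism_def\<close>)
  ultimately have "compact K" unfolding K_def by (metis compact_continuous_image)
  then have clK: "closed K" by (rule compact_imp_closed)
  have KW: "K \<subseteq> U \<inter> W" unfolding K_def using sub c(1) by fastforce
  have supp: "x \<in> K" if "\<eta> x \<noteq> 0" for x
  proof -
    have x: "x \<in> U" "cutoff (\<phi> p) r (\<phi> x) \<noteq> 0" using that by (auto simp: \<eta>_def split: if_splits)
    then have "\<phi> x \<in> cball (\<phi> p) (2 * r)" using cutoff_eq_0[OF r(1), of "\<phi> x" "\<phi> p"]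
      by (force simp: dist_commute)
    moreover have "\<phi> x \<in> half_space" using x openin_imp_subset[OF chart_rel_open[OF c(1)]] by blast
    ultimately show ?thesis unfolding K_def using x c(1) by (metis IntI chart_inv image_eqI)
  qed
  show thesis
  proof
    show "msmooth_at UNIV \<eta> x" for x
    proof (cases "x \<in> U")
      case True
      have "smooth_at (\<phi> ` (U \<inter> UNIV)) (\<eta> \<circ> inv_into U \<phi>) (\<phi> x)"
        by (rule smooth_atI[of UNIV _ "cutoff (\<phi> p) r"]) (use c(1) in \<open>auto simp: \<eta>_def Ck_on_cutoff\<close>)
      then show ?thesis using c(1) True by (intro msmooth_atI)
    next
      case False
      show ?thesis
        by (rule msmooth_at_cong[OF msmooth_at_const[of UNIV 0], of "- K"]) (use clK KW False supp in auto)
    qed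
    show "0 \<le> \<eta> x" for x by (simp add: \<eta>_def cutoff_range)
    show "open ({x \<in> U. \<phi> x \<in> ball (\<phi> p) r})" by (rule chart_preimage_open[OF c(1)]) simp
    show "p \<in> {x \<in> U. \<phi> x \<in> ball (\<phi> p) r}" using c r by simp
    show 1: "\<eta> x = 1" if "x \<in> {x \<in> U. \<phi> x \<in> ball (\<phi> p) r}" for x
      using that r by (auto simp: \<eta>_def dist_commute intro!: cutoff_eq_1)
    show "{x \<in> U. \<phi> x \<in> ball (\<phi> p) r} \<subseteq> W" using 1 supp KW by fastforce
    have "closure {x. \<eta> x \<noteq> 0} \<subseteq> K" by (rule closure_minimal) (use supp clK in auto)
    then show "closure {x. \<eta> x \<noteq> 0} \<subseteq> W" using KW by blast
  qed
qed

lemma partition_of_unity: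
  assumes "\<And>p. open (W p)" "\<And>p. p \<in> W p"
  obtains I and \<eta> :: "'a \<Rightarrow> 'a \<Rightarrow> real" where "finite I" "\<And>i x. i \<in> I \<Longrightarrow> msmooth_at UNIV (\<eta> i) x"
    "\<And>i. i \<in> I \<Longrightarrow> closure {x. \<eta> i x \<noteq> 0} \<subseteq> W i" "\<And>x. (\<Sum>i\<in>I. \<eta> i x) = 1"
proof -
  have "\<exists>b V. (\<forall>x. msmooth_at UNIV b x) \<and> (\<forall>x. (0::real) \<le> b x) \<and> open V \<and> p \<in> V \<and> (\<forall>x\<in>V. b x = 1)
      \<and> closure {x. b x \<noteq> 0} \<subseteq> W p" for p
    using bump[OF assms, of p] by metis
  then obtain b V where b: "\<And>p x. msmooth_at UNIV (b p) x" "\<And>p x. (0::real) \<le> b p x" "\<And>p. open (V p)"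
    "\<And>p. p \<in> V p" "\<And>p x. x \<in> V p \<Longrightarrow> b p x = 1" "\<And>p. closure {x. b p x \<noteq> 0} \<subseteq> W p" by metis
  obtain I where I: "finite I" "(\<Union>p\<in>I. V p) = UNIV"
    using compactE_image[OF compact_UNIV, of UNIV V] b(3,4) by (metis UNIV_I UN_I subset_UNIV subsetI top.extremum_uniqueI)
  define s where "s x = (\<Sum>i\<in>I. b i x)" for x
  have s: "s x \<noteq> 0" for x
  proof -
    obtain i where i: "i \<in> I" "x \<in> V i" using I(2) by blast
    then have "b i x \<le> s x" unfolding s_def using I(1) b(2) by (intro member_le_sum) auto
    then show ?thesis using b(5)[OF i(2)] by auto
  qed
  show thesis
  proof
    show "finite I" by fact
    show "msmooth_at UNIV (\<lambda>x. b i x * inverse (s x)) x" for i x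
      by (intro msmooth_at_mult msmooth_at_inverse b(1) s) (auto simp: s_def[abs_def] intro!: msmooth_at_sum b(1))
    have "{x. b i x * inverse (s x) \<noteq> 0} = {x. b i x \<noteq> 0}" for i using s by auto
    then show "closure {x. b i x * inverse (s x) \<noteq> 0} \<subseteq> W i" for i using b(6) by simp
    show "(\<Sum>i\<in>I. b i x * inverse (s x)) = 1" for x
      using s[of x] by (simp add: sum_distrib_right[symmetric] s_def)
  qed
qed

subsection \<open>Functions with vanishing differential at a point\<close>

text \<open>One chart suffices to test this. At boundary points the derivative within the image of the chart
  includes the normal one, taken from inside.\<close>

definition critical_at :: "('a \<Rightarrow> 'b::real_normed_vector) \<Rightarrow> 'a \<Rightarrow> bool" where
  "critical_at f p \<longleftrightarrow> (\<exists>(U, \<phi>)\<in>\<A>. p \<in> U \<and> ((f \<circ> inv_into U \<phi>) has_derivative (\<lambda>_. 0)) (at (\<phi> p) within \<phi> ` U))"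

lemma critical_atI:
  "(U, \<phi>) \<in> \<A> \<Longrightarrow> p \<in> U \<Longrightarrow> ((f \<circ> inv_into U \<phi>) has_derivative (\<lambda>_. 0)) (at (\<phi> p) within \<phi> ` U) \<Longrightarrow> critical_at f p"
  unfolding critical_at_def by blast

lemma critical_at_cong:
  assumes "critical_at f p" "open W" "p \<in> W" "\<And>x. x \<in> W \<Longrightarrow> f x = g x"
  shows "critical_at g p"
proof -
  obtain U \<phi> where c: "(U, \<phi>) \<in> \<A>" "p \<in> U"
    "((f \<circ> inv_into U \<phi>) has_derivative (\<lambda>_. 0)) (at (\<phi> p) within \<phi> ` U)"
    using assms(1) unfolding critical_at_def by blast
  obtain O' where O: "open O'" "\<phi> p \<in> O'" "\<And>y. y \<in> \<phi> ` U \<Longrightarrow> y \<in> O' \<Longrightarrow> inv_into U \<phi> y \<in> W"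
    using chart_nbhd[OF c(1) assms(2) c(2) assms(3)] by metis
  obtain e where e: "e > 0" "ball (\<phi> p) e \<subseteq> O'" using O openE by blast
  show ?thesis
    by (rule critical_atI[OF c(1,2)], rule has_derivative_transform_within[OF c(3) e(1)])
      (use c O e assms(4) in \<open>auto simp: subset_iff dist_commute\<close>)
qed

lemma critical_at_const: "critical_at (\<lambda>_. c) p"
proof -
  obtain U \<phi> where "(U, \<phi>) \<in> \<A>" "p \<in> U" by (rule chart_exists)
  then show ?thesis by (rule critical_atI) (simp add: o_def)
qed

lemma chart_has_derivative:
  assumes "msmooth_at UNIV f p" "(U, \<phi>) \<in> \<A>" "p \<in> U"
  shows "((f \<circ> inv_into U \<phi>) has_derivative frechet_derivative (f \<circ> inv_into U \<phi>) (at (\<phi> p) within \<phi> ` U))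
    (at (\<phi> p) within \<phi> ` U)"
  using msmooth_at_chart[OF assms(1) _ assms(2,3)] assms(3) by (intro smooth_at_imp_has_derivative) auto

text \<open>The product of two functions vanishing at \<open>p\<close> has no first order part there. This is what makes
  commutators with first order operators pointwise.\<close>

lemma critical_at_prod:
  fixes f g :: "'a \<Rightarrow> complex"
  assumes "msmooth_at UNIV f p" "msmooth_at UNIV g p"
  shows "critical_at (\<lambda>x. (f x - f p) * (g x - g p)) p"
proof -
  obtain U \<phi> where c: "(U, \<phi>) \<in> \<A>" "p \<in> U" by (rule chart_exists)
  from has_derivative_mult[OF has_derivative_diff[OF chart_has_derivative[OF assms(1) c] has_derivative_const[of "f p"]]
      has_derivative_diff[OF chart_has_derivative[OF assms(2) c] has_derivative_const[of "g p"]]]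
  show ?thesis using c by (intro critical_atI[OF c]) (simp add: o_def)
qed

lemma critical_at_cnj: "critical_at f p \<Longrightarrow> critical_at (\<lambda>x. cnj (f x)) p"
proof -
  assume "critical_at f p"
  then obtain U \<phi> where c: "(U, \<phi>) \<in> \<A>" "p \<in> U"
    "((f \<circ> inv_into U \<phi>) has_derivative (\<lambda>_. 0)) (at (\<phi> p) within \<phi> ` U)"
    unfolding critical_at_def by blast
  from bounded_linear.has_derivative[OF bounded_linear_cnj c(3)] show ?thesis
    by (intro critical_atI[OF c(1,2)]) (simp add: o_def)
qed

end

context bmanifold
begin

section \<open>Components of the boundary\<close>

lemma component_subset: "N \<in> components bd \<Longrightarrow> N \<subseteq> bd"
  by (rule in_components_subset)

lemma closed_component: "N \<in> components bd \<Longrightarrow> closed N"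
  using closed_bd closed_components by blast

text \<open>A small piece of the bounding hyperplane of a chart is convex, so its image lies in a single
  component of the boundary. In particular the components are relatively open in the boundary.\<close>

lemma component_nbhd:
  assumes "N \<in> components bd" "p \<in> N" "(U, \<phi>) \<in> \<A>" "p \<in> U"
  obtains e where "e > 0" "\<And>y. dist y (\<phi> p) < e \<Longrightarrow> y \<bullet> normal_dir = 0 \<Longrightarrow> y \<in> \<phi> ` U \<and> inv_into U \<phi> y \<in> N"
proof -
  obtain O' where O: "open O'" "\<phi> p \<in> O'" "half_space \<inter> O' = \<phi> ` U"
    using rel_openE[OF chart_rel_open[OF assms(3)]] assms(4) by (metis imageI)
  obtain e where e: "e > 0" "ball (\<phi> p) e \<subseteq> O'" using O openE by blast
  define C where "C = ball (\<phi> p) e \<inter> {y. normal_dir \<bullet> y = 0}"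
  have CU: "C \<subseteq> \<phi> ` U" using O(3) e(2) by (auto simp: C_def half_space_def inner_commute)
  have "convex C" unfolding C_def by (intro convex_Int convex_ball convex_hyperplane)
  then have "connected C" by (rule convex_connected)
  moreover have "continuous_on C (inv_into U \<phi>)"
    by (rule continuous_on_subset[OF _ CU]) (use chart_homeo[OF assms(3)] in \<open>simp add: homeomorphism_def\<close>)
  ultimately have conn: "connected (inv_into U \<phi> ` C)" by (rule connected_continuous_image[rotated])
  have pbd: "p \<in> bd" using assms(1,2) component_subset by blast
  have "inv_into U \<phi> ` C \<subseteq> bd"
  proof
    fix x assume "x \<in> inv_into U \<phi> ` C"
    then obtain y where y: "y \<in> C" "x = inv_into U \<phi> y" by blast
    then have "x \<in> U" "\<phi> x = y" using CU by (auto simp: inv_into_into f_inv_into_f subset_iff)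
    then show "x \<in> bd" using bd_chart[OF assms(3)] y(1) by (auto simp: C_def inner_commute)
  qed
  moreover have "p \<in> inv_into U \<phi> ` C"
    by (rule image_eqI[of _ _ "\<phi> p"])
      (use bd_chart[OF assms(3,4)] pbd assms e in \<open>auto simp: C_def inner_commute\<close>)
  ultimately have "inv_into U \<phi> ` C \<subseteq> N"
    using components_maximal[OF assms(1) conn] assms(2) by blast
  then show thesis
    by (intro that[OF e(1)]) (use CU in \<open>auto simp: C_def inner_commute dist_commute image_subset_iff subset_iff\<close>)
qed

lemma derivative_zero_along_segment:
  fixes g :: "'w::real_normed_vector \<Rightarrow> 'b::real_normed_vector"
  assumes "(g has_derivative D) (at y within T)" "e > 0"
    and "\<And>t. 0 \<le> t \<Longrightarrow> t < e \<Longrightarrow> y + t *\<^sub>R b \<in> T \<and> g (y + t *\<^sub>R b) = g y"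
  shows "D b = 0"
proof -
  let ?c = "\<lambda>t. y + t *\<^sub>R b"
  have c: "(?c has_derivative (\<lambda>t. t *\<^sub>R b)) (at 0 within {0..<e})"
    by (auto intro!: derivative_eq_intros)
  have "(g has_derivative D) (at (?c 0) within ?c ` {0..<e})"
    by (rule has_derivative_subset) (use assms in auto)
  from has_derivative_in_compose[OF c this]
  have 1: "((\<lambda>t. g (?c t)) has_derivative (\<lambda>t. D (t *\<^sub>R b))) (at 0 within {0..<e})" .
  have 2: "((\<lambda>t. g (?c t)) has_derivative (\<lambda>t. 0)) (at 0 within {0..<e})"
    by (rule has_derivative_transform[OF _ _ has_derivative_const[of "g y"]]) (use assms in auto)
  have "(\<lambda>t. D (t *\<^sub>R b)) = (\<lambda>t. 0)"
  proof (rule frechet_derivative_unique_within[OF 1 2])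
    fix i :: real and d :: real assume "i \<in> Basis" "d > 0"
    then show "\<exists>t. 0 < \<bar>t\<bar> \<and> \<bar>t\<bar> < d \<and> 0 + t *\<^sub>R i \<in> {0..<e}"
      using assms(2) by (intro exI[of _ "min d e / 2"]) auto
  qed
  from fun_cong[OF this, of 1] show ?thesis by simp
qed

text \<open>If \<open>f\<close> vanishes on a boundary component, then its tangential derivatives vanish there, as do
  those of \<open>\<rho>\<close>. So at such a point the differential of \<open>f\<close> is a multiple of the one of \<open>\<rho>\<close>.\<close>

lemma vanishing_on_component:
  fixes f :: "'a \<Rightarrow> complex"
  assumes "N \<in> components bd" "p \<in> N" "msmooth_at UNIV f p" "\<And>x. x \<in> N \<Longrightarrow> f x = 0"
  obtains c where "critical_at (\<lambda>x. f x - c * of_real (\<rho> x)) p"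
proof -
  obtain U \<phi> where ch: "(U, \<phi>) \<in> \<A>" "p \<in> U" by (rule chart_exists)
  obtain e where e: "e > 0" "\<And>y. dist y (\<phi> p) < e \<Longrightarrow> y \<bullet> normal_dir = 0 \<Longrightarrow> y \<in> \<phi> ` U \<and> inv_into U \<phi> y \<in> N"
    using component_nbhd[OF assms(1,2) ch] by blast
  have pbd: "p \<in> bd" using assms(1,2) component_subset by blast
  then have pn: "\<phi> p \<bullet> normal_dir = 0" using bd_chart[OF ch] by simp
  let ?n = "normal_dir :: 'v"
  let ?r = "\<lambda>x. complex_of_real (\<rho> x)"
  let ?D = "\<lambda>f. frechet_derivative (f \<circ> inv_into U \<phi>) (at (\<phi> p) within \<phi> ` U)"
  have zero: "?D g b = 0" if "msmooth_at UNIV g p" "\<And>x. x \<in> N \<Longrightarrow> g x = 0" "b \<in> Basis" "b \<noteq> ?n"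
    for g :: "'a \<Rightarrow> complex" and b
  proof (rule derivative_zero_along_segment[OF chart_has_derivative[OF that(1) ch] e(1)])
    fix t :: real assume t: "0 \<le> t" "t < e"
    have "dist (\<phi> p + t *\<^sub>R b) (\<phi> p) < e" using t that(3) by (simp add: dist_norm)
    moreover have "(\<phi> p + t *\<^sub>R b) \<bullet> ?n = 0"
      using pn that(3,4) by (simp add: inner_add_left inner_normal_dir_Basis)
    ultimately show "\<phi> p + t *\<^sub>R b \<in> \<phi> ` U \<and>
        (g \<circ> inv_into U \<phi>) (\<phi> p + t *\<^sub>R b) = (g \<circ> inv_into U \<phi>) (\<phi> p)"
      using e(2) that(2) assms(2) ch by auto
  qed
  have rs: "msmooth_at UNIV ?r p" by (intro msmooth_at_of_real rho_smooth)
  have rN: "?r x = 0" if "x \<in> N" for x using that component_subset[OF assms(1)] rho_bd by auto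
  have repr: "?D g v = (v \<bullet> ?n) *\<^sub>R ?D g ?n" if "msmooth_at UNIV g p" "\<And>x. x \<in> N \<Longrightarrow> g x = 0" for g :: "'a \<Rightarrow> complex" and v
  proof -
    have lin: "linear (?D g)"
      using chart_has_derivative[OF that(1) ch] has_derivative_linear by blast
    have "?D g v = ?D g (\<Sum>b\<in>Basis. (v \<bullet> b) *\<^sub>R b)" by (simp add: euclidean_representation)
    also have "\<dots> = (\<Sum>b\<in>Basis. (v \<bullet> b) *\<^sub>R ?D g b)" using lin by (simp add: linear_sum linear_scale)
    also have "\<dots> = (\<Sum>b\<in>Basis. if b = ?n then (v \<bullet> ?n) *\<^sub>R ?D g ?n else 0)"
      using zero[OF that] by (intro sum.cong) auto
    finally show ?thesis by (simp add: normal_dir_Basis)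
  qed
  have "?D ?r ?n \<noteq> 0"
  proof
    assume "?D ?r ?n = 0"
    then have "?D ?r v = 0" for v using repr[OF rs rN, of v] by simp
    then have "?D ?r = (\<lambda>_. 0)" by blast
    then have "((?r \<circ> inv_into U \<phi>) has_derivative (\<lambda>_. 0)) (at (\<phi> p) within \<phi> ` U)"
      using chart_has_derivative[OF rs ch] by metis
    from bounded_linear.has_derivative[OF bounded_linear_Re this]
    have "((\<rho> \<circ> inv_into U \<phi>) has_derivative (\<lambda>_. 0)) (at (\<phi> p) within \<phi> ` U)" by (simp add: o_def)
    then show False using defining ch pbd unfolding defining_function_def by blast
  qed
  note nz = this
  define c where "c = ?D f ?n / ?D ?r ?n"
  have "((\<lambda>y. (f \<circ> inv_into U \<phi>) y - c * (?r \<circ> inv_into U \<phi>) y) has_derivative (\<lambda>v. ?D f v - c * ?D ?r v))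
      (at (\<phi> p) within \<phi> ` U)"
    by (intro has_derivative_diff has_derivative_mult_right chart_has_derivative[OF assms(3) ch]
        chart_has_derivative[OF rs ch])
  moreover have "(\<lambda>v. ?D f v - c * ?D ?r v) = (\<lambda>_. 0)"
  proof
    fix v
    have "?D f v - c * ?D ?r v = (v \<bullet> ?n) *\<^sub>R (?D f ?n - c * ?D ?r ?n)"
    proof -
      have "?D f v = (v \<bullet> ?n) *\<^sub>R ?D f ?n" by (rule repr[OF assms(3,4)])
      moreover have "?D ?r v = (v \<bullet> ?n) *\<^sub>R ?D ?r ?n" by (rule repr[OF rs rN])
      ultimately show ?thesis by (simp only: scaleR_diff_right mult_scaleR_right)
    qed
    then show "?D f v - c * ?D ?r v = 0" using nz by (simp add: c_def)
  qed
  ultimately show thesis by (intro that[of c] critical_atI[OF ch]) (simp add: o_def)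
qed

end

section \<open>Frames and sections\<close>

locale bundle_on = bmanifold +
  fixes E :: "('a, 'e::complex_vector) vbundle"
  assumes vbundle: "vector_bundle \<A> E"
begin

lemma fiber_subspace: "complex_vector.subspace (fiber E x)"
  using vbundle by (simp add: vector_bundle_def)

lemma fiber_zero: "0 \<in> fiber E x"
  and fiber_add: "u \<in> fiber E x \<Longrightarrow> v \<in> fiber E x \<Longrightarrow> u + v \<in> fiber E x"
  and fiber_scale: "u \<in> fiber E x \<Longrightarrow> c *\<^sub>C u \<in> fiber E x"
  and fiber_diff: "u \<in> fiber E x \<Longrightarrow> v \<in> fiber E x \<Longrightarrow> u - v \<in> fiber E x"
  and fiber_sum: "(\<And>i. i \<in> I \<Longrightarrow> f i \<in> fiber E x) \<Longrightarrow> (\<Sum>i\<in>I. f i) \<in> fiber E x"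
  using fiber_subspace[of x]
  by (auto intro: complex_vector.subspace_0 complex_vector.subspace_add complex_vector.subspace_scale
      complex_vector.subspace_diff complex_vector.subspace_sum)

lemma frame_exists: obtains W es where "(W, es) \<in> frames E" "p \<in> W"
proof -
  have "p \<in> \<Union> (fst ` frames E)" using vbundle by (simp add: vector_bundle_def)
  then show thesis using that by auto
qed

lemma frame_open: "(W, es) \<in> frames E \<Longrightarrow> open W"
  using vbundle unfolding vector_bundle_def by blast

lemma frame_basis:
  assumes "(W, es) \<in> frames E" "x \<in> W"
  shows "distinct (map (\<lambda>e. e x) es)" "complex_vector.independent (set (map (\<lambda>e. e x) es))"
    "complex_vector.span (set (map (\<lambda>e. e x) es)) = fiber E x"
  using vbundle assms unfolding vector_bundle_def by blast+

lemma frame_transition: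
  assumes "(W, es) \<in> frames E" "(W', fs) \<in> frames E" "i < length es" "j < length fs"
  shows "msmooth_on \<A> (W \<inter> W') (\<lambda>x. coord fs x ((es ! i) x) j)"
  using vbundle assms unfolding vector_bundle_def by fast

lemma frame_in_fiber:
  assumes "(W, es) \<in> frames E" "x \<in> W" "i < length es"
  shows "(es ! i) x \<in> fiber E x"
proof -
  have "(es ! i) x \<in> set (map (\<lambda>e. e x) es)"
    unfolding set_map by (rule imageI[OF nth_mem[OF assms(3)]])
  then show ?thesis unfolding frame_basis(3)[OF assms(1,2), symmetric] by (rule complex_vector.span_base)
qed

lemma sum_frame_as_set_sum:
  assumes "(W, es) \<in> frames E" "x \<in> W"
  shows "\<exists>g. bij_betw g {..<length es} (set (map (\<lambda>e. e x) es)) \<and>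
    (\<forall>u. (\<Sum>v\<in>set (map (\<lambda>e. e x) es). u v *\<^sub>C v) = (\<Sum>i<length es. u (g i) *\<^sub>C (es ! i) x))"
proof -
  let ?g = "\<lambda>i. map (\<lambda>e. e x) es ! i"
  have b: "bij_betw ?g {..<length es} (set (map (\<lambda>e. e x) es))"
    by (rule bij_betw_nth[OF frame_basis(1)[OF assms]]) simp_all
  have "(\<Sum>v\<in>set (map (\<lambda>e. e x) es). u v *\<^sub>C v) = (\<Sum>i<length es. u (?g i) *\<^sub>C (es ! i) x)" for u
    using sum.reindex_bij_betw[OF b, of "\<lambda>v. u v *\<^sub>C v"] by simp
  then show ?thesis using b by blast
qed

lemma frame_unique:
  assumes "(W, es) \<in> frames E" "x \<in> W" "i < length es"
    and "(\<Sum>i<length es. c i *\<^sub>C (es ! i) x) = (\<Sum>i<length es. d i *\<^sub>C (es ! i) x)"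
  shows "c i = d i"
proof -
  obtain g where g: "bij_betw g {..<length es} (set (map (\<lambda>e. e x) es))"
    "\<And>u. (\<Sum>v\<in>set (map (\<lambda>e. e x) es). u v *\<^sub>C v) = (\<Sum>i<length es. u (g i) *\<^sub>C (es ! i) x)"
    using sum_frame_as_set_sum[OF assms(1,2)] by blast
  let ?h = "inv_into {..<length es} g"
  have h: "?h (g j) = j" if "j < length es" for j
    by (rule inv_into_f_f[OF bij_betw_imp_inj_on[OF g(1)]]) (simp add: that)
  let ?u = "\<lambda>v. c (?h v) - d (?h v)"
  have "(\<Sum>v\<in>set (map (\<lambda>e. e x) es). ?u v *\<^sub>C v) = (\<Sum>i<length es. (c i - d i) *\<^sub>C (es ! i) x)"
    unfolding g(2) by (rule sum.cong[OF refl]) (simp add: h)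
  also have "\<dots> = 0"
    using assms(4) by (simp add: complex_vector.scale_left_diff_distrib sum_subtractf)
  finally have "?u (g i) = 0"
    by (rule complex_vector.independentD[OF frame_basis(2)[OF assms(1,2)] finite_set order_refl])
      (use bij_betw_imp_surj_on[OF g(1)] assms(3) in blast)
  then show ?thesis using h[OF assms(3)] by simp
qed

lemma frame_expand:
  assumes "(W, es) \<in> frames E" "x \<in> W" "w \<in> fiber E x"
  shows "w = (\<Sum>i<length es. coord es x w i *\<^sub>C (es ! i) x)"
proof -
  obtain g where g: "bij_betw g {..<length es} (set (map (\<lambda>e. e x) es))"
    "\<And>u. (\<Sum>v\<in>set (map (\<lambda>e. e x) es). u v *\<^sub>C v) = (\<Sum>i<length es. u (g i) *\<^sub>C (es ! i) x)"
    using sum_frame_as_set_sum[OF assms(1,2)] by blast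
  have "w \<in> complex_vector.span (set (map (\<lambda>e. e x) es))" using frame_basis(3)[OF assms(1,2)] assms(3) by simp
  then obtain u where "w = (\<Sum>v\<in>set (map (\<lambda>e. e x) es). u v *\<^sub>C v)"
    unfolding complex_vector.span_finite[OF finite_set] by blast
  then have "w = (\<Sum>i<length es. u (g i) *\<^sub>C (es ! i) x)" by (simp only: g(2))
  then have "\<exists>c. w = (\<Sum>i<length es. c i *\<^sub>C (es ! i) x)" by (rule exI[of _ "\<lambda>i. u (g i)"])
  then show ?thesis unfolding coord_def by (rule someI_ex)
qed

lemma coord_eq:
  assumes "(W, es) \<in> frames E" "x \<in> W" "w = (\<Sum>i<length es. c i *\<^sub>C (es ! i) x)" "i < length es"
  shows "coord es x w i = c i"
proof -
  have "w \<in> fiber E x" unfolding assms(3) using frame_in_fiber[OF assms(1,2)]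
    by (intro fiber_sum fiber_scale) auto
  from frame_expand[OF assms(1,2) this] show ?thesis
    using frame_unique[OF assms(1,2,4), of "coord es x w" c] assms(3) by simp
qed

lemma coord_add:
  assumes "(W, es) \<in> frames E" "x \<in> W" "v \<in> fiber E x" "w \<in> fiber E x" "i < length es"
  shows "coord es x (v + w) i = coord es x v i + coord es x w i"
  by (rule coord_eq[OF assms(1,2) _ assms(5)])
    (subst (1) frame_expand[OF assms(1,2,3)], subst (1) frame_expand[OF assms(1,2,4)],
      simp add: scaleC_add_left sum.distrib)

lemma coord_scale:
  assumes "(W, es) \<in> frames E" "x \<in> W" "v \<in> fiber E x" "i < length es"
  shows "coord es x (c *\<^sub>C v) i = c * coord es x v i"
  by (rule coord_eq[OF assms(1,2) _ assms(4)])
    (subst (1) frame_expand[OF assms(1,2,3)], simp add: complex_vector.scale_sum_right scaleC_scaleC)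

lemma coord_zero: "(W, es) \<in> frames E \<Longrightarrow> x \<in> W \<Longrightarrow> i < length es \<Longrightarrow> coord es x 0 i = 0"
  by (rule coord_eq) auto

lemma coord_sum:
  assumes "(W, es) \<in> frames E" "x \<in> W" "\<And>k. k \<in> I \<Longrightarrow> v k \<in> fiber E x" "i < length es"
  shows "coord es x (\<Sum>k\<in>I. v k) i = (\<Sum>k\<in>I. coord es x (v k) i)"
  using assms(3)
  by (induction I rule: infinite_finite_induct)
    (auto simp: coord_zero[OF assms(1,2,4)] coord_add[OF assms(1,2) _ fiber_sum assms(4)])

lemma coord_change:
  assumes "(W, es) \<in> frames E" "(W', fs) \<in> frames E" "x \<in> W" "x \<in> W'" "w \<in> fiber E x" "j < length fs"
  shows "coord fs x w j = (\<Sum>i<length es. coord es x w i * coord fs x ((es ! i) x) j)"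
proof -
  have "coord fs x w j = coord fs x (\<Sum>i<length es. coord es x w i *\<^sub>C (es ! i) x) j"
    using frame_expand[OF assms(1,3,5)] by simp
  also have "\<dots> = (\<Sum>i<length es. coord fs x (coord es x w i *\<^sub>C (es ! i) x) j)"
    using frame_in_fiber[OF assms(1,3)] by (intro coord_sum[OF assms(2,4) _ assms(6)] fiber_scale) auto
  also have "\<dots> = (\<Sum>i<length es. coord es x w i * coord fs x ((es ! i) x) j)"
    using frame_in_fiber[OF assms(1,3)] by (intro sum.cong coord_scale[OF assms(2,4) _ assms(6)]) auto
  finally show ?thesis .
qed

lemma coord_inject:
  assumes "(W, es) \<in> frames E" "x \<in> W" "v \<in> fiber E x" "w \<in> fiber E x"
    and "\<And>i. i < length es \<Longrightarrow> coord es x v i = coord es x w i"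
  shows "v = w"
  using frame_expand[OF assms(1,2,3)] frame_expand[OF assms(1,2,4)] assms(5) by simp

text \<open>Smoothness of a section, tested in one frame. Since the frames are smoothly related, this gives smoothness
  of the coefficients in every frame.\<close>

definition smooth_section_at :: "'a set \<Rightarrow> ('a \<Rightarrow> 'e) \<Rightarrow> 'a \<Rightarrow> bool" where
  "smooth_section_at S s p \<longleftrightarrow>
     (\<exists>(W, es)\<in>frames E. p \<in> W \<and> (\<forall>i<length es. msmooth_at (W \<inter> S) (\<lambda>x. coord es x (s x) i) p))"

lemma smooth_section_at_frame:
  assumes "smooth_section_at S s p" "p \<in> S" "\<And>x. x \<in> S \<Longrightarrow> s x \<in> fiber E x"
    and "(W', fs) \<in> frames E" "p \<in> W'" "j < length fs"
  shows "msmooth_at (W' \<inter> S) (\<lambda>x. coord fs x (s x) j) p"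
proof -
  obtain W es where W: "(W, es) \<in> frames E" "p \<in> W"
    "\<And>i. i < length es \<Longrightarrow> msmooth_at (W \<inter> S) (\<lambda>x. coord es x (s x) i) p"
    using assms(1) unfolding smooth_section_at_def by blast
  let ?S = "W \<inter> W' \<inter> S"
  have "msmooth_at ?S (\<lambda>x. \<Sum>i<length es. coord es x (s x) i * coord fs x ((es ! i) x) j) p"
  proof (intro msmooth_at_sum msmooth_at_mult)
    fix i assume i: "i \<in> {..<length es}"
    show "msmooth_at ?S (\<lambda>x. coord es x (s x) i) p"
      by (rule msmooth_at_cong[OF W(3), of i UNIV]) (use i in auto)
    have "msmooth_at (W \<inter> W') (\<lambda>x. coord fs x ((es ! i) x) j) p"
      using frame_transition[OF W(1) assms(4) _ assms(6)] i W(2) assms(5) by (auto simp: msmooth_on_iff_msmooth_at)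
    then show "msmooth_at ?S (\<lambda>x. coord fs x ((es ! i) x) j) p" by (rule msmooth_at_cong[of _ _ _ UNIV]) auto
  qed (use W assms in auto)
  then show ?thesis
    by (rule msmooth_at_cong[of _ _ _ W])
      (use W frame_open assms coord_change[OF W(1) assms(4) _ _ _ assms(6)] in auto)
qed

lemma smooth_sectionsI:
  assumes "\<And>x. x \<in> S \<Longrightarrow> s x \<in> fiber E x" "\<And>x. x \<notin> S \<Longrightarrow> s x = 0" "\<And>p. p \<in> S \<Longrightarrow> smooth_section_at S s p"
  shows "s \<in> smooth_sections \<A> E S"
  using assms smooth_section_at_frame[OF assms(3) _ assms(1)]
  by (fastforce simp: smooth_sections_def msmooth_on_iff_msmooth_at)

lemma smooth_sectionsD:
  assumes "s \<in> smooth_sections \<A> E S"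
  shows "x \<in> S \<Longrightarrow> s x \<in> fiber E x" "x \<notin> S \<Longrightarrow> s x = 0"
    "(W, es) \<in> frames E \<Longrightarrow> x \<in> W \<Longrightarrow> x \<in> S \<Longrightarrow> i < length es \<Longrightarrow> msmooth_at (W \<inter> S) (\<lambda>x. coord es x (s x) i) x"
proof -
  have *: "\<forall>x\<in>S. s x \<in> fiber E x" "\<forall>x. x \<notin> S \<longrightarrow> s x = 0"
    "\<forall>(W, es)\<in>frames E. \<forall>i<length es. \<forall>x\<in>W \<inter> S. msmooth_at (W \<inter> S) (\<lambda>x. coord es x (s x) i) x"
    using assms unfolding smooth_sections_def msmooth_on_iff_msmooth_at by blast+
  show "x \<in> S \<Longrightarrow> s x \<in> fiber E x" "x \<notin> S \<Longrightarrow> s x = 0"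
    "(W, es) \<in> frames E \<Longrightarrow> x \<in> W \<Longrightarrow> x \<in> S \<Longrightarrow> i < length es \<Longrightarrow> msmooth_at (W \<inter> S) (\<lambda>x. coord es x (s x) i) x"
    using * by blast+
qed

lemma smooth_sections_at:
  assumes "s \<in> smooth_sections \<A> E S" "p \<in> S"
  shows "smooth_section_at S s p"
proof -
  obtain W es where "(W, es) \<in> frames E" "p \<in> W" by (rule frame_exists)
  then show ?thesis using smooth_sectionsD(3)[OF assms(1)] assms(2) unfolding smooth_section_at_def by blast
qed

lemma smooth_section_at_cong:
  assumes "smooth_section_at S s p" "open O'" "p \<in> O'" "\<And>x. x \<in> T \<Longrightarrow> x \<in> O' \<Longrightarrow> x \<in> S \<and> s x = t x"
  shows "smooth_section_at T t p"
proof -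
  obtain W es where W: "(W, es) \<in> frames E" "p \<in> W"
    "\<And>i. i < length es \<Longrightarrow> msmooth_at (W \<inter> S) (\<lambda>x. coord es x (s x) i) p"
    using assms(1) unfolding smooth_section_at_def by blast
  have "msmooth_at (W \<inter> T) (\<lambda>x. coord es x (t x) i) p" if "i < length es" for i
    by (rule msmooth_at_cong[OF W(3)[OF that] assms(2,3)]) (use assms(4) in auto)
  then show ?thesis using W unfolding smooth_section_at_def by blast
qed

lemma zero_section: "(\<lambda>_. 0) \<in> smooth_sections \<A> E S"
proof (rule smooth_sectionsI)
  fix p assume "p \<in> S"
  obtain W es where W: "(W, es) \<in> frames E" "p \<in> W" by (rule frame_exists)
  have "msmooth_at (W \<inter> S) (\<lambda>x. coord es x 0 i) p" if "i < length es" for i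
    by (rule msmooth_at_cong[OF msmooth_at_const[of UNIV 0] frame_open[OF W(1)] W(2)]) (use coord_zero[OF W(1)] that in auto)
  then show "smooth_section_at S (\<lambda>_. 0) p" using W unfolding smooth_section_at_def by blast
qed (auto intro: fiber_zero)

lemma section_add:
  assumes "s \<in> smooth_sections \<A> E S" "t \<in> smooth_sections \<A> E S"
  shows "(\<lambda>x. s x + t x) \<in> smooth_sections \<A> E S"
proof (rule smooth_sectionsI)
  fix p assume p: "p \<in> S"
  obtain W es where W: "(W, es) \<in> frames E" "p \<in> W" by (rule frame_exists)
  have "msmooth_at (W \<inter> S) (\<lambda>x. coord es x (s x + t x) i) p" if i: "i < length es" for i
    by (rule msmooth_at_cong[OF msmooth_at_add[OF smooth_sectionsD(3)[OF assms(1) W p i] smooth_sectionsD(3)[OF assms(2) W p i]] open_UNIV])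
      (use p W smooth_sectionsD(1)[OF assms(1)] smooth_sectionsD(1)[OF assms(2)] coord_add[OF W(1) _ _ _ i] in auto)
  then show "smooth_section_at S (\<lambda>x. s x + t x) p" using W unfolding smooth_section_at_def by blast
qed (use smooth_sectionsD[OF assms(1)] smooth_sectionsD[OF assms(2)] in \<open>auto intro: fiber_add\<close>)

lemma section_scale:
  assumes "s \<in> smooth_sections \<A> E S" "\<And>x. x \<in> S \<Longrightarrow> msmooth_at S f x"
  shows "(\<lambda>x. f x *\<^sub>C s x) \<in> smooth_sections \<A> E S"
proof (rule smooth_sectionsI)
  fix p assume p: "p \<in> S"
  obtain W es where W: "(W, es) \<in> frames E" "p \<in> W" by (rule frame_exists)
  have f: "msmooth_at (W \<inter> S) f p" by (rule msmooth_at_cong[OF assms(2)[OF p] open_UNIV]) auto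
  have "msmooth_at (W \<inter> S) (\<lambda>x. coord es x (f x *\<^sub>C s x) i) p" if i: "i < length es" for i
    by (rule msmooth_at_cong[OF msmooth_at_mult[OF f smooth_sectionsD(3)[OF assms(1) W p i]] open_UNIV])
      (use p W smooth_sectionsD(1)[OF assms(1)] coord_scale[OF W(1) _ _ i] in auto)
  then show "smooth_section_at S (\<lambda>x. f x *\<^sub>C s x) p" using W unfolding smooth_section_at_def by blast
qed (use smooth_sectionsD[OF assms(1)] in \<open>auto intro: fiber_scale\<close>)

lemma section_diff:
  assumes "s \<in> smooth_sections \<A> E S" "t \<in> smooth_sections \<A> E S"
  shows "(\<lambda>x. s x - t x) \<in> smooth_sections \<A> E S"
  using section_add[OF assms(1) section_scale[OF assms(2) msmooth_at_const[of S "-1"]]]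
  by (simp add: complex_vector.scale_minus_left)

lemma section_sum:
  assumes "\<And>i. i \<in> I \<Longrightarrow> s i \<in> smooth_sections \<A> E S"
  shows "(\<lambda>x. \<Sum>i\<in>I. s i x) \<in> smooth_sections \<A> E S"
  using assms by (induction I rule: infinite_finite_induct) (auto intro: zero_section section_add)

abbreviation "sec \<equiv> smooth_sections \<A> E UNIV"

text \<open>Sections are built from coefficients in a single frame; the coefficients are supported in a closed set
  inside the domain of the frame, so that the extension by \<open>0\<close> is smooth.\<close>

lemma section_from_coords:
  assumes W: "(W, es) \<in> frames E" and K: "closed K" "K \<subseteq> W"
    and c: "\<And>i x. i < length es \<Longrightarrow> x \<in> W \<Longrightarrow> msmooth_at W (c i) x"
      "\<And>i x. i < length es \<Longrightarrow> x \<notin> K \<Longrightarrow> c i x = 0"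
  shows "(\<lambda>x. if x \<in> W then \<Sum>i<length es. c i x *\<^sub>C (es ! i) x else 0) \<in> sec" (is "?s \<in> _")
proof (rule smooth_sectionsI)
  fix p :: 'a
  show "smooth_section_at UNIV ?s p"
  proof (cases "p \<in> W")
    case True
    have "msmooth_at (W \<inter> UNIV) (\<lambda>x. coord es x (?s x) i) p" if i: "i < length es" for i
      by (rule msmooth_at_cong[OF c(1)[OF i True] open_UNIV]) (use coord_eq[OF W _ _ i] in auto)
    then show ?thesis using W True unfolding smooth_section_at_def by blast
  next
    case False
    show ?thesis
      by (rule smooth_section_at_cong[OF smooth_sections_at[OF zero_section[of UNIV]], of p "- K"])
        (use K False c(2) in \<open>auto intro!: sum.neutral[symmetric]\<close>)
  qed
qed (use frame_in_fiber[OF W] in \<open>auto intro!: fiber_sum fiber_scale fiber_zero\<close>)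

lemma section_zero_by_density:
  assumes "s \<in> sec" "open W" "p \<in> W" "\<And>x. x \<in> W \<Longrightarrow> x \<notin> bd \<Longrightarrow> s x = 0"
  shows "s p = 0"
proof -
  obtain W' es where W: "(W', es) \<in> frames E" "p \<in> W'" by (rule frame_exists)
  have o: "open (W \<inter> W')" using assms(2) frame_open[OF W(1)] by blast
  have "coord es p (s p) i = 0" if i: "i < length es" for i
  proof (rule zero_by_density[OF o])
    show "isCont (\<lambda>x. coord es x (s x) i) p"
      using smooth_sectionsD(3)[OF assms(1) W _ i] W frame_open[OF W(1)] by (intro msmooth_at_isCont) auto
  qed (use assms W coord_zero[OF W(1) _ i] in auto)
  then show ?thesis
    using frame_expand[OF W smooth_sectionsD(1)[OF assms(1)]] by simp
qed

lemma section_eq_by_density: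
  assumes "s \<in> sec" "t \<in> sec" "open W" "p \<in> W" "\<And>x. x \<in> W \<Longrightarrow> x \<notin> bd \<Longrightarrow> s x = t x"
  shows "s p = t p"
  using section_zero_by_density[OF section_diff[OF assms(1,2)] assms(3,4)] assms(5) by simp

text \<open>A frame over \<open>W\<close> and a cut-off function \<open>\<psi>\<close> supported in \<open>W\<close> give global sections and
  coordinate functions which are unchanged where \<open>\<psi> = 1\<close>.\<close>

definition cut_frame :: "('a \<Rightarrow> real) \<Rightarrow> 'a set \<Rightarrow> ('a \<Rightarrow> 'e) list \<Rightarrow> nat \<Rightarrow> 'a \<Rightarrow> 'e" where
  "cut_frame \<psi> W es i x = (if x \<in> W then of_real (\<psi> x) *\<^sub>C (es ! i) x else 0)"

definition cut_coord :: "('a \<Rightarrow> real) \<Rightarrow> 'a set \<Rightarrow> ('a \<Rightarrow> 'e) list \<Rightarrow> ('a \<Rightarrow> 'e) \<Rightarrow> nat \<Rightarrow> 'a \<Rightarrow> complex" where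
  "cut_coord \<psi> W es u i x = (if x \<in> W then of_real (\<psi> x) * coord es x (u x) i else 0)"

lemma (in bmanifold) msmooth_at_cut:
  assumes "open W" "\<And>x. x \<in> W \<Longrightarrow> msmooth_at W f x" "\<And>x. msmooth_at UNIV \<psi> x" "closure {x. \<psi> x \<noteq> (0::real)} \<subseteq> W"
  shows "msmooth_at UNIV (\<lambda>x. if x \<in> W then of_real (\<psi> x) * f x else (0::complex)) p"
proof (cases "p \<in> W")
  case True
  have "msmooth_at W \<psi> p" by (rule msmooth_at_cong[OF assms(3) open_UNIV]) auto
  then have "msmooth_at W (\<lambda>x. of_real (\<psi> x) * f x) p" using assms(2) True by (intro msmooth_at_mult msmooth_at_of_real) auto
  then show ?thesis by (rule msmooth_at_cong[OF _ assms(1) True]) auto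
next
  case False
  define K where "K = closure {x. \<psi> x \<noteq> 0}"
  have 0: "\<psi> x = 0" if "x \<in> - K" for x
    using that subsetD[OF closure_subset[of "{x. \<psi> x \<noteq> 0}"], of x] by (auto simp: K_def)
  have o: "open (- K)" "p \<in> - K" using False assms(4) by (auto simp: K_def)
  show ?thesis
    by (rule msmooth_at_cong[OF msmooth_at_const[of UNIV 0] o]) (simp add: 0)
qed

lemma cut_coord_smooth:
  assumes "(W, es) \<in> frames E" "u \<in> sec" "\<And>x. msmooth_at UNIV \<psi> x" "closure {x. \<psi> x \<noteq> 0} \<subseteq> W" "i < length es"
  shows "msmooth_at UNIV (cut_coord \<psi> W es u i) p"
  unfolding cut_coord_def[abs_def]
  by (rule msmooth_at_cut[OF frame_open[OF assms(1)] _ assms(3,4)])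
    (use smooth_sectionsD(3)[OF assms(2,1) _ _ assms(5)] in auto)

lemma cut_frame_section:
  assumes "(W, es) \<in> frames E" "\<And>x. msmooth_at UNIV \<psi> x" "closure {x. \<psi> x \<noteq> 0} \<subseteq> W" "i < length es"
  shows "cut_frame \<psi> W es i \<in> sec"
proof -
  have \<psi>: "msmooth_at W (\<lambda>x. complex_of_real (\<psi> x)) x" for x
    by (rule msmooth_at_cong[OF msmooth_at_of_real[OF assms(2)] open_UNIV]) auto
  have \<psi>': "msmooth_at W (\<lambda>x. if j = i then complex_of_real (\<psi> x) else 0) x" for j x
    using \<psi> msmooth_at_const[of W 0] by (cases "j = i") auto
  have "(\<lambda>x. if x \<in> W then \<Sum>j<length es. (if j = i then of_real (\<psi> x) else 0) *\<^sub>C (es ! j) x else 0) \<in> sec"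
    by (rule section_from_coords[OF assms(1) closed_closure assms(3)])
      (use \<psi>' closure_subset[of "{x. \<psi> x \<noteq> 0}"] in auto)
  moreover have "(\<Sum>j<length es. (if j = i then of_real (\<psi> x) else 0) *\<^sub>C (es ! j) x) = of_real (\<psi> x) *\<^sub>C (es ! i) x" for x
  proof -
    have "(\<Sum>j<length es. (if j = i then of_real (\<psi> x) else 0) *\<^sub>C (es ! j) x)
        = (\<Sum>j<length es. if j = i then of_real (\<psi> x) *\<^sub>C (es ! i) x else 0)"
      by (intro sum.cong) auto
    then show ?thesis using assms(4) by simp
  qed
  ultimately show ?thesis unfolding cut_frame_def[abs_def] by (simp only:)
qed

lemma cut_expand:
  assumes "(W, es) \<in> frames E" "u x \<in> fiber E x" "x \<in> W" "\<psi> x = 1"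
  shows "u x = (\<Sum>i<length es. cut_coord \<psi> W es u i x *\<^sub>C cut_frame \<psi> W es i x)"
  using frame_expand[OF assms(1,3,2)] assms(3,4) by (simp add: cut_coord_def cut_frame_def)

lemma section_through:
  assumes "w \<in> fiber E p"
  obtains s where "s \<in> sec" "s p = w"
proof -
  obtain W es where W: "(W, es) \<in> frames E" "p \<in> W" by (rule frame_exists)
  obtain \<psi> :: "'a \<Rightarrow> real" and V where \<psi>: "\<And>x. msmooth_at UNIV \<psi> x" "p \<in> V" "\<And>x. x \<in> V \<Longrightarrow> \<psi> x = 1" "closure {x. \<psi> x \<noteq> 0} \<subseteq> W"
    using bump[OF frame_open[OF W(1)] W(2)] by metis
  let ?s = "\<lambda>x. \<Sum>i<length es. coord es p w i *\<^sub>C cut_frame \<psi> W es i x"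
  have "?s \<in> sec"
    by (intro section_sum section_scale cut_frame_section W msmooth_at_const \<psi>(1,4)) auto
  moreover have "?s p = w"
    using frame_expand[OF W assms] W(2) \<psi>(2,3) by (simp add: cut_frame_def)
  ultimately show thesis by (rule that)
qed

end

section \<open>First order operators\<close>

locale bundle_pair = bmanifold \<A> \<rho> + E: bundle_on \<A> \<rho> E + F: bundle_on \<A> \<rho> F
  for \<A> :: "('a::t2_space, 'v::euclidean_space) atlas" and \<rho> :: "'a \<Rightarrow> real"
    and E F :: "('a, 'e::complex_vector) vbundle"
begin

text \<open>An additive operator is of first order iff it commutes at \<open>p\<close> with multiplication by
  functions whose differential vanishes at \<open>p\<close>. Phrased in this way, the order passes to formal
  adjoints by weak identities.\<close>

definition first_order :: "(('a \<Rightarrow> 'e) \<Rightarrow> 'a \<Rightarrow> 'e) \<Rightarrow> bool" where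
  "first_order P \<longleftrightarrow>
     (\<forall>u\<in>E.sec. P u \<in> F.sec) \<and>
     (\<forall>u\<in>E.sec. \<forall>v\<in>E.sec. \<forall>p. P (\<lambda>x. u x + v x) p = P u p + P v p) \<and>
     (\<forall>u\<in>E.sec. \<forall>f p. (\<forall>x. msmooth_at UNIV f x) \<longrightarrow> critical_at f p \<longrightarrow> P (\<lambda>x. f x *\<^sub>C u x) p = f p *\<^sub>C P u p)"

text \<open>A first order operator is totally characteristic iff \<open>[P, \<rho>] = \<rho> B\<close> with \<open>B\<close> smooth up to
  the boundary. Then \<open>B\<close> has order zero, and \<open>\<rho>\<^sup>-\<^sup>i\<^sup>\<sigma> P \<rho>\<^sup>i\<^sup>\<sigma> = P + i\<sigma> B\<close>.\<close>

definition b_first_order :: "(('a \<Rightarrow> 'e) \<Rightarrow> 'a \<Rightarrow> 'e) \<Rightarrow> (('a \<Rightarrow> 'e) \<Rightarrow> 'a \<Rightarrow> 'e) \<Rightarrow> bool" where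
  "b_first_order P B \<longleftrightarrow> first_order P \<and>
     (\<forall>u\<in>E.sec. B u \<in> F.sec) \<and>
     (\<forall>u\<in>E.sec. \<forall>v\<in>E.sec. \<forall>p. B (\<lambda>x. u x + v x) p = B u p + B v p) \<and>
     (\<forall>u\<in>E.sec. \<forall>f p. (\<forall>x. msmooth_at UNIV f x) \<longrightarrow> B (\<lambda>x. f x *\<^sub>C u x) p = f p *\<^sub>C B u p) \<and>
     (\<forall>u\<in>E.sec. \<forall>p. P (\<lambda>x. of_real (\<rho> x) *\<^sub>C u x) p = of_real (\<rho> p) *\<^sub>C (P u p + B u p))"

lemma
  assumes "first_order P"
  shows fo_section: "u \<in> E.sec \<Longrightarrow> P u \<in> F.sec"
    and fo_add: "u \<in> E.sec \<Longrightarrow> v \<in> E.sec \<Longrightarrow> P (\<lambda>x. u x + v x) p = P u p + P v p"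
    and fo_mult: "u \<in> E.sec \<Longrightarrow> (\<And>x. msmooth_at UNIV f x) \<Longrightarrow> critical_at f p \<Longrightarrow> P (\<lambda>x. f x *\<^sub>C u x) p = f p *\<^sub>C P u p"
  using assms unfolding first_order_def by blast+

lemma
  assumes "b_first_order P B"
  shows bfo_fo: "first_order P"
    and bfo_section: "u \<in> E.sec \<Longrightarrow> B u \<in> F.sec"
    and bfo_add: "u \<in> E.sec \<Longrightarrow> v \<in> E.sec \<Longrightarrow> B (\<lambda>x. u x + v x) p = B u p + B v p"
    and bfo_mult: "u \<in> E.sec \<Longrightarrow> (\<And>x. msmooth_at UNIV f x) \<Longrightarrow> B (\<lambda>x. f x *\<^sub>C u x) p = f p *\<^sub>C B u p"
    and bfo_rho: "u \<in> E.sec \<Longrightarrow> P (\<lambda>x. of_real (\<rho> x) *\<^sub>C u x) p = of_real (\<rho> p) *\<^sub>C (P u p + B u p)"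
  using assms unfolding b_first_order_def by blast+

lemma bfo_fo_B: "b_first_order P B \<Longrightarrow> first_order B"
  unfolding b_first_order_def first_order_def by blast

lemma fo_zero: "first_order P \<Longrightarrow> P (\<lambda>_. 0) p = 0"
  using fo_add[OF _ E.zero_section E.zero_section, of P p] by simp

lemma fo_const: "first_order P \<Longrightarrow> u \<in> E.sec \<Longrightarrow> P (\<lambda>x. c *\<^sub>C u x) p = c *\<^sub>C P u p"
  using fo_mult[of P u "\<lambda>_. c"] msmooth_at_const critical_at_const by blast

lemma fo_diff:
  assumes "first_order P" "u \<in> E.sec" "v \<in> E.sec"
  shows "P (\<lambda>x. u x - v x) p = P u p - P v p"
  using fo_add[OF assms(1,2) E.section_scale[OF assms(3) msmooth_at_const[of UNIV "-1"]], of p]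
    fo_const[OF assms(1,3), of "-1"] by (simp add: complex_vector.scale_minus_left)

lemma fo_sum:
  assumes "first_order P" "\<And>i. i \<in> I \<Longrightarrow> u i \<in> E.sec"
  shows "P (\<lambda>x. \<Sum>i\<in>I. u i x) p = (\<Sum>i\<in>I. P (u i) p)"
  using assms(2)
  by (induction I rule: infinite_finite_induct)
    (auto simp: fo_zero[OF assms(1)] fo_add[OF assms(1) _ E.section_sum])

text \<open>Locality: a section vanishing near \<open>p\<close> is a multiple of itself by a function that is zero near
  \<open>p\<close>.\<close>

lemma fo_local:
  assumes "first_order P" "u \<in> E.sec" "v \<in> E.sec" "open W" "p \<in> W" "\<And>x. x \<in> W \<Longrightarrow> u x = v x"
  shows "P u p = P v p"
proof -
  obtain \<eta> :: "'a \<Rightarrow> real" and V where \<eta>: "\<And>x. msmooth_at UNIV \<eta> x" "open V" "p \<in> V" "\<And>x. x \<in> V \<Longrightarrow> \<eta> x = 1"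
    "closure {x. \<eta> x \<noteq> 0} \<subseteq> W"
    using bump[OF assms(4,5)] by metis
  let ?f = "\<lambda>x. 1 - complex_of_real (\<eta> x)"
  let ?d = "\<lambda>x. u x - v x"
  have "?d x = ?f x *\<^sub>C ?d x" for x
  proof (cases "x \<in> W")
    case False
    then have "\<eta> x = 0" using \<eta>(5) closure_subset[of "{x. \<eta> x \<noteq> 0}"] by blast
    then show ?thesis by simp
  qed (simp add: assms(6))
  then have "P ?d p = P (\<lambda>x. ?f x *\<^sub>C ?d x) p" by presburger
  also have "\<dots> = ?f p *\<^sub>C P ?d p"
  proof (rule fo_mult[OF assms(1) E.section_diff[OF assms(2,3)]])
    show "msmooth_at UNIV ?f x" for x by (intro msmooth_at_diff msmooth_at_const msmooth_at_of_real \<eta>) auto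
    show "critical_at ?f p" by (rule critical_at_cong[OF critical_at_const \<eta>(2,3), of 0]) (simp add: \<eta>(4))
  qed
  also have "\<dots> = 0" using \<eta>(3,4) by simp
  finally show ?thesis using fo_diff[OF assms(1-3)] by simp
qed

text \<open>The commutator \<open>[P, f]\<close> has order zero: for \<open>(f - f(p)) (g - g(p))\<close> has vanishing
  differential at \<open>p\<close>.\<close>

lemma fo_commutator_mult:
  assumes P: "first_order P" and u: "u \<in> E.sec" and f: "\<And>x. msmooth_at UNIV f x" and g: "\<And>x. msmooth_at UNIV g x"
  shows "P (\<lambda>x. f x *\<^sub>C g x *\<^sub>C u x) p - f p *\<^sub>C P (\<lambda>x. g x *\<^sub>C u x) p
    = g p *\<^sub>C (P (\<lambda>x. f x *\<^sub>C u x) p - f p *\<^sub>C P u p)"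
proof -
  let ?h = "\<lambda>x. (f x - f p) * (g x - g p)"
  have fu: "(\<lambda>x. f x *\<^sub>C u x) \<in> E.sec" and gu: "(\<lambda>x. g x *\<^sub>C u x) \<in> E.sec"
    by (intro E.section_scale u f g)+
  have fgu: "(\<lambda>x. f x *\<^sub>C g x *\<^sub>C u x) \<in> E.sec" by (intro E.section_scale gu f)
  note c = E.section_scale[OF _ msmooth_at_const]
  have "0 = P (\<lambda>x. ?h x *\<^sub>C u x) p"
  proof -
    have "\<And>x. msmooth_at UNIV ?h x" by (intro msmooth_at_mult msmooth_at_diff f g msmooth_at_const) auto
    from fo_mult[OF P u this critical_at_prod[OF f g]] show ?thesis by simp
  qed
  also have "(\<lambda>x. ?h x *\<^sub>C u x) = (\<lambda>x. (f x *\<^sub>C g x *\<^sub>C u x - f p *\<^sub>C g x *\<^sub>C u x) - (g p *\<^sub>C f x *\<^sub>C u x - (f p * g p) *\<^sub>C u x))"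
    by (intro ext) (simp add: scaleC_scaleC algebra_simps complex_vector.scale_left_diff_distrib
        complex_vector.scale_right_diff_distrib)
  also have "P \<dots> p = (P (\<lambda>x. f x *\<^sub>C g x *\<^sub>C u x) p - f p *\<^sub>C P (\<lambda>x. g x *\<^sub>C u x) p)
      - (g p *\<^sub>C P (\<lambda>x. f x *\<^sub>C u x) p - (f p * g p) *\<^sub>C P u p)"
    unfolding fo_diff[OF P E.section_diff[OF fgu c[OF gu]] E.section_diff[OF c[OF fu] c[OF u]]]
      fo_diff[OF P fgu c[OF gu]] fo_diff[OF P c[OF fu] c[OF u]]
      fo_const[OF P gu] fo_const[OF P fu] fo_const[OF P u] ..
  finally show ?thesis
    by (simp add: scaleC_scaleC algebra_simps complex_vector.scale_right_diff_distrib)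
qed

lemma bfo_rule:
  assumes P: "b_first_order P B" and u: "u \<in> E.sec" and f: "\<And>x. msmooth_at UNIV f x"
    and d: "critical_at (\<lambda>x. f x - c * of_real (\<rho> x)) p"
  shows "P (\<lambda>x. f x *\<^sub>C u x) p = f p *\<^sub>C P u p + (c * of_real (\<rho> p)) *\<^sub>C B u p"
proof -
  let ?g = "\<lambda>x. f x - c * of_real (\<rho> x)"
  have r: "msmooth_at UNIV (\<lambda>x. complex_of_real (\<rho> x)) x" for x by (intro msmooth_at_of_real rho_smooth)
  have g: "msmooth_at UNIV ?g x" for x by (intro msmooth_at_diff msmooth_at_mult f r msmooth_at_const) auto
  have gu: "(\<lambda>x. ?g x *\<^sub>C u x) \<in> E.sec" and ru: "(\<lambda>x. of_real (\<rho> x) *\<^sub>C u x) \<in> E.sec"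
    by (intro E.section_scale u g r)+
  have "(\<lambda>x. f x *\<^sub>C u x) = (\<lambda>x. ?g x *\<^sub>C u x + c *\<^sub>C of_real (\<rho> x) *\<^sub>C u x)"
    by (intro ext) (simp add: scaleC_scaleC complex_vector.scale_left_diff_distrib)
  then have "P (\<lambda>x. f x *\<^sub>C u x) p = ?g p *\<^sub>C P u p + c *\<^sub>C of_real (\<rho> p) *\<^sub>C (P u p + B u p)"
    using fo_add[OF bfo_fo[OF P] gu E.section_scale[OF ru msmooth_at_const], of c p] fo_mult[OF bfo_fo[OF P] u g d]
      fo_const[OF bfo_fo[OF P] ru] bfo_rho[OF P u] by simp
  then show ?thesis
    by (simp add: scaleC_scaleC scaleC_add_right complex_vector.scale_left_diff_distrib)
qed

text \<open>Near \<open>p\<close> the coefficients of \<open>u\<close> in a frame vanish on \<open>N\<close>, so at \<open>p\<close> their differentials are multiples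
  of \<open>d \<rho>\<close>, and the commutators of \<open>P\<close> with them carry a factor \<open>\<rho>(p) = 0\<close>. In other words, \<open>P\<close>
  differentiates only tangentially.\<close>

lemma bfo_vanish:
  assumes P: "b_first_order P B" and N: "N \<in> components bd" "p \<in> N"
    and u: "u \<in> E.sec" "\<And>x. x \<in> N \<Longrightarrow> u x = 0"
  shows "P u p = 0" "B u p = 0"
proof -
  obtain W es where W: "(W, es) \<in> frames E" "p \<in> W" by (rule E.frame_exists)
  obtain \<psi> :: "'a \<Rightarrow> real" and V where \<psi>: "\<And>x. msmooth_at UNIV \<psi> x" "open V" "p \<in> V" "V \<subseteq> W" "\<And>x. x \<in> V \<Longrightarrow> \<psi> x = 1"
    "closure {x. \<psi> x \<noteq> 0} \<subseteq> W"
    using bump[OF E.frame_open[OF W(1)] W(2)] by metis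
  let ?c = "E.cut_coord \<psi> W es u" and ?e = "E.cut_frame \<psi> W es"
  let ?k = "length es"
  have e: "?e i \<in> E.sec" if "i < ?k" for i by (rule E.cut_frame_section[OF W(1) \<psi>(1,6) that])
  have c: "msmooth_at UNIV (?c i) x" if "i < ?k" for i x by (rule E.cut_coord_smooth[OF W(1) u(1) \<psi>(1,6) that])
  have c0: "?c i x = 0" if "i < ?k" "x \<in> N" for i x
    using that u(2) E.coord_zero[OF W(1)] by (simp add: E.cut_coord_def)
  have ce: "(\<lambda>x. ?c i x *\<^sub>C ?e i x) \<in> E.sec" if "i < ?k" for i
    using that by (intro E.section_scale e c)
  have s: "(\<lambda>x. \<Sum>i<?k. ?c i x *\<^sub>C ?e i x) \<in> E.sec" by (rule E.section_sum) (simp add: ce)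
  have exp: "u x = (\<Sum>i<?k. ?c i x *\<^sub>C ?e i x)" if "x \<in> V" for x
    using that \<psi>(4,5) by (intro E.cut_expand[OF W(1) E.smooth_sectionsD(1)[OF u(1) UNIV_I]]) auto
  have P0: "P (\<lambda>x. ?c i x *\<^sub>C ?e i x) p = 0" if i: "i < ?k" for i
  proof -
    obtain l where "critical_at (\<lambda>x. ?c i x - l * of_real (\<rho> x)) p"
      using vanishing_on_component[OF N c[OF i] c0[OF i]] by blast
    from bfo_rule[OF P e[OF i] c[OF i] this]
    show ?thesis using c0[OF i N(2)] rho_bd[of p] component_subset[OF N(1)] N(2) by (auto simp: subset_iff)
  qed
  show "P u p = 0"
    using fo_local[OF bfo_fo[OF P] u(1) s \<psi>(2,3) exp] fo_sum[OF bfo_fo[OF P], of "{..<?k}"] ce P0 by simp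
  have B0: "B (\<lambda>x. ?c i x *\<^sub>C ?e i x) p = 0" if i: "i < ?k" for i
    using bfo_mult[OF P e[OF i] c[OF i]] c0[OF i N(2)] by simp
  show "B u p = 0"
    using fo_local[OF bfo_fo_B[OF P] u(1) s \<psi>(2,3) exp] fo_sum[OF bfo_fo_B[OF P], of "{..<?k}"] ce B0 by simp
qed

text \<open>The operator \<open>P + B\<close> is again totally characteristic, with the same \<open>B\<close>. It equals \<open>\<rho>\<^sup>-\<^sup>1 P \<rho>\<close>, and comparing its
  formal adjoint with that of \<open>P\<close> will exhibit the adjoint of \<open>B\<close>.\<close>

lemma bfo_shift:
  assumes P: "b_first_order P B"
  shows "b_first_order (\<lambda>u x. P u x + B u x) B"
proof -
  note fo = bfo_fo[OF P] and foB = bfo_fo_B[OF P]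
  have r: "msmooth_at UNIV (\<lambda>x. complex_of_real (\<rho> x)) x" for x by (intro msmooth_at_of_real rho_smooth)
  have 1: "first_order (\<lambda>u x. P u x + B u x)"
    unfolding first_order_def
  proof (intro conjI ballI allI impI)
    fix u v :: "'a \<Rightarrow> 'e" and f :: "'a \<Rightarrow> complex" and p assume u: "u \<in> E.sec"
    show "(\<lambda>x. P u x + B u x) \<in> F.sec" by (intro F.section_add fo_section[OF fo u] fo_section[OF foB u])
    show "P (\<lambda>x. u x + v x) p + B (\<lambda>x. u x + v x) p = P u p + B u p + (P v p + B v p)" if "v \<in> E.sec"
      using fo_add[OF fo u that] fo_add[OF foB u that] by simp
    show "P (\<lambda>x. f x *\<^sub>C u x) p + B (\<lambda>x. f x *\<^sub>C u x) p = f p *\<^sub>C (P u p + B u p)"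
      if "\<forall>x. msmooth_at UNIV f x" "critical_at f p"
      using fo_mult[OF fo u _ that(2)] fo_mult[OF foB u _ that(2)] that(1) by (simp add: scaleC_add_right)
  qed
  show ?thesis
    unfolding b_first_order_def
  proof (intro conjI ballI allI impI 1)
    fix u v :: "'a \<Rightarrow> 'e" and f :: "'a \<Rightarrow> complex" and p assume u: "u \<in> E.sec"
    show "B u \<in> F.sec" by (rule bfo_section[OF P u])
    show "B (\<lambda>x. u x + v x) p = B u p + B v p" if "v \<in> E.sec" by (rule bfo_add[OF P u that])
    show "B (\<lambda>x. f x *\<^sub>C u x) p = f p *\<^sub>C B u p" if "\<forall>x. msmooth_at UNIV f x"
      by (rule bfo_mult[OF P u]) (simp add: that)
    show "P (\<lambda>x. of_real (\<rho> x) *\<^sub>C u x) p + B (\<lambda>x. of_real (\<rho> x) *\<^sub>C u x) p =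
        of_real (\<rho> p) *\<^sub>C (P u p + B u p + B u p)"
      using bfo_rho[OF P u] bfo_mult[OF P u r] by (simp add: scaleC_add_right)
  qed
qed

subsection \<open>Differential operators in charts\<close>

lemma smooth_at_coord:
  assumes ch: "(U, \<phi>) \<in> \<A>" "p \<in> U" and W: "(W, es) \<in> frames E" "p \<in> W" and O': "open W'" "p \<in> W'"
    and u: "u \<in> E.sec" and i: "i < length es"
  shows "smooth_at (\<phi> ` (U \<inter> W \<inter> W')) ((\<lambda>x. coord es x (u x) i) \<circ> inv_into U \<phi>) (\<phi> p)"
proof -
  have "msmooth_at (W \<inter> UNIV) (\<lambda>x. coord es x (u x) i) p"
    using E.smooth_sectionsD(3)[OF u W UNIV_I i] .
  from msmooth_at_chart[OF this _ ch] W(2)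
  have "smooth_at (\<phi> ` (U \<inter> W)) ((\<lambda>x. coord es x (u x) i) \<circ> inv_into U \<phi>) (\<phi> p)" by simp
  then show ?thesis by (rule smooth_at_cong[of _ _ _ UNIV]) auto
qed

lemma pderivs_add:
  fixes g :: "'v \<Rightarrow> complex"
  assumes V: "rel_open V" "y \<in> V" and g: "smooth_at V g y" "smooth_at V h y"
    and k: "\<And>z. z \<in> V \<Longrightarrow> k z = g z + h z" and bs: "length bs \<le> 1"
  shows "pderivs V bs k y = pderivs V bs g y + pderivs V bs h y"
proof (cases bs)
  case Nil
  then show ?thesis using k V by simp
next
  case (Cons b bs')
  then have bs': "bs = [b]" using bs by simp
  have "(k has_derivative (\<lambda>v. frechet_derivative g (at y within V) v + frechet_derivative h (at y within V) v)) (at y within V)"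
    by (rule has_derivative_transform[OF V(2) k has_derivative_add[OF smooth_at_imp_has_derivative[OF g(1) V(2)] smooth_at_imp_has_derivative[OF g(2) V(2)]]])
  from rel_open_frechet_derivative[OF V this] show ?thesis unfolding bs' by simp
qed

lemma pderivs_mult:
  fixes g :: "'v \<Rightarrow> complex"
  assumes V: "rel_open V" "y \<in> V" and g: "smooth_at V g y" and f: "(f has_derivative (\<lambda>_. 0)) (at y within V)"
    and k: "\<And>z. z \<in> V \<Longrightarrow> k z = f z * g z" and bs: "length bs \<le> 1"
  shows "pderivs V bs k y = f y * pderivs V bs g y"
proof (cases bs)
  case Nil
  then show ?thesis using k V by simp
next
  case (Cons b bs')
  then have bs': "bs = [b]" using bs by simp
  have "(k has_derivative (\<lambda>v. f y * frechet_derivative g (at y within V) v + 0 * g y)) (at y within V)"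
    by (rule has_derivative_transform[OF V(2) k has_derivative_mult[OF f smooth_at_imp_has_derivative[OF g V(2)]]])
  from rel_open_frechet_derivative[OF V this] show ?thesis unfolding bs' by simp
qed

text \<open>In the coordinate formula a factor whose differential vanishes at the point can be pulled out of the
  words of length at most \<open>1\<close>.\<close>

lemma diff_operator_first_order:
  assumes P: "diff_operator \<A> E F 1 P"
  shows "first_order P"
proof -
  have sec: "P u \<in> F.sec" if "u \<in> E.sec" for u using P that unfolding diff_operator_def by blast
  have formula: "\<exists>a. \<forall>u\<in>E.sec. \<forall>p\<in>U \<inter> W \<inter> W'. \<forall>j<length fs. coord fs p (P u p) j =
         (\<Sum>bs\<in>{bs. set bs \<subseteq> Basis \<and> length bs \<le> 1}. \<Sum>i<length es. a bs j i (\<phi> p) *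
            pderivs (\<phi> ` (U \<inter> W \<inter> W')) bs ((\<lambda>x. coord es x (u x) i) \<circ> inv_into U \<phi>) (\<phi> p))"
    if "(U, \<phi>) \<in> \<A>" "(W, es) \<in> frames E" "(W', fs) \<in> frames F" for U \<phi> W es W' fs
  proof -
    have "\<forall>(U, \<phi>)\<in>\<A>. \<forall>(W, es)\<in>frames E. \<forall>(W', fs)\<in>frames F.
        let V = \<phi> ` (U \<inter> W \<inter> W') in
        \<exists>a :: 'v list \<Rightarrow> nat \<Rightarrow> nat \<Rightarrow> 'v \<Rightarrow> complex.
          (\<forall>bs j i. smooth_on V (a bs j i)) \<and>
          (\<forall>u\<in>E.sec. \<forall>p\<in>U \<inter> W \<inter> W'. \<forall>j<length fs.
             coord fs p (P u p) j =
               (\<Sum>bs\<in>{bs. set bs \<subseteq> Basis \<and> length bs \<le> 1}. \<Sum>i<length es.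
                  a bs j i (\<phi> p) *
                  pderivs V bs ((\<lambda>x. coord es x (u x) i) \<circ> inv_into U \<phi>) (\<phi> p)))"
      using P unfolding diff_operator_def by (rule conjunct2)
    note * = bspec[OF this that(1), unfolded prod.case]
    note ** = bspec[OF * that(2), unfolded prod.case]
    note *** = bspec[OF ** that(3), unfolded prod.case Let_def]
    from *** show ?thesis by (elim exE conjE, intro exI) assumption
  qed
  show ?thesis
    unfolding first_order_def
  proof (intro conjI ballI allI impI)
    fix u v p assume u: "u \<in> E.sec" and v: "v \<in> E.sec"
    have uv: "(\<lambda>x. u x + v x) \<in> E.sec" by (rule E.section_add[OF u v])
    obtain U \<phi> where ch: "(U, \<phi>) \<in> \<A>" "p \<in> U" by (rule chart_exists)
    obtain W es where W: "(W, es) \<in> frames E" "p \<in> W" by (rule E.frame_exists)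
    obtain W' fs where W': "(W', fs) \<in> frames F" "p \<in> W'" by (rule F.frame_exists)
    let ?V = "\<phi> ` (U \<inter> W \<inter> W')"
    have V: "rel_open ?V" "\<phi> p \<in> ?V"
      using chart_rel_open_Int[OF ch(1) open_Int[OF E.frame_open[OF W(1)] F.frame_open[OF W'(1)]]] ch W W'
      by (auto simp: Int_assoc)
    obtain a where a: "\<And>u p j. u \<in> E.sec \<Longrightarrow> p \<in> U \<inter> W \<inter> W' \<Longrightarrow> j < length fs \<Longrightarrow> coord fs p (P u p) j =
         (\<Sum>bs\<in>{bs. set bs \<subseteq> Basis \<and> length bs \<le> 1}. \<Sum>i<length es. a bs j i (\<phi> p) *
            pderivs ?V bs ((\<lambda>x. coord es x (u x) i) \<circ> inv_into U \<phi>) (\<phi> p))"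
      using formula[OF ch(1) W(1) W'(1)] by blast
    have p: "p \<in> U \<inter> W \<inter> W'" using ch W W' by blast
    have chart_deriv: "pderivs ?V bs ((\<lambda>x. coord es x (u x + v x) i) \<circ> inv_into U \<phi>) (\<phi> p) =
        pderivs ?V bs ((\<lambda>x. coord es x (u x) i) \<circ> inv_into U \<phi>) (\<phi> p) +
        pderivs ?V bs ((\<lambda>x. coord es x (v x) i) \<circ> inv_into U \<phi>) (\<phi> p)"
      if i: "i < length es" and bs: "length bs \<le> 1" for i bs
    proof (rule pderivs_add[OF V _ _ _ bs])
      show "((\<lambda>x. coord es x (u x + v x) i) \<circ> inv_into U \<phi>) z =
         ((\<lambda>x. coord es x (u x) i) \<circ> inv_into U \<phi>) z + ((\<lambda>x. coord es x (v x) i) \<circ> inv_into U \<phi>) z"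
        if "z \<in> ?V" for z
      proof -
        obtain x where x: "x \<in> U" "x \<in> W" "z = \<phi> x" using \<open>z \<in> ?V\<close> by blast
        then show ?thesis
          using E.coord_add[OF W(1) x(2) E.smooth_sectionsD(1)[OF u UNIV_I] E.smooth_sectionsD(1)[OF v UNIV_I] i] ch(1)
          by simp
      qed
    qed (rule smooth_at_coord[OF ch W F.frame_open[OF W'(1)] W'(2) _ i], fact)+
    show "P (\<lambda>x. u x + v x) p = P u p + P v p"
    proof (rule F.coord_inject[OF W'])
      fix j assume j: "j < length fs"
      have "coord fs p (P (\<lambda>x. u x + v x) p) j = coord fs p (P u p) j + coord fs p (P v p) j"
        unfolding a[OF uv p j] a[OF u p j] a[OF v p j] sum.distrib[symmetric]
        by (intro sum.cong refl) (simp add: chart_deriv distrib_left)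
      then show "coord fs p (P (\<lambda>x. u x + v x) p) j = coord fs p (P u p + P v p) j"
        using F.coord_add[OF W' F.smooth_sectionsD(1)[OF sec[OF u]] F.smooth_sectionsD(1)[OF sec[OF v]] j] by simp
    qed (use F.smooth_sectionsD(1)[OF sec] u v uv in \<open>auto intro: F.fiber_add\<close>)
  next
    fix u :: "'a \<Rightarrow> 'e" and f :: "'a \<Rightarrow> complex" and p assume u: "u \<in> E.sec" and f: "\<forall>x. msmooth_at UNIV f x" and d: "critical_at f p"
    have fu: "(\<lambda>x. f x *\<^sub>C u x) \<in> E.sec" by (rule E.section_scale[OF u]) (simp add: f)
    obtain U \<phi> where ch: "(U, \<phi>) \<in> \<A>" "p \<in> U"
      and der: "((f \<circ> inv_into U \<phi>) has_derivative (\<lambda>_. 0)) (at (\<phi> p) within \<phi> ` U)"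
      using d unfolding critical_at_def by blast
    obtain W es where W: "(W, es) \<in> frames E" "p \<in> W" by (rule E.frame_exists)
    obtain W' fs where W': "(W', fs) \<in> frames F" "p \<in> W'" by (rule F.frame_exists)
    let ?V = "\<phi> ` (U \<inter> W \<inter> W')"
    have V: "rel_open ?V" "\<phi> p \<in> ?V"
      using chart_rel_open_Int[OF ch(1) open_Int[OF E.frame_open[OF W(1)] F.frame_open[OF W'(1)]]] ch W W'
      by (auto simp: Int_assoc)
    obtain a where a: "\<And>u p j. u \<in> E.sec \<Longrightarrow> p \<in> U \<inter> W \<inter> W' \<Longrightarrow> j < length fs \<Longrightarrow> coord fs p (P u p) j =
         (\<Sum>bs\<in>{bs. set bs \<subseteq> Basis \<and> length bs \<le> 1}. \<Sum>i<length es. a bs j i (\<phi> p) *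
            pderivs ?V bs ((\<lambda>x. coord es x (u x) i) \<circ> inv_into U \<phi>) (\<phi> p))"
      using formula[OF ch(1) W(1) W'(1)] by blast
    have p: "p \<in> U \<inter> W \<inter> W'" using ch W W' by blast
    have derV: "((f \<circ> inv_into U \<phi>) has_derivative (\<lambda>_. 0)) (at (\<phi> p) within ?V)"
      by (rule has_derivative_subset[OF der]) blast
    have chart_deriv: "pderivs ?V bs ((\<lambda>x. coord es x (f x *\<^sub>C u x) i) \<circ> inv_into U \<phi>) (\<phi> p) =
        f p * pderivs ?V bs ((\<lambda>x. coord es x (u x) i) \<circ> inv_into U \<phi>) (\<phi> p)"
      if i: "i < length es" and bs: "length bs \<le> 1" for i bs
    proof -
      have "pderivs ?V bs ((\<lambda>x. coord es x (f x *\<^sub>C u x) i) \<circ> inv_into U \<phi>) (\<phi> p) =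
        (f \<circ> inv_into U \<phi>) (\<phi> p) * pderivs ?V bs ((\<lambda>x. coord es x (u x) i) \<circ> inv_into U \<phi>) (\<phi> p)"
      proof (rule pderivs_mult[OF V _ derV _ bs])
        show "((\<lambda>x. coord es x (f x *\<^sub>C u x) i) \<circ> inv_into U \<phi>) z =
           (f \<circ> inv_into U \<phi>) z * ((\<lambda>x. coord es x (u x) i) \<circ> inv_into U \<phi>) z"
          if "z \<in> ?V" for z
        proof -
          obtain x where x: "x \<in> U" "x \<in> W" "z = \<phi> x" using \<open>z \<in> ?V\<close> by blast
          then show ?thesis
            using E.coord_scale[OF W(1) x(2) E.smooth_sectionsD(1)[OF u UNIV_I] i] ch(1) by simp
        qed
      qed (rule smooth_at_coord[OF ch W F.frame_open[OF W'(1)] W'(2) u i])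
      then show ?thesis using ch by simp
    qed
    show "P (\<lambda>x. f x *\<^sub>C u x) p = f p *\<^sub>C P u p"
    proof (rule F.coord_inject[OF W'])
      fix j assume j: "j < length fs"
      have "coord fs p (P (\<lambda>x. f x *\<^sub>C u x) p) j = f p * coord fs p (P u p) j"
        unfolding a[OF fu p j] a[OF u p j] sum_distrib_left
        by (intro sum.cong refl) (simp add: chart_deriv)
      then show "coord fs p (P (\<lambda>x. f x *\<^sub>C u x) p) j = coord fs p (f p *\<^sub>C P u p) j"
        using F.coord_scale[OF W' F.smooth_sectionsD(1)[OF sec[OF u]] j] by simp
    qed (use F.smooth_sectionsD(1)[OF sec] u fu in \<open>auto intro: F.fiber_scale\<close>)
  qed (rule sec)
qed

text \<open>If \<open>Q\<close> extends \<open>\<rho>\<^sup>-\<^sup>1 P \<rho>\<close> smoothly up to the boundary, then \<open>B = Q - P\<close>. In the interior \<open>\<rho> B\<close> is the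
  commutator \<open>[P, \<rho>]\<close>, so \<open>B\<close> has order zero there, and by density everywhere.\<close>

lemma b_diff_operator_b_first_order:
  assumes "b_diff_operator \<A> \<rho> E F 1 P"
  obtains B where "b_first_order P B"
proof -
  obtain Q where Q: "diff_operator \<A> E F 1 Q" and PQ: "\<And>u x. u \<in> E.sec \<Longrightarrow> x \<notin> bd \<Longrightarrow>
      Q u x = inverse (of_real (\<rho> x ^ 1)) *\<^sub>C P (\<lambda>y. of_real (\<rho> y ^ 1) *\<^sub>C u y) x"
    and P: "diff_operator \<A> E F 1 P"
    using assms unfolding b_diff_operator_def by fastforce
  note foP = diff_operator_first_order[OF P] and foQ = diff_operator_first_order[OF Q]
  let ?r = "\<lambda>x. complex_of_real (\<rho> x)"
  have r: "msmooth_at UNIV ?r x" for x by (intro msmooth_at_of_real rho_smooth)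
  have ru: "(\<lambda>x. ?r x *\<^sub>C u x) \<in> E.sec" if "u \<in> E.sec" for u by (intro E.section_scale that r)
  have Pr: "P (\<lambda>x. ?r x *\<^sub>C u x) p = ?r p *\<^sub>C Q u p" if u: "u \<in> E.sec" for u p
  proof (rule F.section_eq_by_density[OF fo_section[OF foP ru[OF u]] _ open_UNIV UNIV_I])
    show "(\<lambda>p. ?r p *\<^sub>C Q u p) \<in> F.sec" by (rule F.section_scale[OF fo_section[OF foQ u] r])
    show "P (\<lambda>x. ?r x *\<^sub>C u x) x = ?r x *\<^sub>C Q u x" if "x \<notin> bd" for x
      using PQ[OF u that] rho_pos[OF that] by (simp add: scaleC_scaleC)
  qed
  define B where "B u x = Q u x - P u x" for u x
  have Bsec: "B u \<in> F.sec" if "u \<in> E.sec" for u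
    unfolding B_def[abs_def] by (intro F.section_diff fo_section[OF foP that] fo_section[OF foQ that])
  have rB: "?r p *\<^sub>C B u p = P (\<lambda>x. ?r x *\<^sub>C u x) p - ?r p *\<^sub>C P u p" if "u \<in> E.sec" for u p
    using Pr[OF that] by (simp add: B_def complex_vector.scale_right_diff_distrib)
  have "b_first_order P B"
    unfolding b_first_order_def
  proof (intro conjI ballI allI impI foP Bsec)
    fix u v :: "'a \<Rightarrow> 'e" and f :: "'a \<Rightarrow> complex" and p assume u: "u \<in> E.sec"
    show "B (\<lambda>x. u x + v x) p = B u p + B v p" if v: "v \<in> E.sec"
      using fo_add[OF foP u v] fo_add[OF foQ u v] by (simp add: B_def)
    show "P (\<lambda>x. ?r x *\<^sub>C u x) p = ?r p *\<^sub>C (P u p + B u p)"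
      using Pr[OF u] by (simp add: B_def)
    assume f: "\<forall>x. msmooth_at UNIV f x"
    have fu: "(\<lambda>x. f x *\<^sub>C u x) \<in> E.sec" by (rule E.section_scale[OF u]) (simp add: f)
    show "B (\<lambda>x. f x *\<^sub>C u x) p = f p *\<^sub>C B u p"
    proof (rule F.section_eq_by_density[OF Bsec[OF fu] F.section_scale[OF Bsec[OF u]] open_UNIV UNIV_I])
      fix x assume x: "x \<notin> bd"
      have "?r x *\<^sub>C B (\<lambda>x. f x *\<^sub>C u x) x = f x *\<^sub>C ?r x *\<^sub>C B u x"
        unfolding rB[OF fu] rB[OF u] using fo_commutator_mult[OF foP u r, where g = f and p = x] f by blast
      then have "?r x *\<^sub>C B (\<lambda>x. f x *\<^sub>C u x) x = ?r x *\<^sub>C f x *\<^sub>C B u x"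
        by (simp add: scaleC_scaleC mult.commute)
      then show "B (\<lambda>x. f x *\<^sub>C u x) x = f x *\<^sub>C B u x"
        unfolding complex_vector.scale_cancel_left using rho_pos[OF x] by simp
    qed (simp add: f)
  qed
  then show thesis by (rule that)
qed

end

section \<open>Integration\<close>

text \<open>By dominated convergence the integral is the limit of the integrals of the difference quotients, and
  these vanish by translation invariance.\<close>

lemma integral_directional_derivative_eq_0:
  fixes g :: "'v::euclidean_space \<Rightarrow> complex"
  assumes \<Omega>: "open \<Omega>" and K: "compact K" "K \<subseteq> \<Omega>" and gK: "\<And>y. y \<notin> K \<Longrightarrow> g y = 0"
    and der: "\<And>y. y \<in> \<Omega> \<Longrightarrow> (g has_derivative g' y) (at y)"
    and cont: "continuous_on \<Omega> (\<lambda>y. g' y b)" and b: "norm b = 1"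
  shows "integrable lborel (\<lambda>y. if y \<in> \<Omega> then g' y b else 0)"
    and "(LINT y|lborel. (if y \<in> \<Omega> then g' y b else 0)) = 0"
proof -
  define D where "D y = (if y \<in> \<Omega> then g' y else (\<lambda>_. 0))" for y
  have clK: "closed K" using K(1) by (rule compact_imp_closed)
  have zero_der: "(g has_derivative (\<lambda>_. 0)) (at y)" if "y \<notin> K" for y
    by (rule has_derivative_transform_within_open[OF has_derivative_const[of 0] open_Compl[OF clK]])
      (use that gK in auto)
  have g'0: "g' y = (\<lambda>_. 0)" if "y \<in> \<Omega>" "y \<notin> K" for y
    using has_derivative_unique[OF der[OF that(1)] zero_der[OF that(2)]] .
  have D0: "D y = (\<lambda>_. 0)" if "y \<notin> K" for y using g'0[OF _ that] by (simp add: D_def)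
  have derD: "(g has_derivative D y) (at y)" for y
    using der zero_der K(2) by (auto simp: D_def)
  have contD: "continuous_on UNIV (\<lambda>y. D y b)"
  proof -
    have "continuous_on \<Omega> (\<lambda>y. D y b)" by (rule continuous_on_cong[THEN iffD2, OF refl _ cont]) (simp add: D_def)
    moreover have "continuous_on (- K) (\<lambda>y. D y b)"
      by (rule continuous_on_cong[THEN iffD2, OF refl _ continuous_on_const[of _ 0]]) (simp add: D0)
    ultimately have "continuous_on (\<Omega> \<union> - K) (\<lambda>y. D y b)"
      using \<Omega> clK by (intro continuous_on_open_Un) auto
    moreover have "\<Omega> \<union> - K = UNIV" using K(2) by blast
    ultimately show ?thesis by simp
  qed
  have "compact ((\<lambda>y. D y b) ` K)" using contD K(1) by (meson compact_continuous_image continuous_on_subset subset_UNIV)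
  then obtain C where C: "\<And>y. y \<in> K \<Longrightarrow> norm (D y b) \<le> C" "C \<ge> 0"
    by (metis bounded_pos compact_imp_bounded image_eqI less_imp_le)
  have CD: "norm (D y b) \<le> C" for y using C D0[of y] by (cases "y \<in> K") auto
  have lip: "norm (g (y + t *\<^sub>R b) - g y) \<le> C * t" if "t \<ge> 0" for y t
  proof -
    have "((\<lambda>s. g (y + s *\<^sub>R b)) has_derivative (\<lambda>h. h *\<^sub>R D (y + s *\<^sub>R b) b)) (at s within {0..t})" for s
    proof -
      have "((\<lambda>s. y + s *\<^sub>R b) has_derivative (\<lambda>h. h *\<^sub>R b)) (at s within {0..t})"
        by (auto intro!: derivative_eq_intros)
      from has_derivative_compose[OF this derD]
      show ?thesis using linear_scale[OF has_derivative_linear[OF derD]] by simp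
    qed
    then have "norm (g (y + t *\<^sub>R b) - g (y + 0 *\<^sub>R b)) \<le> C * norm (t - 0)"
      using that CD
      by (intro differentiable_bound[of "{0..t}" "\<lambda>s. g (y + s *\<^sub>R b)" "\<lambda>s h. h *\<^sub>R D (y + s *\<^sub>R b) b"])
        (auto intro!: onorm_le, metis CD abs_ge_zero mult.commute mult_left_mono)
    then show ?thesis using that by simp
  qed
  obtain R where R: "\<And>y. y \<in> K \<Longrightarrow> norm y \<le> R" using K(1) by (meson bounded_iff compact_imp_bounded)
  have gcont: "continuous_on UNIV g"
    using derD by (meson continuous_at_imp_continuous_on has_derivative_continuous)
  then have gm: "g \<in> borel_measurable borel" by (rule borel_measurable_continuous_onI)
  have shm: "(\<lambda>y. g (y + c)) \<in> borel_measurable borel" for c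
    by (intro borel_measurable_continuous_onI continuous_on_compose2[OF gcont] continuous_intros) auto
  have indI: "integrable lborel (\<lambda>y::'v. c * indicator (cball 0 r) y :: real)" for c r
    by (intro integrable_mult_right integrable_real_indicator) (use emeasure_lborel_cball_finite[of "0::'v" r] in auto)
  have gcK: "compact (g ` K)" using gcont K(1) by (meson compact_continuous_image continuous_on_subset subset_UNIV)
  then obtain G where G: "\<And>y. y \<in> K \<Longrightarrow> norm (g y) \<le> G" "G \<ge> 0"
    by (metis bounded_pos compact_imp_bounded image_eqI less_imp_le)
  have gint: "integrable lborel g"
    by (rule Bochner_Integration.integrable_bound[OF indI[of G R]])
      (use gm G R gK in \<open>auto simp: indicator_def split: if_splits\<close>, force)
  have shift: "(LINT y|lborel. g (y + c)) = (LINT y|lborel. g y)" "integrable lborel (\<lambda>y. g (y + c))" for c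
  proof -
    have "integral\<^sup>L (distr lborel borel ((+) c)) g = (LINT y|lborel. g (c + y))"
      by (rule integral_distr) (use gm in auto)
    then show "(LINT y|lborel. g (y + c)) = (LINT y|lborel. g y)" by (simp add: lborel_distr_plus add.commute)
    have "integrable (distr lborel borel ((+) c)) g \<longleftrightarrow> integrable lborel (\<lambda>y. g (c + y))"
      by (rule integrable_distr_eq) (use gm in auto)
    then show "integrable lborel (\<lambda>y. g (y + c))" using gint by (simp add: lborel_distr_plus add.commute)
  qed
  define s where "s n y = real (Suc n) *\<^sub>R (g (y + inverse (real (Suc n)) *\<^sub>R b) - g y)" for n y
  have s0: "(LINT y|lborel. s n y) = 0" for n
    unfolding s_def using shift gint by simp
  have conv: "(\<lambda>n. s n y) \<longlonglongrightarrow> D y b" for y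
  proof -
    have "((\<lambda>t. y + t *\<^sub>R b) has_derivative (\<lambda>h. h *\<^sub>R b)) (at 0)"
      by (auto intro!: derivative_eq_intros)
    from has_derivative_compose[OF this derD]
    have "((\<lambda>t. g (y + t *\<^sub>R b)) has_derivative (\<lambda>h. h *\<^sub>R D y b)) (at 0)"
      using linear_scale[OF has_derivative_linear[OF derD]] by simp
    then have "((\<lambda>t. norm (g (y + t *\<^sub>R b) - g y - t *\<^sub>R D y b) / norm t) \<longlongrightarrow> 0) (at 0)"
      by (simp add: has_derivative_at)
    then have "((\<lambda>t. norm ((g (y + t *\<^sub>R b) - g y) /\<^sub>R t - D y b)) \<longlongrightarrow> 0) (at 0)"
    proof (rule Lim_transform_eventually)
      have "norm (g (y + t *\<^sub>R b) - g y - t *\<^sub>R D y b) / norm t = norm ((g (y + t *\<^sub>R b) - g y) /\<^sub>R t - D y b)"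
        if "t \<noteq> 0" for t
      proof -
        have "(g (y + t *\<^sub>R b) - g y) /\<^sub>R t - D y b = (g (y + t *\<^sub>R b) - g y - t *\<^sub>R D y b) /\<^sub>R t"
          using that by (simp add: scaleR_diff_right)
        then show ?thesis by (simp add: divide_inverse mult.commute)
      qed
      then show "\<forall>\<^sub>F t in at 0. norm (g (y + t *\<^sub>R b) - g y - t *\<^sub>R D y b) / norm t
          = norm ((g (y + t *\<^sub>R b) - g y) /\<^sub>R t - D y b)"
        by (simp add: eventually_at_filter)
    qed
    then have "((\<lambda>t. (g (y + t *\<^sub>R b) - g y) /\<^sub>R t) \<longlongrightarrow> D y b) (at 0)"
      by (rule LIM_zero_cancel[OF tendsto_norm_zero_cancel])
    moreover have "filterlim (\<lambda>n. inverse (real (Suc n))) (at 0) sequentially"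
      using LIMSEQ_inverse_real_of_nat by (auto simp: filterlim_at)
    ultimately have "(\<lambda>n. (g (y + inverse (real (Suc n)) *\<^sub>R b) - g y) /\<^sub>R inverse (real (Suc n))) \<longlonglongrightarrow> D y b"
      by (rule filterlim_compose)
    then show ?thesis by (simp add: s_def)
  qed
  have bound: "norm (s n y) \<le> C * indicator (cball 0 (R + 1)) y" for n y
  proof (cases "y \<in> cball 0 (R + 1)")
    case True
    have "norm (s n y) \<le> real (Suc n) * (C * inverse (real (Suc n)))"
      unfolding s_def norm_scaleR using lip[of "inverse (real (Suc n))" y] by (intro mult_mono) auto
    also have "\<dots> = C" by (simp del: of_nat_Suc add: field_simps)
    finally show ?thesis using True by simp
  next
    case False
    let ?z = "y + inverse (real (Suc n)) *\<^sub>R b"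
    have "norm y \<le> norm ?z + norm (inverse (real (Suc n)) *\<^sub>R b)"
      using norm_triangle_ineq4[of ?z "inverse (real (Suc n)) *\<^sub>R b"] by simp
    moreover have "norm (inverse (real (Suc n)) *\<^sub>R b) \<le> 1" using b by (simp add: inverse_le_1_iff)
    ultimately have "norm ?z > R" using False by auto
    then have "g ?z = 0" using R gK by force
    moreover have "g y = 0" using False R gK by force
    ultimately show ?thesis using False by (simp add: s_def)
  qed
  have Dm: "(\<lambda>y. D y b) \<in> borel_measurable lborel"
    using borel_measurable_continuous_onI[OF contD] by simp
  have sm: "s n \<in> borel_measurable lborel" for n
    unfolding s_def[abs_def] using gm shm by simp
  have "AE y in lborel. (\<lambda>n. s n y) \<longlonglongrightarrow> D y b" "\<And>n. AE y in lborel. norm (s n y) \<le> C * indicator (cball 0 (R + 1)) y"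
    using conv bound by auto
  note dc = Dm sm indI this
  have "integrable lborel (\<lambda>y. D y b)" by (rule integrable_dominated_convergence[OF dc])
  moreover have "(\<lambda>n. LINT y|lborel. s n y) \<longlonglongrightarrow> (LINT y|lborel. D y b)"
    by (rule integral_dominated_convergence[OF dc])
  then have "(LINT y|lborel. D y b) = 0" using s0 by (simp add: LIMSEQ_const_iff)
  moreover have "(\<lambda>y. D y b) = (\<lambda>y. if y \<in> \<Omega> then g' y b else 0)" by (auto simp: D_def)
  ultimately show "integrable lborel (\<lambda>y. if y \<in> \<Omega> then g' y b else 0)"
    and "(LINT y|lborel. (if y \<in> \<Omega> then g' y b else 0)) = 0" by simp_all
qed

locale b_measure = bmanifold \<A> \<rho>
  for \<A> :: "('a::t2_space, 'v::euclidean_space) atlas" and \<rho> :: "'a \<Rightarrow> real" +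
  fixes \<mu> :: "'a measure"
  assumes dens: "smooth_positive_b_density \<A> \<rho> \<mu>"
begin

text \<open>The smooth density \<open>\<rho> \<mu>\<close>, which is finite, in contrast to \<open>\<mu>\<close>.\<close>

definition nu :: "'a measure" where
  "nu = (SOME \<nu>. smooth_positive_density \<A> \<nu> \<and> \<mu> = density \<nu> (\<lambda>x. ennreal (1 / \<rho> x)))"

lemma nu: "smooth_positive_density \<A> nu" "\<mu> = density nu (\<lambda>x. ennreal (1 / \<rho> x))"
proof -
  have "smooth_positive_density \<A> nu \<and> \<mu> = density nu (\<lambda>x. ennreal (1 / \<rho> x))"
    unfolding nu_def by (rule someI_ex) (use dens in \<open>simp add: smooth_positive_b_density_def\<close>)
  then show "smooth_positive_density \<A> nu" "\<mu> = density nu (\<lambda>x. ennreal (1 / \<rho> x))" by blast+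
qed

lemma sets_nu[measurable_cong]: "sets nu = sets borel"
  using nu(1) by (simp add: smooth_positive_density_def)

lemma space_nu: "space nu = UNIV"
  using sets_eq_imp_space_eq[OF sets_nu] by simp

lemma chart_density:
  assumes "(U, \<phi>) \<in> \<A>"
  obtains \<delta> :: "'v \<Rightarrow> real" where "smooth_on (\<phi> ` U) \<delta>" "\<And>y. y \<in> \<phi> ` U \<Longrightarrow> \<delta> y > 0"
    "\<And>B. B \<in> sets borel \<Longrightarrow> B \<subseteq> U \<Longrightarrow> emeasure nu B = (\<integral>\<^sup>+y\<in>\<phi> ` B. ennreal (\<delta> y) \<partial>lborel)"
proof -
  have "\<forall>(U, \<phi>)\<in>\<A>. \<exists>\<delta>::'v \<Rightarrow> real. smooth_on (\<phi> ` U) \<delta> \<and> (\<forall>y\<in>\<phi> ` U. \<delta> y > 0) \<and>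
        (\<forall>B\<in>sets borel. B \<subseteq> U \<longrightarrow> emeasure nu B = (\<integral>\<^sup>+y\<in>\<phi> ` B. ennreal (\<delta> y) \<partial>lborel))"
    using nu(1) unfolding smooth_positive_density_def by (rule conjunct2)
  from bspec[OF this assms, unfolded prod.case] show thesis using that by blast
qed

lemma rel_open_borel: "rel_open (T :: 'v set) \<Longrightarrow> T \<in> sets borel"
proof -
  assume "rel_open T"
  then obtain O' where O: "open O'" "T = half_space \<inter> O'" unfolding openin_open by blast
  have "closed (half_space :: 'v set)"
    using closed_halfspace_ge[of 0 normal_dir] by (simp add: half_space_def inner_commute)
  then show ?thesis unfolding O(2) by (rule sets.Int[OF borel_closed borel_open[OF O(1)]])
qed

text \<open>Over a chart, \<open>nu\<close> is the push-forward of \<open>\<delta> dy\<close> under the inverse of the coordinate map, because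
  both measures agree on Borel sets.\<close>

lemma chart_integral:
  fixes f :: "'a \<Rightarrow> complex"
  assumes ch: "(U, \<phi>) \<in> \<A>"
    and d: "smooth_on (\<phi> ` U) \<delta>" "\<And>y. y \<in> \<phi> ` U \<Longrightarrow> \<delta> y > 0"
      "\<And>B. B \<in> sets borel \<Longrightarrow> B \<subseteq> U \<Longrightarrow> emeasure nu B = (\<integral>\<^sup>+y\<in>\<phi> ` B. ennreal (\<delta> y) \<partial>lborel)"
    and f: "f \<in> borel_measurable borel" "\<And>x. x \<notin> U \<Longrightarrow> f x = 0"
  shows "integral\<^sup>L nu f = (LINT y|lborel. (if y \<in> \<phi> ` U then \<delta> y *\<^sub>R f (inv_into U \<phi> y) else 0))"
proof (cases "U = {}")
  case True
  then have "f = (\<lambda>_. 0)" using f(2) by blast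
  then show ?thesis using True by simp
next
  case False
  then obtain p0 where p0: "p0 \<in> U" by blast
  let ?T = "\<phi> ` U"
  define j where "j y = (if y \<in> ?T then inv_into U \<phi> y else p0)" for y
  define d' where "d' y = (if y \<in> ?T then \<delta> y else 0)" for y
  have T: "?T \<in> sets borel" using rel_open_borel[OF chart_rel_open[OF ch]] .
  have U: "U \<in> sets borel" using chart_open[OF ch] by simp
  have ci: "continuous_on ?T (inv_into U \<phi>)" using chart_homeo[OF ch] by (simp add: homeomorphism_def)
  have jm[measurable]: "j \<in> borel_measurable borel"
    unfolding j_def[abs_def]
    by (rule measurable_restrict_space_iff[THEN iffD1, OF _ _ borel_measurable_continuous_on_restrict[OF ci]])
      (use T in auto)
  have cd: "continuous_on ?T \<delta>"
    using d(1) smooth_at_imp_continuous unfolding smooth_on_iff_smooth_at continuous_on_eq_continuous_within by blast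
  have dm[measurable]: "d' \<in> borel_measurable borel"
    unfolding d'_def[abs_def]
    by (rule measurable_restrict_space_iff[THEN iffD1, OF _ _ borel_measurable_continuous_on_restrict[OF cd]])
      (use T in auto)
  have d'0: "d' y \<ge> 0" for y using d(2)[of y] by (auto simp: d'_def)
  let ?M1 = "density nu (indicator U)"
  let ?M2 = "distr (density lborel (\<lambda>y. ennreal (d' y))) borel j"
  have M: "?M1 = ?M2"
  proof (rule measure_eqI)
    show "sets ?M1 = sets ?M2" by (simp add: sets_nu)
    fix B assume "B \<in> sets ?M1"
    then have B[measurable]: "B \<in> sets borel" by (simp add: sets_nu)
    have UB: "U \<inter> B \<in> sets borel" using U B by blast
    have "emeasure ?M1 B = emeasure nu (U \<inter> B)"
      using U B by (intro emeasure_restricted) (simp_all add: sets_nu)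
    also have "\<dots> = (\<integral>\<^sup>+y\<in>\<phi> ` (U \<inter> B). ennreal (\<delta> y) \<partial>lborel)" by (rule d(3)[OF UB]) blast
    also have "\<dots> = (\<integral>\<^sup>+y. ennreal (d' y) * indicator (j -` B) y \<partial>lborel)"
    proof (rule nn_integral_cong)
      fix y
      show "ennreal (\<delta> y) * indicator (\<phi> ` (U \<inter> B)) y = ennreal (d' y) * indicator (j -` B) y"
      proof (cases "y \<in> ?T")
        case True
        then obtain x where x: "x \<in> U" "y = \<phi> x" by blast
        then have "y \<in> \<phi> ` (U \<inter> B) \<longleftrightarrow> x \<in> B" using inj_on_image_mem_iff[OF chart_inj[OF ch] x(1), of "U \<inter> B"] by auto
        moreover have "j y = x" "d' y = \<delta> y" using x ch True by (auto simp: j_def d'_def)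
        ultimately show ?thesis by (simp add: indicator_def)
      next
        case False
        then have "y \<notin> \<phi> ` (U \<inter> B)" by blast
        then show ?thesis using False by (simp add: d'_def)
      qed
    qed
    also have "\<dots> = emeasure (density lborel (\<lambda>y. ennreal (d' y))) (j -` B)"
      using measurable_sets[OF jm B] by (subst emeasure_density) auto
    also have "\<dots> = emeasure ?M2 B" by (subst emeasure_distr) auto
    finally show "emeasure ?M1 B = emeasure ?M2 B" .
  qed
  have fm: "f \<in> borel_measurable nu" using f(1) measurable_cong_sets[OF sets_nu refl] by blast
  have "integral\<^sup>L nu f = (LINT x|nu. indicator U x *\<^sub>R f x)"
    by (rule Bochner_Integration.integral_cong[OF refl]) (use f(2) in \<open>auto simp: indicator_def\<close>)
  also have "\<dots> = integral\<^sup>L (density nu (\<lambda>x. ennreal (indicator U x))) f"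
    by (rule integral_density[symmetric]) (use fm U in \<open>auto simp: sets_nu\<close>)
  also have "\<dots> = integral\<^sup>L ?M2 f" unfolding M[symmetric] by (simp add: ennreal_indicator)
  also have "\<dots> = integral\<^sup>L (density lborel (\<lambda>y. ennreal (d' y))) (\<lambda>y. f (j y))"
    by (rule integral_distr) (use f(1) in auto)
  also have "\<dots> = (LINT y|lborel. d' y *\<^sub>R f (j y))"
    by (rule integral_density) (use d'0 f(1) in auto)
  also have "\<dots> = (LINT y|lborel. (if y \<in> \<phi> ` U then \<delta> y *\<^sub>R f (inv_into U \<phi> y) else 0))"
    by (rule Bochner_Integration.integral_cong[OF refl]) (simp add: d'_def j_def)
  finally show ?thesis .
qed

text \<open>Each point has a neighbourhood on which the density in a chart is bounded; compactness does the rest.\<close>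

lemma emeasure_nu_finite: "emeasure nu UNIV < \<infinity>"
proof -
  have "\<exists>V. open V \<and> p \<in> V \<and> emeasure nu V < \<infinity>" for p
  proof -
    obtain U \<phi> where ch: "(U, \<phi>) \<in> \<A>" "p \<in> U" by (rule chart_exists)
    obtain \<delta> where d: "smooth_on (\<phi> ` U) \<delta>" "\<And>y. y \<in> \<phi> ` U \<Longrightarrow> \<delta> y > 0"
      "\<And>B. B \<in> sets borel \<Longrightarrow> B \<subseteq> U \<Longrightarrow> emeasure nu B = (\<integral>\<^sup>+y\<in>\<phi> ` B. ennreal (\<delta> y) \<partial>lborel)"
      using chart_density[OF ch(1)] by blast
    have cd: "continuous_on (\<phi> ` U) \<delta>"
      using d(1) smooth_at_imp_continuous unfolding smooth_on_iff_smooth_at continuous_on_eq_continuous_within by blast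
    obtain O' where O: "open O'" "\<phi> p \<in> O'" "half_space \<inter> O' = \<phi> ` U"
      using rel_openE[OF chart_rel_open[OF ch(1)]] ch(2) by (metis imageI)
    obtain e where e: "e > 0" "cball (\<phi> p) e \<subseteq> O'" using O open_contains_cball by blast
    let ?C = "half_space \<inter> cball (\<phi> p) e"
    have "closed (half_space :: 'v set)"
      using closed_halfspace_ge[of 0 normal_dir] by (simp add: half_space_def inner_commute)
    then have "compact ?C" by (rule closed_Int_compact) auto
    moreover have CU: "?C \<subseteq> \<phi> ` U" using e O by blast
    ultimately have "compact (\<delta> ` ?C)" using cd by (meson compact_continuous_image continuous_on_subset)
    then obtain c where c: "\<And>y. y \<in> ?C \<Longrightarrow> \<bar>\<delta> y\<bar> \<le> c" "c > 0"
      by (metis bounded_pos compact_imp_bounded image_eqI real_norm_def)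
    let ?V = "{x \<in> U. \<phi> x \<in> ball (\<phi> p) e}"
    have V: "open ?V" by (rule chart_preimage_open[OF ch(1)]) simp
    have VC: "\<phi> ` ?V \<subseteq> ?C"
      using openin_imp_subset[OF chart_rel_open[OF ch(1)]] by auto
    have "emeasure nu ?V = (\<integral>\<^sup>+y\<in>\<phi> ` ?V. ennreal (\<delta> y) \<partial>lborel)" using V by (intro d(3)) auto
    also have "\<dots> \<le> (\<integral>\<^sup>+y. ennreal c * indicator (cball (\<phi> p) e) y \<partial>lborel)"
    proof (rule nn_integral_mono)
      fix y
      show "ennreal (\<delta> y) * indicator (\<phi> ` ?V) y \<le> ennreal c * indicator (cball (\<phi> p) e) y"
      proof (cases "y \<in> \<phi> ` ?V")
        case True
        then have "y \<in> ?C" using VC by blast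
        then show ?thesis using c(1)[of y] by (auto simp: indicator_def intro!: ennreal_leI)
      qed simp
    qed
    also have "\<dots> = ennreal c * emeasure lborel (cball (\<phi> p) e)"
      by (rule nn_integral_cmult_indicator) simp
    also have "\<dots> < \<infinity>"
      using emeasure_lborel_cball_finite[of "\<phi> p" e] by (simp add: ennreal_mult_less_top)
    finally show ?thesis using V ch e by (intro exI[of _ ?V]) auto
  qed
  then obtain V where V: "\<And>p. open (V p)" "\<And>p. p \<in> V p" "\<And>p. emeasure nu (V p) < \<infinity>" by metis
  obtain I where I: "finite I" "UNIV \<subseteq> (\<Union>p\<in>I. V p)"
  proof (rule compactE_image[OF compact_UNIV, of UNIV V])
    show "UNIV \<subseteq> (\<Union>p. V p)" using V(2) by blast
  qed (use V(1) in auto)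
  have "emeasure nu UNIV = emeasure nu (\<Union>p\<in>I. V p)" by (rule arg_cong[where f = "emeasure nu"]) (use I(2) in blast)
  also have "\<dots> \<le> (\<Sum>p\<in>I. emeasure nu (V p))"
    by (rule emeasure_subadditive_finite[OF I(1)]) (use V(1) in \<open>auto simp: sets_nu\<close>)
  also have "\<dots> < \<infinity>" using V(3) I(1) by (simp add: less_top[symmetric] ennreal_sum_less_top)
  finally show ?thesis .
qed

lemma finite_measure_nu: "finite_measure nu"
  by (rule finite_measureI) (use emeasure_nu_finite in \<open>simp add: space_nu less_top[symmetric]\<close>)

text \<open>The manifold is compact, so a function whose closed support avoids the boundary is compactly supported in
  the interior; there \<open>1 / \<rho>\<close> is bounded.\<close>

abbreviation interior_support :: "('a \<Rightarrow> 'z::zero) \<Rightarrow> bool" where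
  "interior_support f \<equiv> closure {x. f x \<noteq> 0} \<inter> bd = {}"

lemma interior_support_mono:
  assumes "interior_support f" "\<And>x. f x = 0 \<Longrightarrow> g x = 0"
  shows "interior_support g"
proof -
  have "{x. g x \<noteq> 0} \<subseteq> {x. f x \<noteq> 0}" using assms(2) by blast
  then show ?thesis using closure_mono assms(1) by blast
qed

lemma
  fixes f :: "'a \<Rightarrow> complex"
  assumes f: "\<And>x. isCont f x" and s: "interior_support f"
  shows mu_integrable: "integrable \<mu> f"
    and mu_integral: "integral\<^sup>L \<mu> f = (LINT x|nu. (1 / \<rho> x) *\<^sub>R f x)"
proof -
  let ?K = "closure {x. f x \<noteq> 0}"
  have fm: "f \<in> borel_measurable nu"
    using f by (simp add: measurable_cong_sets[OF sets_nu refl] borel_measurable_continuous_onI continuous_at_imp_continuous_on)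
  have "\<rho> \<in> borel_measurable nu"
    using rho_isCont by (simp add: measurable_cong_sets[OF sets_nu refl] borel_measurable_continuous_onI continuous_at_imp_continuous_on)
  then have rm: "(\<lambda>x. 1 / \<rho> x) \<in> borel_measurable nu" by simp
  have "compact ?K" using compact_Int_closed[OF compact_UNIV, of ?K] by simp
  moreover have "continuous_on ?K (\<lambda>x. (1 / \<rho> x) *\<^sub>R f x)"
  proof (intro continuous_at_imp_continuous_on ballI)
    fix x assume "x \<in> ?K"
    then have "\<rho> x \<noteq> 0" using s rho_bd by blast
    then show "isCont (\<lambda>x. (1 / \<rho> x) *\<^sub>R f x) x"
      by (intro continuous_scaleR isCont_divide f rho_isCont continuous_const)
  qed
  ultimately have "compact ((\<lambda>x. (1 / \<rho> x) *\<^sub>R f x) ` ?K)" by (rule compact_continuous_image[rotated])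
  then obtain c where c: "c > 0" "\<forall>z\<in>(\<lambda>x. (1 / \<rho> x) *\<^sub>R f x) ` ?K. norm z \<le> c"
    using compact_imp_bounded bounded_pos by blast
  have b: "norm ((1 / \<rho> x) *\<^sub>R f x) \<le> c" for x
  proof (cases "f x = 0")
    case False
    then show ?thesis using c(2) subsetD[OF closure_subset[of "{x. f x \<noteq> 0}"], of x] by blast
  qed (use c(1) in simp)
  have "integrable nu (\<lambda>x. (1 / \<rho> x) *\<^sub>R f x)"
    by (rule finite_measure.integrable_const_bound[OF finite_measure_nu, of _ c])
      (rule AE_I2, rule b, intro borel_measurable_scaleR rm fm)
  moreover have "integrable (density nu (\<lambda>x. ennreal (1 / \<rho> x))) f \<longleftrightarrow> integrable nu (\<lambda>x. (1 / \<rho> x) *\<^sub>R f x)"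
    using fm rm rho_nonneg by (intro integrable_density) auto
  ultimately show "integrable \<mu> f" unfolding nu(2)[symmetric] by blast
  have "integral\<^sup>L (density nu (\<lambda>x. ennreal (1 / \<rho> x))) f = (LINT x|nu. (1 / \<rho> x) *\<^sub>R f x)"
    using fm rm rho_nonneg by (intro integral_density) auto
  then show "integral\<^sup>L \<mu> f = (LINT x|nu. (1 / \<rho> x) *\<^sub>R f x)" unfolding nu(2)[symmetric] .
qed

lemma nu_open_pos:
  assumes "open Z" "p \<in> Z" "Z \<inter> bd = {}"
  shows "emeasure nu Z > 0"
proof (rule ccontr)
  assume n: "\<not> emeasure nu Z > 0"
  obtain U \<phi> where ch: "(U, \<phi>) \<in> \<A>" "p \<in> U" by (rule chart_exists)
  obtain \<delta> where d: "smooth_on (\<phi> ` U) \<delta>" "\<And>y. y \<in> \<phi> ` U \<Longrightarrow> \<delta> y > 0"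
    "\<And>B. B \<in> sets borel \<Longrightarrow> B \<subseteq> U \<Longrightarrow> emeasure nu B = (\<integral>\<^sup>+y\<in>\<phi> ` B. ennreal (\<delta> y) \<partial>lborel)"
    using chart_density[OF ch(1)] by blast
  have cd: "continuous_on (\<phi> ` U) \<delta>"
    using d(1) smooth_at_imp_continuous unfolding smooth_on_iff_smooth_at continuous_on_eq_continuous_within by blast
  have T: "rel_open (\<phi> ` (U \<inter> Z))" by (rule chart_rel_open_Int[OF ch(1) assms(1)])
  have pT: "\<phi> p \<in> \<phi> ` (U \<inter> Z)" using ch assms(2) by blast
  have "\<phi> p \<bullet> normal_dir \<noteq> 0" using bd_chart[OF ch] assms(2,3) by blast
  then have "\<phi> p \<bullet> normal_dir > 0" using rel_open_subset[OF T pT] by simp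
  then obtain O' where O: "open O'" "\<phi> p \<in> O'" "O' \<subseteq> \<phi> ` (U \<inter> Z)" using rel_open_interior[OF T pT] by metis
  have cdO: "continuous_on O' \<delta>" by (rule continuous_on_subset[OF cd]) (use O in blast)
  have "(\<integral>\<^sup>+y. ennreal (indicator O' y *\<^sub>R \<delta> y) \<partial>lborel) \<le> (\<integral>\<^sup>+y\<in>\<phi> ` (U \<inter> Z). ennreal (\<delta> y) \<partial>lborel)"
    using O(3) by (intro nn_integral_mono) (auto simp: indicator_def)
  also have "\<dots> = emeasure nu (U \<inter> Z)"
    using chart_open[OF ch(1)] assms(1) by (intro d(3)[symmetric]) auto
  also have "\<dots> \<le> emeasure nu Z" by (rule emeasure_mono) (use assms(1) in \<open>auto simp: sets_nu\<close>)
  finally have "(\<integral>\<^sup>+y. ennreal (indicator O' y *\<^sub>R \<delta> y) \<partial>lborel) = 0" using n by simp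
  moreover have "(\<lambda>y. indicator O' y *\<^sub>R \<delta> y) \<in> borel_measurable borel"
    using borel_measurable_continuous_on_indicator[OF _ cdO] O(1) by simp
  ultimately have "AE y in lborel. ennreal (indicator O' y *\<^sub>R \<delta> y) = 0"
    by (subst (asm) nn_integral_0_iff_AE) auto
  then have "AE y in lborel. y \<notin> O'"
  proof (rule AE_mp, intro AE_I2 impI)
    fix y assume y: "ennreal (indicator O' y *\<^sub>R \<delta> y) = 0"
    show "y \<notin> O'"
    proof
      assume "y \<in> O'"
      then show False using y O(3) d(2)[of y] by (auto simp: ennreal_eq_0_iff)
    qed
  qed
  then have "O' \<in> null_sets lborel" using O(1) by (subst (asm) AE_iff_null_sets[symmetric]) auto
  then have "negligible O'" unfolding negligible_iff_null_sets by (rule null_sets_completionI)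
  then show False using open_not_negligible[OF O(1)] O(2) by blast
qed

text \<open>The fundamental lemma of the calculus of variations, with test function a cut-off of the conjugate of
  \<open>g\<close>. It turns the weak identities that define adjoints into pointwise ones.\<close>

lemma weak_zero:
  fixes g :: "'a \<Rightarrow> complex"
  assumes g: "\<And>x. msmooth_at UNIV g x"
    and w: "\<And>f. (\<And>x. msmooth_at UNIV f x) \<Longrightarrow> interior_support f \<Longrightarrow> (LINT x|\<mu>. f x * g x) = 0"
  shows "g p = 0"
proof (rule zero_by_density[OF open_UNIV UNIV_I])
  show "isCont g p" by (rule msmooth_at_isCont[OF g]) auto
  fix p assume p: "p \<notin> bd"
  show "g p = 0"
  proof (rule ccontr)
    assume gp: "g p \<noteq> 0"
    have obd: "open (- bd)" using closed_bd by blast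
    have pbd: "p \<in> - bd" using p by simp
    obtain \<eta> :: "'a \<Rightarrow> real" and V where \<eta>: "\<And>x. msmooth_at UNIV \<eta> x" "\<And>x. 0 \<le> \<eta> x" "open V" "p \<in> V" "V \<subseteq> - bd"
      "\<And>x. x \<in> V \<Longrightarrow> \<eta> x = 1" "closure {x. \<eta> x \<noteq> 0} \<subseteq> - bd"
      using bump[OF obd pbd] by blast
    let ?f = "\<lambda>x. of_real (\<eta> x) * cnj (g x)"
    have f: "msmooth_at UNIV ?f x" for x by (intro msmooth_at_mult msmooth_at_of_real msmooth_at_cnj \<eta> g) auto
    have \<eta>s: "interior_support \<eta>" using \<eta>(7) by blast
    have fs: "interior_support ?f" by (rule interior_support_mono[OF \<eta>s]) simp
    define h where "h x = \<eta> x * (cmod (g x))\<^sup>2" for x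
    have hf: "?f x * g x = complex_of_real (h x)" for x
      by (simp add: h_def mult.assoc complex_norm_square mult.commute[of "cnj _"] del: of_real_power)
    have hc: "isCont h x" for x
      unfolding h_def[abs_def] using msmooth_at_isCont[OF \<eta>(1)] msmooth_at_isCont[OF g] by (intro continuous_intros) auto
    have hs: "interior_support h" by (rule interior_support_mono[OF \<eta>s]) (simp add: h_def)
    have hi: "integrable \<mu> (\<lambda>x. complex_of_real (h x))"
      by (rule mu_integrable) (use hc hs in \<open>auto intro: continuous_intros\<close>)
    have "(LINT x|\<mu>. complex_of_real (h x)) = 0" using w[OF f fs] unfolding hf .
    then have "integral\<^sup>L \<mu> h = 0" by simp
    moreover have "integrable \<mu> h" using hi by (simp add: complex_of_real_integrable_eq)
    moreover have "h x \<ge> 0" for x using \<eta>(2) by (simp add: h_def)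
    ultimately have "AE x in \<mu>. h x = 0" by (subst (asm) integral_nonneg_eq_0_iff_AE) auto
    moreover have "\<rho> \<in> borel_measurable nu"
      using rho_isCont by (simp add: measurable_cong_sets[OF sets_nu refl] borel_measurable_continuous_onI continuous_at_imp_continuous_on)
    then have "(AE x in density nu (\<lambda>x. ennreal (1 / \<rho> x)). h x = 0) \<longleftrightarrow>
        (AE x in nu. 0 < ennreal (1 / \<rho> x) \<longrightarrow> h x = 0)"
      by (intro AE_density) simp
    ultimately have AE: "AE x in nu. 0 < ennreal (1 / \<rho> x) \<longrightarrow> h x = 0"
      unfolding nu(2)[symmetric] by blast
    define Z where "Z = V \<inter> g -` (- {0})"
    have "continuous_on UNIV g" using msmooth_at_isCont[OF g] by (simp add: continuous_at_imp_continuous_on)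
    then have Z: "open Z" unfolding Z_def using \<eta>(3) by (intro open_Int open_vimage) auto
    have "AE x in nu. x \<notin> Z"
      using AE
    proof (rule AE_mp, intro AE_I2 impI notI)
      fix x assume "0 < ennreal (1 / \<rho> x) \<longrightarrow> h x = 0" "x \<in> Z"
      then show False using \<eta>(5,6) rho_pos[of x] by (auto simp: Z_def h_def)
    qed
    then have "emeasure nu Z = 0"
      using Z AE_iff_null_sets[of Z nu] by (auto simp: sets_nu)
    moreover have "emeasure nu Z > 0"
      by (rule nu_open_pos[OF Z]) (use \<eta>(4,5) gp in \<open>auto simp: Z_def\<close>)
    ultimately show False by simp
  qed
qed

end

section \<open>Hermitian metrics\<close>

locale hermitian_bundle = bundle_on \<A> \<rho> E
  for \<A> :: "('a::t2_space, 'v::euclidean_space) atlas" and \<rho> :: "'a \<Rightarrow> real"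
    and E :: "('a, 'e::complex_vector) vbundle" +
  fixes h :: "'a \<Rightarrow> 'e \<Rightarrow> 'e \<Rightarrow> complex"
  assumes hermitian: "hermitian_metric \<A> E h"
begin

lemma
  shows h_add_left: "u \<in> fiber E x \<Longrightarrow> v \<in> fiber E x \<Longrightarrow> w \<in> fiber E x \<Longrightarrow> h x (u + v) w = h x u w + h x v w"
    and h_scale_left: "u \<in> fiber E x \<Longrightarrow> w \<in> fiber E x \<Longrightarrow> h x (c *\<^sub>C u) w = c * h x u w"
    and h_cnj: "u \<in> fiber E x \<Longrightarrow> w \<in> fiber E x \<Longrightarrow> h x u w = cnj (h x w u)"
    and h_pos: "u \<in> fiber E x \<Longrightarrow> u \<noteq> 0 \<Longrightarrow> Re (h x u u) > 0"
proof -
  have *: "\<forall>x. \<forall>u\<in>fiber E x. \<forall>v\<in>fiber E x. \<forall>w\<in>fiber E x. \<forall>c.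
        h x (u + v) w = h x u w + h x v w \<and> h x (c *\<^sub>C u) w = c * h x u w \<and> h x u w = cnj (h x w u) \<and>
        (u \<noteq> 0 \<longrightarrow> Re (h x u u) > 0)"
    using hermitian unfolding hermitian_metric_def by (rule conjunct1)
  then show "u \<in> fiber E x \<Longrightarrow> v \<in> fiber E x \<Longrightarrow> w \<in> fiber E x \<Longrightarrow> h x (u + v) w = h x u w + h x v w"
    "u \<in> fiber E x \<Longrightarrow> w \<in> fiber E x \<Longrightarrow> h x (c *\<^sub>C u) w = c * h x u w"
    "u \<in> fiber E x \<Longrightarrow> w \<in> fiber E x \<Longrightarrow> h x u w = cnj (h x w u)"
    "u \<in> fiber E x \<Longrightarrow> u \<noteq> 0 \<Longrightarrow> Re (h x u u) > 0"
    by blast+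
qed

lemma h_frame_smooth:
  assumes "(W, es) \<in> frames E" "i < length es" "j < length es" "x \<in> W"
  shows "msmooth_at W (\<lambda>x. h x ((es ! i) x) ((es ! j) x)) x"
proof -
  have "\<forall>(W, es)\<in>frames E. \<forall>i<length es. \<forall>j<length es. msmooth_on \<A> W (\<lambda>x. h x ((es ! i) x) ((es ! j) x))"
    using hermitian unfolding hermitian_metric_def by (rule conjunct2)
  from bspec[OF this assms(1), unfolded prod.case] show ?thesis using assms(2-4) by (simp add: msmooth_on_iff_msmooth_at)
qed

lemma h_add_right: "u \<in> fiber E x \<Longrightarrow> v \<in> fiber E x \<Longrightarrow> w \<in> fiber E x \<Longrightarrow> h x u (v + w) = h x u v + h x u w"
  using h_cnj[of u x "v + w"] h_cnj[of u x v] h_cnj[of u x w] h_add_left[of v x w u]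
  by (simp add: fiber_add)

lemma h_scale_right: "u \<in> fiber E x \<Longrightarrow> v \<in> fiber E x \<Longrightarrow> h x u (c *\<^sub>C v) = cnj c * h x u v"
  using h_cnj[of u x "c *\<^sub>C v"] h_cnj[of u x v] h_scale_left[of v x u c]
  by (simp add: fiber_scale)

lemma h_zero_left: "w \<in> fiber E x \<Longrightarrow> h x 0 w = 0"
  using h_scale_left[of w x w 0] by simp

lemma h_zero_right: "w \<in> fiber E x \<Longrightarrow> h x w 0 = 0"
  using h_scale_right[of w x w 0] by simp

lemma h_diff_left: "u \<in> fiber E x \<Longrightarrow> v \<in> fiber E x \<Longrightarrow> w \<in> fiber E x \<Longrightarrow> h x (u - v) w = h x u w - h x v w"
  using h_add_left[of u x "(-1) *\<^sub>C v" w] h_scale_left[of v x w "-1"] fiber_scale[of v x "-1"]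
  by (simp add: complex_vector.scale_minus_left)

lemma h_diff_right: "u \<in> fiber E x \<Longrightarrow> v \<in> fiber E x \<Longrightarrow> w \<in> fiber E x \<Longrightarrow> h x u (v - w) = h x u v - h x u w"
  using h_add_right[of u x v "(-1) *\<^sub>C w"] h_scale_right[of u x w "-1"] fiber_scale[of w x "-1"]
  by (simp add: complex_vector.scale_minus_left)

lemma h_sum_left:
  "(\<And>i. i \<in> I \<Longrightarrow> u i \<in> fiber E x) \<Longrightarrow> w \<in> fiber E x \<Longrightarrow> h x (\<Sum>i\<in>I. u i) w = (\<Sum>i\<in>I. h x (u i) w)"
  by (induction I rule: infinite_finite_induct) (auto simp: h_zero_left h_add_left fiber_sum)

lemma h_sum_right:
  "(\<And>i. i \<in> I \<Longrightarrow> u i \<in> fiber E x) \<Longrightarrow> w \<in> fiber E x \<Longrightarrow> h x w (\<Sum>i\<in>I. u i) = (\<Sum>i\<in>I. h x w (u i))"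
  by (induction I rule: infinite_finite_induct) (auto simp: h_zero_right h_add_right fiber_sum)

lemma h_nondegenerate:
  assumes "w \<in> fiber E x" "\<And>u. u \<in> fiber E x \<Longrightarrow> h x u w = 0"
  shows "w = 0"
  using h_pos[of w x] assms(2)[OF assms(1)] assms(1) by fastforce

lemma h_smooth:
  assumes "s \<in> sec" "t \<in> sec"
  shows "msmooth_at UNIV (\<lambda>x. h x (s x) (t x)) p"
proof -
  obtain W es where W: "(W, es) \<in> frames E" "p \<in> W" by (rule frame_exists)
  let ?c = "\<lambda>s i x. coord es x (s x) i"
  have "msmooth_at W (\<lambda>x. \<Sum>i<length es. \<Sum>j<length es. ?c s i x * (cnj (?c t j x) * h x ((es ! i) x) ((es ! j) x))) p"
    using smooth_sectionsD(3)[OF assms(1) W] smooth_sectionsD(3)[OF assms(2) W] W(2)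
    by (intro msmooth_at_sum msmooth_at_mult msmooth_at_cnj h_frame_smooth[OF W(1)]) auto
  then show ?thesis
  proof (rule msmooth_at_cong[OF _ frame_open[OF W(1)] W(2)], intro conjI)
    fix x assume x: "x \<in> W"
    note f = frame_in_fiber[OF W(1) x]
    have "h x (s x) (t x) = h x (\<Sum>i<length es. ?c s i x *\<^sub>C (es ! i) x) (\<Sum>j<length es. ?c t j x *\<^sub>C (es ! j) x)"
      using frame_expand[OF W(1) x smooth_sectionsD(1)[OF assms(1)]] frame_expand[OF W(1) x smooth_sectionsD(1)[OF assms(2)]]
      by simp
    also have "\<dots> = (\<Sum>i<length es. \<Sum>j<length es. h x (?c s i x *\<^sub>C (es ! i) x) (?c t j x *\<^sub>C (es ! j) x))"
      by (subst h_sum_left) (use f in \<open>auto intro!: fiber_scale fiber_sum sum.cong h_sum_right\<close>)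
    also have "\<dots> = (\<Sum>i<length es. \<Sum>j<length es. ?c s i x * (cnj (?c t j x) * h x ((es ! i) x) ((es ! j) x)))"
      by (intro sum.cong refl) (use f in \<open>simp add: h_scale_left h_scale_right fiber_scale\<close>)
    finally show "(\<Sum>i<length es. \<Sum>j<length es. ?c s i x * (cnj (?c t j x) * h x ((es ! i) x) ((es ! j) x))) = h x (s x) (t x)"
      by simp
  qed simp
qed

text \<open>The Riesz representation with smooth dependence on the point. As in the Gram-Schmidt process,
  the solution for \<open>k + 1\<close> frame elements is corrected from the one for \<open>k\<close> by a multiple of the
  component \<open>n\<close> of the new element orthogonal to the previous ones.\<close>

lemma riesz_local:
  assumes W: "(W, es) \<in> frames E" and "k \<le> length es" and "\<And>i x. i < k \<Longrightarrow> x \<in> W \<Longrightarrow> msmooth_at W (G i) x"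
  shows "\<exists>c. (\<forall>j<k. \<forall>x\<in>W. msmooth_at W (c j) x) \<and>
    (\<forall>x\<in>W. \<forall>i<k. h x ((es ! i) x) (\<Sum>j<k. c j x *\<^sub>C (es ! j) x) = G i x)"
  using assms(2,3)
proof (induction k arbitrary: G)
  case 0
  then show ?case by simp
next
  case (Suc k)
  have k: "k < length es" using Suc.prems by simp
  note hs = h_frame_smooth[OF W]
  have "\<exists>c. (\<forall>j<k. \<forall>x\<in>W. msmooth_at W (c j) x) \<and>
    (\<forall>x\<in>W. \<forall>i<k. h x ((es ! i) x) (\<Sum>j<k. c j x *\<^sub>C (es ! j) x) = G i x)"
    by (rule Suc.IH) (use Suc.prems in auto)
  then obtain c where c: "\<And>j x. j < k \<Longrightarrow> x \<in> W \<Longrightarrow> msmooth_at W (c j) x"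
    "\<And>x i. x \<in> W \<Longrightarrow> i < k \<Longrightarrow> h x ((es ! i) x) (\<Sum>j<k. c j x *\<^sub>C (es ! j) x) = G i x"
    by blast
  have "msmooth_at W (\<lambda>x. h x ((es ! i) x) ((es ! k) x)) x" if "i < k" "x \<in> W" for i x
    using hs[of i k x] that k by simp
  then have "\<exists>d. (\<forall>j<k. \<forall>x\<in>W. msmooth_at W (d j) x) \<and>
    (\<forall>x\<in>W. \<forall>i<k. h x ((es ! i) x) (\<Sum>j<k. d j x *\<^sub>C (es ! j) x) = h x ((es ! i) x) ((es ! k) x))"
    using k by (intro Suc.IH) auto
  then obtain d where d: "\<And>j x. j < k \<Longrightarrow> x \<in> W \<Longrightarrow> msmooth_at W (d j) x"
    "\<And>x i. x \<in> W \<Longrightarrow> i < k \<Longrightarrow> h x ((es ! i) x) (\<Sum>j<k. d j x *\<^sub>C (es ! j) x) = h x ((es ! i) x) ((es ! k) x)"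
    by blast
  define C where "C x = (\<Sum>j<k. c j x *\<^sub>C (es ! j) x)" for x
  define D where "D x = (\<Sum>j<k. d j x *\<^sub>C (es ! j) x)" for x
  \<comment> \<open>\<open>D\<close> is the orthogonal projection of \<open>e\<^sub>k\<close> to the span of the previous elements.\<close>
  define n where "n x = (es ! k) x - D x" for x
  define a where "a x = h x ((es ! k) x) (n x)" for x
  define b where "b x = cnj ((G k x - h x ((es ! k) x) (C x)) * inverse (a x))" for x
  have fe: "(es ! i) x \<in> fiber E x" if "x \<in> W" "i \<le> k" for i x
    using frame_in_fiber[OF W that(1)] that(2) k by simp
  have fC: "C x \<in> fiber E x" and fD: "D x \<in> fiber E x" and fn: "n x \<in> fiber E x" if "x \<in> W" for x
    using fe[OF that] unfolding n_def C_def D_def by (auto intro!: fiber_sum fiber_scale fiber_diff)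
  have orth: "h x ((es ! i) x) (n x) = 0" if "x \<in> W" "i < k" for i x
    using d(2)[OF that] fe[OF that(1), of i] fe[OF that(1), of k] fD[OF that(1)] that(2)
    by (simp add: n_def h_diff_right D_def)
  have nn: "n x \<noteq> 0" if x: "x \<in> W" for x
  proof
    assume "n x = 0"
    then have 1: "(es ! k) x = (\<Sum>j<k. d j x *\<^sub>C (es ! j) x)" by (simp add: n_def D_def)
    let ?l = "\<lambda>j. if j = k then 1 else (0::complex)" and ?r = "\<lambda>j. if j < k then d j x else (0::complex)"
    have "(\<Sum>j<length es. ?l j *\<^sub>C (es ! j) x) = (\<Sum>j<length es. if j = k then (es ! k) x else 0)"
      by (intro sum.cong) auto
    also have "\<dots> = (es ! k) x" using k by simp
    also have "\<dots> = (\<Sum>j<length es. ?r j *\<^sub>C (es ! j) x)"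
      unfolding 1 by (rule sum.mono_neutral_cong_left) (use k in auto)
    finally have "?l k = ?r k" by (rule frame_unique[OF W x k])
    then show False by simp
  qed
  have a0: "a x \<noteq> 0" if x: "x \<in> W" for x
  proof -
    have "h x (n x) (n x) = a x - h x (D x) (n x)"
      unfolding a_def n_def by (rule h_diff_left) (use x fe[OF x, of k] fD fn in \<open>auto simp: n_def[symmetric]\<close>)
    also have "h x (D x) (n x) = (\<Sum>j<k. h x (d j x *\<^sub>C (es ! j) x) (n x))"
      unfolding D_def by (rule h_sum_left) (use x fe[OF x] fn in \<open>auto intro: fiber_scale\<close>)
    also have "\<dots> = 0"
      by (rule sum.neutral) (use x fe[OF x] fn orth in \<open>auto simp: h_scale_left\<close>)
    finally show ?thesis using h_pos[OF fn[OF x] nn[OF x]] by auto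
  qed
  have hC: "h x ((es ! k) x) (C x) = (\<Sum>j<k. cnj (c j x) * h x ((es ! k) x) ((es ! j) x))"
    and ha: "a x = h x ((es ! k) x) ((es ! k) x) - (\<Sum>j<k. cnj (d j x) * h x ((es ! k) x) ((es ! j) x))"
    if x: "x \<in> W" for x
  proof -
    have *: "h x ((es ! k) x) (\<Sum>j<k. c j x *\<^sub>C (es ! j) x) = (\<Sum>j<k. cnj (c j x) * h x ((es ! k) x) ((es ! j) x))" for c
      by (subst h_sum_right) (use fe[OF x] in \<open>auto intro!: fiber_scale sum.cong h_scale_right\<close>)
    show "h x ((es ! k) x) (C x) = (\<Sum>j<k. cnj (c j x) * h x ((es ! k) x) ((es ! j) x))"
      unfolding C_def by (rule *)
    have "a x = h x ((es ! k) x) ((es ! k) x) - h x ((es ! k) x) (D x)"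
      unfolding a_def n_def by (rule h_diff_right) (use x fe[OF x, of k] fD in auto)
    then show "a x = h x ((es ! k) x) ((es ! k) x) - (\<Sum>j<k. cnj (d j x) * h x ((es ! k) x) ((es ! j) x))"
      unfolding D_def by (simp only: *)
  qed
  have sa: "msmooth_at W a x" if x: "x \<in> W" for x
  proof (rule msmooth_at_cong[OF _ open_UNIV UNIV_I])
    show "msmooth_at W (\<lambda>x. h x ((es ! k) x) ((es ! k) x) - (\<Sum>j<k. cnj (d j x) * h x ((es ! k) x) ((es ! j) x))) x"
      using x k d(1) by (intro msmooth_at_diff msmooth_at_sum msmooth_at_mult msmooth_at_cnj hs) auto
  qed (use ha in auto)
  have sb: "msmooth_at W b x" if x: "x \<in> W" for x
  proof (rule msmooth_at_cong[OF _ open_UNIV UNIV_I])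
    show "msmooth_at W (\<lambda>x. cnj ((G k x - (\<Sum>j<k. cnj (c j x) * h x ((es ! k) x) ((es ! j) x))) * inverse (a x))) x"
      using x k c(1) Suc.prems(2) a0[OF x] by (intro msmooth_at_diff msmooth_at_sum msmooth_at_mult msmooth_at_cnj msmooth_at_inverse hs sa) auto
  qed (use hC in \<open>auto simp: b_def\<close>)
  let ?c = "\<lambda>j x. if j < k then c j x - b x * d j x else b x"
  show ?case
  proof (rule exI[of _ ?c], intro conjI allI impI ballI)
    fix j x assume j: "j < Suc k" and x: "x \<in> W"
    show "msmooth_at W (?c j) x"
      using c(1)[of j x] d(1)[of j x] sb[OF x] x by (cases "j < k") (auto intro!: msmooth_at_diff msmooth_at_mult)
  next
    fix i x assume i: "i < Suc k" and x: "x \<in> W"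
    have "(\<Sum>j<Suc k. ?c j x *\<^sub>C (es ! j) x) = C x + b x *\<^sub>C n x"
      by (simp add: C_def D_def n_def complex_vector.scale_left_diff_distrib sum_subtractf
          complex_vector.scale_right_diff_distrib complex_vector.scale_sum_right)
    moreover have "h x ((es ! i) x) (C x + b x *\<^sub>C n x) = h x ((es ! i) x) (C x) + cnj (b x) * h x ((es ! i) x) (n x)"
      using fe[OF x, of i] i fC[OF x] fn[OF x] by (simp add: h_add_right h_scale_right fiber_scale)
    moreover have "\<dots> = G i x"
    proof (cases "i < k")
      case True
      then show ?thesis using c(2)[OF x] orth[OF x] by (simp add: C_def)
    next
      case False
      then have "i = k" using i by simp
      then show ?thesis using a0[OF x] by (simp add: b_def a_def[symmetric] mult.assoc)
    qed
    ultimately show "h x ((es ! i) x) (\<Sum>j<Suc k. ?c j x *\<^sub>C (es ! j) x) = G i x" by simp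
  qed
qed

text \<open>Where all \<open>G\<^sub>i\<close> vanish the representing vector is orthogonal to the whole fibre, hence \<open>0\<close>; this
  bounds the support of the solution and gives a global section.\<close>

lemma riesz_section:
  assumes W: "(W, es) \<in> frames E" and K: "closed K" "K \<subseteq> W"
    and G: "\<And>i x. i < length es \<Longrightarrow> msmooth_at UNIV (G i) x" "\<And>i x. i < length es \<Longrightarrow> x \<notin> K \<Longrightarrow> G i x = 0"
  obtains w where "w \<in> sec" "\<And>x i. x \<in> W \<Longrightarrow> i < length es \<Longrightarrow> h x ((es ! i) x) (w x) = G i x"
    "\<And>x. x \<notin> W \<Longrightarrow> w x = 0"
proof -
  have GW: "msmooth_at W (G i) x" if "i < length es" for i x
    by (rule msmooth_at_cong[OF G(1)[OF that] open_UNIV]) auto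
  obtain c where c: "\<And>j x. j < length es \<Longrightarrow> x \<in> W \<Longrightarrow> msmooth_at W (c j) x"
    "\<And>x i. x \<in> W \<Longrightarrow> i < length es \<Longrightarrow> h x ((es ! i) x) (\<Sum>j<length es. c j x *\<^sub>C (es ! j) x) = G i x"
    using riesz_local[OF W order_refl, of G] GW by blast
  let ?c = "\<lambda>j x. if x \<in> W then c j x else 0"
  let ?w = "\<lambda>x. if x \<in> W then \<Sum>j<length es. ?c j x *\<^sub>C (es ! j) x else 0"
  have eq: "h x ((es ! i) x) (?w x) = G i x" if "x \<in> W" "i < length es" for x i
    using c(2)[OF that] that by simp
  have "?w \<in> sec"
  proof (rule section_from_coords[OF W K])
    fix j x assume j: "j < length es"
    show "msmooth_at W (?c j) x" if "x \<in> W"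
      by (rule msmooth_at_cong[OF c(1)[OF j that] open_UNIV]) auto
    show "?c j x = 0" if "x \<notin> K"
    proof (cases "x \<in> W")
      case True
      note f = frame_in_fiber[OF W True]
      have w: "?w x \<in> fiber E x" using True f by (auto intro!: fiber_sum fiber_scale)
      have "?w x = 0"
      proof (rule h_nondegenerate[OF w])
        fix u assume u: "u \<in> fiber E x"
        have "h x u (?w x) = h x (\<Sum>i<length es. coord es x u i *\<^sub>C (es ! i) x) (?w x)"
          using frame_expand[OF W True u] by simp
        also have "\<dots> = (\<Sum>i<length es. h x (coord es x u i *\<^sub>C (es ! i) x) (?w x))"
          by (rule h_sum_left) (use f w in \<open>auto intro: fiber_scale\<close>)
        also have "\<dots> = 0"
        proof (rule sum.neutral, rule ballI)
          fix i assume i: "i \<in> {..<length es}"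
          have "h x (coord es x u i *\<^sub>C (es ! i) x) (?w x) = coord es x u i * h x ((es ! i) x) (?w x)"
            by (rule h_scale_left[OF _ w]) (use f i in auto)
          then show "h x (coord es x u i *\<^sub>C (es ! i) x) (?w x) = 0"
            using eq[OF True, of i] G(2)[OF _ that] i by simp
        qed
        finally show "h x u (?w x) = 0" .
      qed
      then have "(\<Sum>i<length es. c i x *\<^sub>C (es ! i) x) = (\<Sum>i<length es. 0 *\<^sub>C (es ! i) x)"
        using True by simp
      from frame_unique[OF W True j this] show ?thesis by simp
    qed simp
  qed
  then show thesis using eq by (rule that) simp_all
qed

end

section \<open>The divergence theorem in a chart\<close>

context bmanifold
begin

definition chart_deriv :: "'a set \<Rightarrow> ('a \<Rightarrow> 'v) \<Rightarrow> ('a \<Rightarrow> complex) \<Rightarrow> 'v \<Rightarrow> 'a \<Rightarrow> complex" where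
  "chart_deriv U \<phi> f b x = frechet_derivative (f \<circ> inv_into U \<phi>) (at (\<phi> x) within \<phi> ` U) b"

lemma chart_deriv_smooth_at:
  assumes ch: "(U, \<phi>) \<in> \<A>" and f: "\<And>x. msmooth_at UNIV f x" and b: "b \<in> Basis" and x: "x \<in> U"
  shows "smooth_at (\<phi> ` U) (chart_deriv U \<phi> f b \<circ> inv_into U \<phi>) (\<phi> x)"
proof -
  have "smooth_at (\<phi> ` U) (\<lambda>z. frechet_derivative (f \<circ> inv_into U \<phi>) (at z within \<phi> ` U) b) (\<phi> x)"
    using msmooth_at_chart[OF f UNIV_I ch x] x by (intro smooth_at_frechet_derivative chart_rel_open[OF ch] b) auto
  then show ?thesis
    by (rule smooth_at_cong[of _ _ _ UNIV]) (use ch in \<open>auto simp: chart_deriv_def\<close>)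
qed

lemma frechet_derivative_zero_near:
  fixes g :: "'v \<Rightarrow> complex"
  assumes ch: "(U, \<phi>) \<in> \<A>" "x \<in> U" and W: "open W" "x \<in> W"
    and g: "\<And>z. z \<in> U \<Longrightarrow> z \<in> W \<Longrightarrow> g (\<phi> z) = 0"
  shows "frechet_derivative g (at (\<phi> x) within \<phi> ` U) = (\<lambda>_. 0)"
proof (rule rel_open_frechet_derivative[OF chart_rel_open[OF ch(1)]])
  obtain O' where O: "open O'" "\<phi> x \<in> O'" "\<And>y. y \<in> \<phi> ` U \<Longrightarrow> y \<in> O' \<Longrightarrow> inv_into U \<phi> y \<in> W"
    using chart_nbhd[OF ch(1) W(1) ch(2) W(2)] by metis
  obtain e where e: "e > 0" "ball (\<phi> x) e \<subseteq> O'" using O openE by blast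
  show "(g has_derivative (\<lambda>_. 0)) (at (\<phi> x) within \<phi> ` U)"
  proof (rule has_derivative_transform_within[OF has_derivative_const[of 0] e(1)])
    fix y assume y: "y \<in> \<phi> ` U" "dist y (\<phi> x) < e"
    then have "inv_into U \<phi> y \<in> W" using O(3)[of y] e(2) by (auto simp: subset_iff dist_commute)
    then show "0 = g y" using g[of "inv_into U \<phi> y"] y(1) ch(1) by auto
  qed (use ch in blast)
qed (use ch in blast)

lemma chart_deriv_zero_near:
  assumes "(U, \<phi>) \<in> \<A>" "x \<in> U" "open W" "x \<in> W" "\<And>z. z \<in> W \<Longrightarrow> f z = 0"
  shows "chart_deriv U \<phi> f b x = 0"
  unfolding chart_deriv_def
  by (subst frechet_derivative_zero_near[OF assms(1-4)]) (use assms(1,5) in auto)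

end

context b_measure
begin

text \<open>Let \<open>X = \<Sum> c\<^sub>b \<partial>\<^sub>b\<close> be a vector field compactly supported in a chart with \<open>X \<rho> = \<rho> \<beta>\<close>. Then the
  divergence \<open>d\<close> of \<open>- X\<close> with respect to the \<open>b\<close>-density \<open>\<rho>\<^sup>-\<^sup>1 \<delta> dy\<close> is smooth up to the
  boundary: \<open>d = \<beta> - \<delta>\<^sup>-\<^sup>1 \<Sum> \<partial>\<^sub>b (c\<^sub>b \<delta>)\<close>.\<close>

lemma chart_divergence:
  assumes ch: "(U, \<phi>) \<in> \<A>" and K: "closed K" "K \<subseteq> U"
    and c: "\<And>b x. b \<in> Basis \<Longrightarrow> msmooth_at UNIV (c b) x" "\<And>b x. b \<in> Basis \<Longrightarrow> x \<notin> K \<Longrightarrow> c b x = 0"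
    and \<beta>: "\<And>x. msmooth_at UNIV \<beta> x" "\<And>x. x \<notin> K \<Longrightarrow> \<beta> x = 0"
    and rel: "\<And>x. x \<in> U \<Longrightarrow> (\<Sum>b\<in>Basis. c b x * chart_deriv U \<phi> (\<lambda>x. of_real (\<rho> x)) b x) = of_real (\<rho> x) * \<beta> x"
  obtains d where "\<And>x. msmooth_at UNIV d x"
    "\<And>f. (\<And>x. msmooth_at UNIV f x) \<Longrightarrow> interior_support f \<Longrightarrow>
      integrable \<mu> (\<lambda>x. if x \<in> U then \<Sum>b\<in>Basis. c b x * chart_deriv U \<phi> f b x else 0) \<and>
      (LINT x|\<mu>. (if x \<in> U then \<Sum>b\<in>Basis. c b x * chart_deriv U \<phi> f b x else 0)) = (LINT x|\<mu>. f x * d x)"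
proof -
  obtain \<delta> where \<delta>: "smooth_on (\<phi> ` U) \<delta>" "\<And>y. y \<in> \<phi> ` U \<Longrightarrow> \<delta> y > 0"
    "\<And>B. B \<in> sets borel \<Longrightarrow> B \<subseteq> U \<Longrightarrow> emeasure nu B = (\<integral>\<^sup>+y\<in>\<phi> ` B. ennreal (\<delta> y) \<partial>lborel)"
    using chart_density[OF ch] by blast
  let ?T = "\<phi> ` U" and ?i = "inv_into U \<phi>"
  note T = chart_rel_open[OF ch]
  let ?\<delta> = "\<lambda>y. complex_of_real (\<delta> y)"
  define m where "m b y = c b (?i y) * ?\<delta> y" for b y
  define dm where "dm b y = frechet_derivative (m b) (at y within ?T) b" for b y
  \<comment> \<open>Off \<open>K\<close> everything vanishes, so the formula extends by \<open>0\<close> to the whole manifold.\<close>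
  define d where "d x = (if x \<in> U then \<beta> x - (\<Sum>b\<in>Basis. dm b (\<phi> x)) * inverse (?\<delta> (\<phi> x)) else 0)" for x
  have \<delta>s: "smooth_at ?T ?\<delta> y" if "y \<in> ?T" for y
    by (rule smooth_at_linear_comp[OF bounded_linear_of_real bspec[OF \<delta>(1)[unfolded smooth_on_iff_smooth_at] that]])
  have ts: "smooth_at ?T (f \<circ> ?i) y" if "\<And>x. msmooth_at UNIV f x" "y \<in> ?T" for f :: "'a \<Rightarrow> complex" and y
    using msmooth_at_chart[OF that(1) UNIV_I ch] that(2) by auto
  have ms: "smooth_at ?T (m b) y" if "b \<in> Basis" "y \<in> ?T" for b y
    using smooth_at_bilinear[OF bounded_bilinear_mult ts[OF c(1)[OF that(1)] that(2)] \<delta>s[OF that(2)]]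
    by (simp add: m_def[abs_def] o_def)
  have dms: "smooth_at ?T (dm b) y" if "b \<in> Basis" "y \<in> ?T" for b y
    unfolding dm_def[abs_def] by (rule smooth_at_frechet_derivative[OF T that(2) ms[OF that] that(1)])
  have dm0: "dm b (\<phi> x) = 0" if "b \<in> Basis" "x \<in> U" "x \<notin> K" for b x
    unfolding dm_def
    by (subst frechet_derivative_zero_near[OF ch that(2), of "- K"]) (use K that c(2) ch in \<open>auto simp: m_def\<close>)
  have d0: "d x = 0" if "x \<notin> K" for x using that dm0 \<beta>(2) by (simp add: d_def)
  have smooth_ext: "msmooth_at UNIV g x"
    if "\<And>x. x \<in> U \<Longrightarrow> smooth_at ?T (g \<circ> ?i) (\<phi> x)" "\<And>x. x \<notin> K \<Longrightarrow> g x = 0" for g :: "'a \<Rightarrow> complex" and x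
  proof (cases "x \<in> U")
    case True
    then show ?thesis using that(1) by (intro msmooth_atI[OF ch]) auto
  next
    case False
    show ?thesis
      by (rule msmooth_at_cong[OF msmooth_at_const[of UNIV 0] open_Compl[OF K(1)]]) (use False K that(2) in auto)
  qed
  have sum_s: "smooth_at ?T (\<lambda>y. \<Sum>b\<in>Basis. g b y) y" if "\<And>b. b \<in> Basis \<Longrightarrow> smooth_at ?T (g b) y"
    for g :: "'v \<Rightarrow> 'v \<Rightarrow> complex" and y
  proof -
    have "smooth_at ?T (\<lambda>y. \<Sum>b\<in>I. g b y) y" if "I \<subseteq> Basis" for I
      using finite_subset[OF that finite_Basis] that \<open>\<And>b. b \<in> Basis \<Longrightarrow> smooth_at ?T (g b) y\<close>
      by (induction I rule: finite_induct) (auto intro: smooth_at_const smooth_at_add)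
    then show ?thesis by blast
  qed
  have ds: "msmooth_at UNIV d x" for x
  proof (rule smooth_ext[OF _ d0])
    fix x assume x: "x \<in> U"
    then have y: "\<phi> x \<in> ?T" by blast
    have inv: "smooth_at ?T (\<lambda>y. inverse (?\<delta> y)) (\<phi> x)"
      by (rule smooth_at_compose[OF \<delta>s[OF y], where T = UNIV])
        (use \<delta>(2)[OF y] y in \<open>auto intro!: smooth_at_Ck[of "- {0}"] Ck_on_inverse\<close>)
    have "smooth_at ?T (\<lambda>y. (\<beta> \<circ> ?i) y + (-1) * ((\<Sum>b\<in>Basis. dm b y) * inverse (?\<delta> y))) (\<phi> x)"
      using y by (intro smooth_at_add smooth_at_bilinear[OF bounded_bilinear_mult] smooth_at_const ts[OF \<beta>(1)] sum_s dms inv)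
    then show "smooth_at ?T (d \<circ> ?i) (\<phi> x)"
      by (rule smooth_at_cong[of _ _ _ UNIV]) (use ch in \<open>auto simp: d_def\<close>)
  qed
  show thesis
  proof (rule that[OF ds])
    fix f :: "'a \<Rightarrow> complex" assume f: "\<And>x. msmooth_at UNIV f x" and fs: "interior_support f"
    define F where "F x = (if x \<in> U then \<Sum>b\<in>Basis. c b x * chart_deriv U \<phi> f b x else 0)" for x
    have Fsm: "msmooth_at UNIV F x" for x
    proof (rule smooth_ext)
      fix x assume x: "x \<in> U"
      then have y: "\<phi> x \<in> ?T" by blast
      have "smooth_at ?T (\<lambda>y. \<Sum>b\<in>Basis. (c b \<circ> ?i) y * (chart_deriv U \<phi> f b \<circ> ?i) y) (\<phi> x)"
        using y x by (intro sum_s smooth_at_bilinear[OF bounded_bilinear_mult] ts[OF c(1)] chart_deriv_smooth_at[OF ch f])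
      then show "smooth_at ?T (F \<circ> ?i) (\<phi> x)"
        by (rule smooth_at_cong[of _ _ _ UNIV]) (use ch in \<open>auto simp: F_def\<close>)
    qed (use c(2) in \<open>auto simp: F_def\<close>)
    let ?S = "closure {x. f x \<noteq> 0}"
    have F0: "F x = 0" if x: "x \<notin> ?S" for x
    proof (cases "x \<in> U")
      case True
      have z: "f z = 0" if "z \<in> - ?S" for z
        using that subsetD[OF closure_subset[of "{x. f x \<noteq> 0}"], of z] by blast
      have "chart_deriv U \<phi> f b x = 0" for b
        by (rule chart_deriv_zero_near[OF ch True open_Compl[OF closed_closure] _ z]) (use x in blast)
      then show ?thesis by (simp add: F_def)
    qed (simp add: F_def)
    have "{x. F x \<noteq> 0} \<subseteq> ?S" using F0 by blast
    then have "closure {x. F x \<noteq> 0} \<subseteq> ?S" by (rule closure_minimal) simp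
    then have Fs: "interior_support F" using fs by blast
    define H where "H x = F x - f x * d x" for x
    have fdsm: "msmooth_at UNIV (\<lambda>x. f x * d x) x" for x by (intro msmooth_at_mult f ds) simp
    have Hsm: "msmooth_at UNIV H x" for x unfolding H_def[abs_def] by (intro msmooth_at_diff Fsm fdsm) simp
    have H0: "H x = 0" if "x \<notin> ?S" for x
      using F0[OF that] that subsetD[OF closure_subset[of "{x. f x \<noteq> 0}"], of x] by (auto simp: H_def)
    then have "{x. H x \<noteq> 0} \<subseteq> ?S" by blast
    then have "closure {x. H x \<noteq> 0} \<subseteq> ?S" by (rule closure_minimal) simp
    then have Hs: "interior_support H" using fs by blast
    have HK: "H x = 0" if "x \<notin> K" for x using that c(2) d0 by (simp add: H_def F_def)
    note cont = msmooth_at_isCont[OF _ open_UNIV UNIV_I]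
    have intF: "integrable \<mu> F" by (rule mu_integrable[OF cont[OF Fsm] Fs])
    have fds: "interior_support (\<lambda>x. f x * d x)" by (rule interior_support_mono[OF fs]) simp
    have intfd: "integrable \<mu> (\<lambda>x. f x * d x)" by (rule mu_integrable[OF cont[OF fdsm] fds])
    \<comment> \<open>In the chart the integrand is the divergence of \<open>f c\<^sub>b \<delta> / \<rho>\<close>.\<close>
    define \<Omega> where "\<Omega> = {y \<in> ?T. 0 < y \<bullet> normal_dir}"
    have \<Omega>open: "open \<Omega>"
      unfolding open_subopen[of \<Omega>]
    proof
      fix y assume y: "y \<in> \<Omega>"
      then have yT: "y \<in> ?T" "0 < y \<bullet> normal_dir" by (auto simp: \<Omega>_def)
      obtain O' where "open O'" "y \<in> O'" "O' \<subseteq> ?T" "\<And>z. z \<in> O' \<Longrightarrow> 0 < z \<bullet> normal_dir"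
        using rel_open_interior[OF T yT] by blast
      then show "\<exists>O'. open O' \<and> y \<in> O' \<and> O' \<subseteq> \<Omega>" by (intro exI[of _ O']) (auto simp: \<Omega>_def)
    qed
    define r where "r y = complex_of_real (\<rho> (?i y))" for y
    have \<Omega>bd: "y \<in> \<Omega> \<longleftrightarrow> ?i y \<notin> bd" if yT: "y \<in> ?T" for y
    proof -
      obtain x where x: "x \<in> U" "y = \<phi> x" using yT by blast
      then show ?thesis using bd_chart[OF ch x(1)] rel_open_subset[OF T yT] ch yT
        by (auto simp: \<Omega>_def less_le)
    qed
    have r0: "r y \<noteq> 0" if "y \<in> \<Omega>" for y
      using \<Omega>bd[of y] that rho_bd[of "?i y"] by (auto simp: r_def \<Omega>_def)
    have rs: "smooth_at ?T r y" if "y \<in> ?T" for y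
      using ts[OF msmooth_at_of_real[OF rho_smooth] that] by (simp add: r_def[abs_def] o_def)
    let ?f = "f \<circ> ?i"
    let ?D = "\<lambda>g y. frechet_derivative g (at y within ?T)"
    have der: "(g has_derivative ?D g y) (at y)" if "smooth_at ?T g y" "y \<in> \<Omega>" for g :: "'v \<Rightarrow> complex" and y
    proof -
      have "(g has_derivative ?D g y) (at y within \<Omega>)"
        by (rule has_derivative_subset[OF smooth_at_imp_has_derivative[OF that(1)]]) (use that(2) in \<open>auto simp: \<Omega>_def\<close>)
      then show ?thesis using at_within_open[OF that(2) \<Omega>open] by metis
    qed
    have con: "continuous_on \<Omega> g" if "\<And>y. y \<in> ?T \<Longrightarrow> smooth_at ?T g y" for g :: "'v \<Rightarrow> complex"
    proof -
      have "continuous_on ?T g"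
        using smooth_at_imp_continuous[OF that] by (simp add: continuous_on_eq_continuous_within)
      then show ?thesis by (rule continuous_on_subset) (auto simp: \<Omega>_def)
    qed
    define g where "g b y = (if y \<in> \<Omega> then ?f y * m b y * inverse (r y) else 0)" for b y
    define g' where "g' b y v = ?f y * m b y * - (inverse (r y) * ?D r y v * inverse (r y)) +
        (?f y * ?D (m b) y v + ?D ?f y v * m b y) * inverse (r y)" for b y v
    have gder: "(g b has_derivative g' b y) (at y)" if b: "b \<in> Basis" and y: "y \<in> \<Omega>" for b y
    proof -
      have yT: "y \<in> ?T" using y by (simp add: \<Omega>_def)
      have "((\<lambda>y. ?f y * m b y * inverse (r y)) has_derivative g' b y) (at y)"
        unfolding g'_def
        by (rule has_derivative_mult[OF has_derivative_mult[OF der[OF ts[OF f yT] y] der[OF ms[OF b yT] y]]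
            Deriv.has_derivative_inverse[OF r0[OF y] der[OF rs[OF yT] y]]])
      then show ?thesis
        by (rule has_derivative_transform_within_open[OF _ \<Omega>open y]) (simp add: g_def)
    qed
    define K0 where "K0 = \<phi> ` (K \<inter> ?S)"
    have "compact (K \<inter> ?S)" using compact_Int_closed[OF compact_UNIV, of "K \<inter> ?S"] K(1) by auto
    moreover have "continuous_on (K \<inter> ?S) \<phi>"
      by (rule continuous_on_subset[of U]) (use chart_homeo[OF ch] K(2) in \<open>auto simp: homeomorphism_def\<close>)
    ultimately have K0: "compact K0" unfolding K0_def by (metis compact_continuous_image)
    have K0\<Omega>: "K0 \<subseteq> \<Omega>"
    proof
      fix y assume "y \<in> K0"
      then obtain x where x: "x \<in> K" "x \<in> ?S" "y = \<phi> x" by (auto simp: K0_def)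
      then have "x \<in> U" "x \<notin> bd" using K(2) fs by blast+
      then show "y \<in> \<Omega>" using \<Omega>bd[of y] x(3) ch by simp
    qed
    have g0: "g b y = 0" if b: "b \<in> Basis" and y: "y \<notin> K0" for b y
    proof (cases "y \<in> \<Omega>")
      case True
      then obtain x where x: "x \<in> U" "y = \<phi> x" by (auto simp: \<Omega>_def)
      then have "x \<notin> K \<or> x \<notin> ?S" using y by (auto simp: K0_def)
      then have "c b x = 0 \<or> f x = 0"
        using c(2)[OF b] subsetD[OF closure_subset[of "{x. f x \<noteq> 0}"], of x] by blast
      then show ?thesis using x ch by (auto simp: g_def m_def)
    qed (simp add: g_def)
    have g'c: "continuous_on \<Omega> (\<lambda>y. g' b y b)" if b: "b \<in> Basis" for b
    proof -
      have "continuous_on \<Omega> ?f" "continuous_on \<Omega> (m b)" "continuous_on \<Omega> r"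
        by (intro con ts[OF f] ms[OF b] rs; assumption)+
      moreover have "continuous_on \<Omega> (\<lambda>y. ?D ?f y b)" "continuous_on \<Omega> (\<lambda>y. ?D (m b) y b)" "continuous_on \<Omega> (\<lambda>y. ?D r y b)"
        by (intro con smooth_at_frechet_derivative[OF T _ _ b] ts[OF f] ms[OF b] rs; assumption)+
      moreover have "continuous_on \<Omega> (\<lambda>y. a y * m y * - (inverse (r y) * r' y * inverse (r y)) + (a y * m' y + a' y * m y) * inverse (r y))"
        if "continuous_on \<Omega> a" "continuous_on \<Omega> m" "continuous_on \<Omega> r" "continuous_on \<Omega> a'" "continuous_on \<Omega> m'"
          "continuous_on \<Omega> r'" for a m a' m' r' :: "'v \<Rightarrow> complex"
        using r0 by (intro continuous_intros that) auto
      ultimately show ?thesis unfolding g'_def by blast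
    qed
    have gint: "integrable lborel (\<lambda>y. if y \<in> \<Omega> then g' b y b else 0)"
      "(LINT y|lborel. (if y \<in> \<Omega> then g' b y b else 0)) = 0" if b: "b \<in> Basis" for b
      using integral_directional_derivative_eq_0[OF \<Omega>open K0 K0\<Omega> g0[OF b] gder[OF b] g'c[OF b]] b by auto
    have key: "(if y \<in> ?T then \<delta> y *\<^sub>R ((1 / \<rho> (?i y)) *\<^sub>R H (?i y)) else 0)
        = (\<Sum>b\<in>Basis. if y \<in> \<Omega> then g' b y b else 0)" for y
    proof (cases "y \<in> \<Omega>")
      case True
      then have yT: "y \<in> ?T" by (simp add: \<Omega>_def)
      then obtain x where x: "x \<in> U" "y = \<phi> x" by blast
      have ix: "?i y = x" using x ch by simp
      have Df: "?D ?f y b = chart_deriv U \<phi> f b x" for b using x by (simp add: chart_deriv_def)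
      have Dr: "?D r y b = chart_deriv U \<phi> (\<lambda>x. of_real (\<rho> x)) b x" for b using x by (simp add: chart_deriv_def r_def[abs_def] o_def)
      have \<delta>n: "?\<delta> y \<noteq> 0" using \<delta>(2)[OF yT] by simp
      have rr: "r y \<noteq> 0" by (rule r0[OF True])
      have rx: "r y = of_real (\<rho> x)" by (simp add: r_def ix)
      have "(\<Sum>b\<in>Basis. g' b y b) =
          (\<Sum>b\<in>Basis. - (f x * ?\<delta> y * inverse (r y) * inverse (r y)) * (c b x * chart_deriv U \<phi> (\<lambda>x. of_real (\<rho> x)) b x)
            + (f x * inverse (r y) * dm b y + ?\<delta> y * inverse (r y) * (c b x * chart_deriv U \<phi> f b x)))"
        by (intro sum.cong refl) (simp add: g'_def Dr Df ix m_def dm_def algebra_simps)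
      also have "\<dots> = - (f x * ?\<delta> y * inverse (r y) * inverse (r y)) * (of_real (\<rho> x) * \<beta> x)
            + (f x * inverse (r y) * (\<Sum>b\<in>Basis. dm b y) + ?\<delta> y * inverse (r y) * F x)"
        unfolding rel[OF x(1), symmetric] using x(1)
        by (simp add: sum.distrib sum_distrib_left sum_subtractf sum_negf F_def)
      also have "\<dots> = ?\<delta> y * inverse (r y) * H x"
        using rr \<delta>n x by (simp add: H_def d_def rx[symmetric] field_simps)
      also have "\<dots> = \<delta> y *\<^sub>R ((1 / \<rho> (?i y)) *\<^sub>R H (?i y))"
        by (simp add: ix rx scaleR_conv_of_real divide_inverse)
      finally show ?thesis using True yT by simp
    next
      case False
      have "\<delta> y *\<^sub>R ((1 / \<rho> (?i y)) *\<^sub>R H (?i y)) = 0" if "y \<in> ?T"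
        using \<Omega>bd[OF that] False rho_bd[of "?i y"] by simp
      then show ?thesis using False by simp
    qed
    have Hm: "(\<lambda>x. (1 / \<rho> x) *\<^sub>R H x) \<in> borel_measurable borel"
    proof (intro borel_measurable_scaleR borel_measurable_divide borel_measurable_const borel_measurable_continuous_onI)
      show "continuous_on UNIV \<rho>" "continuous_on UNIV H"
        using rho_isCont cont[OF Hsm] by (auto intro: continuous_at_imp_continuous_on)
    qed
    have "integral\<^sup>L \<mu> H = (LINT x|nu. (1 / \<rho> x) *\<^sub>R H x)"
      by (rule mu_integral[OF cont[OF Hsm] Hs])
    also have "\<dots> = (LINT y|lborel. (if y \<in> ?T then \<delta> y *\<^sub>R ((1 / \<rho> (?i y)) *\<^sub>R H (?i y)) else 0))"
      by (rule chart_integral[OF ch \<delta> Hm]) (use HK K(2) in auto)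
    also have "\<dots> = (LINT y|lborel. (\<Sum>b\<in>Basis. if y \<in> \<Omega> then g' b y b else 0))"
      unfolding key ..
    also have "\<dots> = (\<Sum>b\<in>Basis. LINT y|lborel. (if y \<in> \<Omega> then g' b y b else 0))"
      by (rule Bochner_Integration.integral_sum[OF gint(1)])
    also have "\<dots> = 0" using gint(2) by simp
    finally have "integral\<^sup>L \<mu> F = (LINT x|\<mu>. f x * d x)"
      using intF intfd by (simp add: H_def[abs_def])
    then show "integrable \<mu> (\<lambda>x. if x \<in> U then \<Sum>b\<in>Basis. c b x * chart_deriv U \<phi> f b x else 0) \<and>
      (LINT x|\<mu>. (if x \<in> U then \<Sum>b\<in>Basis. c b x * chart_deriv U \<phi> f b x else 0)) = (LINT x|\<mu>. f x * d x)"
      using intF by (simp add: F_def[abs_def])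
  qed
qed

end

section \<open>Formal adjoints\<close>

locale hermitian_b = hermitian_bundle \<A> \<rho> E h + b_measure \<A> \<rho> \<mu>
  for \<A> :: "('a::t2_space, 'v::euclidean_space) atlas" and \<rho> :: "'a \<Rightarrow> real"
    and E :: "('a, 'e::complex_vector) vbundle" and h and \<mu>
begin

lemma pairing_integrable:
  assumes "s \<in> sec" "t \<in> sec" "interior_support s"
  shows "integrable \<mu> (\<lambda>x. h x (s x) (t x))"
proof (rule mu_integrable)
  show "isCont (\<lambda>x. h x (s x) (t x)) x" for x
    by (rule msmooth_at_isCont[OF h_smooth[OF assms(1,2)]]) auto
  show "interior_support (\<lambda>x. h x (s x) (t x))"
    by (rule interior_support_mono[OF assms(3)]) (simp add: h_zero_left smooth_sectionsD(1)[OF assms(2)])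
qed

lemma eq_by_pairing:
  assumes "w \<in> fiber E x" "w' \<in> fiber E x" "\<And>u. u \<in> sec \<Longrightarrow> h x (u x) w = h x (u x) w'"
  shows "w = w'"
proof -
  have "w - w' = 0"
  proof (rule h_nondegenerate)
    show "w - w' \<in> fiber E x" by (rule fiber_diff[OF assms(1,2)])
    fix z assume z: "z \<in> fiber E x"
    obtain u where "u \<in> sec" "u x = z" using section_through[OF z] by blast
    then show "h x z (w - w') = 0" using assms(3)[of u] h_diff_right[OF z assms(1,2)] by simp
  qed
  then show ?thesis by simp
qed

lemma section_mult_support:
  "interior_support f \<Longrightarrow> interior_support (\<lambda>x. f x *\<^sub>C u x)" for f :: "'a \<Rightarrow> complex" and u :: "'a \<Rightarrow> 'e"
  by (rule interior_support_mono) auto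

text \<open>Testing against \<open>f u\<close> with an arbitrary function \<open>f\<close> gives orthogonality of \<open>w\<close> to \<open>u\<close> at each point.\<close>

lemma weak_section_zero:
  assumes w: "w \<in> sec" and weak: "\<And>u. u \<in> sec \<Longrightarrow> interior_support u \<Longrightarrow> (LINT x|\<mu>. h x (u x) (w x)) = 0"
  shows "w p = 0"
proof (rule eq_by_pairing)
  fix u assume u: "u \<in> sec"
  have "h p (u p) (w p) = 0"
  proof (rule weak_zero[where g = "\<lambda>x. h x (u x) (w x)"])
    show "msmooth_at UNIV (\<lambda>x. h x (u x) (w x)) x" for x by (rule h_smooth[OF u w])
    fix f :: "'a \<Rightarrow> complex" assume f: "\<And>x. msmooth_at UNIV f x" "interior_support f"
    have "(LINT x|\<mu>. h x (f x *\<^sub>C u x) (w x)) = 0"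
      by (rule weak[OF section_scale[OF u f(1)] section_mult_support[OF f(2)]])
    moreover have "h x (f x *\<^sub>C u x) (w x) = f x * h x (u x) (w x)" for x
      using smooth_sectionsD(1)[OF u] smooth_sectionsD(1)[OF w] by (simp add: h_scale_left)
    ultimately show "(LINT x|\<mu>. f x * h x (u x) (w x)) = 0" by simp
  qed
  then show "h p (u p) (w p) = h p (u p) 0"
    using smooth_sectionsD(1)[OF u] by (simp add: h_zero_right)
qed (use smooth_sectionsD(1)[OF w] fiber_zero in auto)

end

context bundle_pair
begin

text \<open>Operators acting locally do not enlarge supports.\<close>

lemma fo_support:
  assumes "first_order P" "u \<in> E.sec" "closure {x. u x \<noteq> 0} \<inter> S = {}"
  shows "closure {x. P u x \<noteq> 0} \<inter> S = {}"
proof -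
  have "P u x = 0" if x: "x \<notin> closure {x. u x \<noteq> 0}" for x
  proof -
    have "P u x = P (\<lambda>_. 0) x"
    proof (rule fo_local[OF assms(1,2) E.zero_section open_Compl[OF closed_closure]])
      show "x \<in> - closure {x. u x \<noteq> 0}" using x by blast
      show "u z = 0" if "z \<in> - closure {x. u x \<noteq> 0}" for z
        using that subsetD[OF closure_subset[of "{x. u x \<noteq> 0}"], of z] by blast
    qed
    then show ?thesis using fo_zero[OF assms(1)] by simp
  qed
  then have "{x. P u x \<noteq> 0} \<subseteq> closure {x. u x \<noteq> 0}" by blast
  then have "closure {x. P u x \<noteq> 0} \<subseteq> closure {x. u x \<noteq> 0}" by (rule closure_minimal) simp
  then show ?thesis using assms(3) by blast
qed

definition cut_chart :: "('a \<Rightarrow> real) \<Rightarrow> 'a set \<Rightarrow> ('a \<Rightarrow> 'v) \<Rightarrow> 'v \<Rightarrow> 'a \<Rightarrow> complex" where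
  "cut_chart \<psi> U \<phi> b x = (if x \<in> U then of_real (\<psi> x) * of_real (\<phi> x \<bullet> b) else 0)"

lemma cut_chart_smooth:
  assumes "(U, \<phi>) \<in> \<A>" "\<And>x. msmooth_at UNIV \<psi> x" "closure {x. \<psi> x \<noteq> 0} \<subseteq> U"
  shows "msmooth_at UNIV (cut_chart \<psi> U \<phi> b) x"
  unfolding cut_chart_def[abs_def]
proof (rule msmooth_at_cut[OF chart_open[OF assms(1)] _ assms(2,3)])
  fix x assume x: "x \<in> U"
  show "msmooth_at U (\<lambda>x. complex_of_real (\<phi> x \<bullet> b)) x"
  proof (rule msmooth_atI[OF assms(1) x], rule smooth_atI[OF open_UNIV UNIV_I])
    show "Ck_on k UNIV (\<lambda>y. complex_of_real (y \<bullet> b))" for k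
      by (intro Ck_on_linear_comp[OF _ bounded_linear_of_real] Ck_on_bounded_linear bounded_linear_inner_left) auto
  qed (use assms(1) in auto)
qed

text \<open>The function \<open>f\<close> minus its linear Taylor polynomial at \<open>x\<close> in the cut-off coordinates has vanishing
  differential at \<open>x\<close>, so only the linear part contributes to the commutator.\<close>

lemma fo_chart_expansion:
  assumes P: "first_order P" and ch: "(U, \<phi>) \<in> \<A>" and \<psi>: "\<And>x. msmooth_at UNIV \<psi> x" "closure {x. \<psi> x \<noteq> 0} \<subseteq> U"
    and V: "open V" "x \<in> V" "V \<subseteq> U" "\<And>z. z \<in> V \<Longrightarrow> \<psi> z = 1"
    and s: "s \<in> E.sec" and f: "\<And>x. msmooth_at UNIV f x"
  shows "P (\<lambda>x. f x *\<^sub>C s x) x = f x *\<^sub>C P s x + (\<Sum>b\<in>Basis. chart_deriv U \<phi> f b x *\<^sub>C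
    (P (\<lambda>x. cut_chart \<psi> U \<phi> b x *\<^sub>C s x) x - cut_chart \<psi> U \<phi> b x *\<^sub>C P s x))"
proof -
  let ?y = "cut_chart \<psi> U \<phi>" and ?D = "\<lambda>b. chart_deriv U \<phi> f b x"
  have xU: "x \<in> U" using V by blast
  have ys: "msmooth_at UNIV (?y b) z" for b z by (rule cut_chart_smooth[OF ch \<psi>])
  define g where "g z = f z - (\<Sum>b\<in>Basis. ?D b * ?y b z)" for z
  have gs: "msmooth_at UNIV g z" for z unfolding g_def[abs_def] by (intro msmooth_at_diff msmooth_at_sum msmooth_at_mult msmooth_at_const f ys) auto
  let ?L = "\<lambda>z. f z - (\<Sum>b\<in>Basis. ?D b * (if z \<in> U then complex_of_real (\<phi> z \<bullet> b) else 0))"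
  have "critical_at ?L x"
  proof (rule critical_atI[OF ch xU])
    let ?F = "frechet_derivative (f \<circ> inv_into U \<phi>) (at (\<phi> x) within \<phi> ` U)"
    have fd: "((f \<circ> inv_into U \<phi>) has_derivative ?F) (at (\<phi> x) within \<phi> ` U)"
      by (rule chart_has_derivative[OF f ch xU])
    have "((\<lambda>y. (f \<circ> inv_into U \<phi>) y - (\<Sum>b\<in>Basis. ?D b * complex_of_real (y \<bullet> b))) has_derivative
        (\<lambda>v. ?F v - (\<Sum>b\<in>Basis. ?D b * complex_of_real (v \<bullet> b)))) (at (\<phi> x) within \<phi> ` U)"
      by (intro has_derivative_diff fd has_derivative_sum has_derivative_mult_right
          bounded_linear_imp_has_derivative bounded_linear_compose[OF bounded_linear_of_real bounded_linear_inner_left])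
    moreover have "?F v - (\<Sum>b\<in>Basis. ?D b * complex_of_real (v \<bullet> b)) = 0" for v
    proof -
      have lin: "linear ?F" using fd has_derivative_linear by blast
      have "?F v = ?F (\<Sum>b\<in>Basis. (v \<bullet> b) *\<^sub>R b)" by (simp add: euclidean_representation)
      also have "\<dots> = (\<Sum>b\<in>Basis. (v \<bullet> b) *\<^sub>R ?F b)" using lin by (simp add: linear_sum linear_scale)
      finally show ?thesis by (simp add: chart_deriv_def scaleR_conv_of_real mult.commute)
    qed
    ultimately have "((\<lambda>y. (f \<circ> inv_into U \<phi>) y - (\<Sum>b\<in>Basis. ?D b * complex_of_real (y \<bullet> b))) has_derivative
        (\<lambda>v. 0)) (at (\<phi> x) within \<phi> ` U)" by simp
    then show "((?L \<circ> inv_into U \<phi>) has_derivative (\<lambda>_. 0)) (at (\<phi> x) within \<phi> ` U)"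
      by (rule has_derivative_transform[rotated 2]) (use ch xU in auto)
  qed
  then have "critical_at g x"
    by (rule critical_at_cong[OF _ V(1,2)]) (use V(3,4) in \<open>auto simp: g_def cut_chart_def intro!: sum.cong\<close>)
  from fo_mult[OF P s gs this]
  have 1: "P (\<lambda>x. g x *\<^sub>C s x) x = g x *\<^sub>C P s x" .
  have gsec: "(\<lambda>x. g x *\<^sub>C s x) \<in> E.sec" by (rule E.section_scale[OF s gs])
  have ysec: "(\<lambda>x. ?y b x *\<^sub>C s x) \<in> E.sec" for b by (rule E.section_scale[OF s ys])
  have Dsec: "(\<lambda>x. ?D b *\<^sub>C ?y b x *\<^sub>C s x) \<in> E.sec" for b by (rule E.section_scale[OF ysec msmooth_at_const])
  have "(\<lambda>x. f x *\<^sub>C s x) = (\<lambda>z. g z *\<^sub>C s z + (\<Sum>b\<in>Basis. ?D b *\<^sub>C ?y b z *\<^sub>C s z))"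
    by (intro ext) (simp add: g_def scaleC_scaleC complex_vector.scale_left_diff_distrib complex_vector.scale_sum_left)
  then have "P (\<lambda>x. f x *\<^sub>C s x) x = P (\<lambda>z. g z *\<^sub>C s z + (\<Sum>b\<in>Basis. ?D b *\<^sub>C ?y b z *\<^sub>C s z)) x" by presburger
  also have "\<dots> = g x *\<^sub>C P s x + (\<Sum>b\<in>Basis. ?D b *\<^sub>C P (\<lambda>x. ?y b x *\<^sub>C s x) x)"
    unfolding fo_add[OF P gsec E.section_sum[OF Dsec]] fo_sum[OF P Dsec] fo_const[OF P ysec] 1 ..
  also have "\<dots> = f x *\<^sub>C P s x + (\<Sum>b\<in>Basis. ?D b *\<^sub>C (P (\<lambda>x. ?y b x *\<^sub>C s x) x - ?y b x *\<^sub>C P s x))"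
    by (simp add: g_def complex_vector.scale_left_diff_distrib complex_vector.scale_right_diff_distrib
        complex_vector.scale_sum_left sum_subtractf scaleC_scaleC)
  finally show ?thesis .
qed

end

locale hermitian_pair = bundle_pair \<A> \<rho> E F + sw: bundle_pair \<A> \<rho> F E + b_measure \<A> \<rho> \<mu> +
  HE: hermitian_b \<A> \<rho> E hE \<mu> + HF: hermitian_b \<A> \<rho> F hF \<mu>
  for \<A> :: "('a::t2_space, 'v::euclidean_space) atlas" and \<rho> :: "'a \<Rightarrow> real"
    and E F :: "('a, 'e::complex_vector) vbundle" and hE hF :: "'a \<Rightarrow> 'e \<Rightarrow> 'e \<Rightarrow> complex" and \<mu> :: "'a measure"
begin

definition adjoint_value :: "(('a \<Rightarrow> 'e) \<Rightarrow> 'a \<Rightarrow> 'e) \<Rightarrow> ('a \<Rightarrow> 'e) \<Rightarrow> ('a \<Rightarrow> 'e) \<Rightarrow> bool" where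
  "adjoint_value P v w \<longleftrightarrow> w \<in> E.sec \<and> (\<forall>u\<in>E.sec. interior_support u \<longrightarrow>
     (LINT x|\<mu>. hF x (P u x) (v x)) = (LINT x|\<mu>. hE x (u x) (w x)))"

text \<open>In a patch, \<open>u = \<Sum> u\<^sub>i e\<^sub>i\<close> and \<open>\<langle>P u, v\<rangle> = \<Sum> u\<^sub>i \<langle>P e\<^sub>i, v\<rangle> + X\<^sub>i u\<^sub>i\<close> with vector fields \<open>X\<^sub>i\<close> such
  that \<open>X\<^sub>i \<rho> = \<rho> \<langle>B e\<^sub>i, v\<rangle>\<close>. So the divergence theorem applies, and the Riesz representation
  gives the adjoint.\<close>

lemma patch_adjoint:
  assumes P: "b_first_order P B"
  shows "\<exists>V. open V \<and> p \<in> V \<and>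
    (\<forall>\<eta> v. (\<forall>x. msmooth_at UNIV \<eta> x) \<longrightarrow> closure {x. \<eta> x \<noteq> (0::real)} \<subseteq> V \<longrightarrow> v \<in> F.sec \<longrightarrow>
      (\<exists>w. adjoint_value P (\<lambda>x. of_real (\<eta> x) *\<^sub>C v x) w))"
proof -
  note fo = bfo_fo[OF P]
  obtain U \<phi> where ch: "(U, \<phi>) \<in> \<A>" "p \<in> U" by (rule chart_exists)
  obtain W es where W: "(W, es) \<in> frames E" "p \<in> W" by (rule E.frame_exists)
  have o: "open (U \<inter> W)" "p \<in> U \<inter> W" using chart_open[OF ch(1)] E.frame_open[OF W(1)] ch W by auto
  obtain \<psi> :: "'a \<Rightarrow> real" and V where \<psi>: "\<And>x. msmooth_at UNIV \<psi> x" "open V" "p \<in> V" "V \<subseteq> U \<inter> W" "\<And>x. x \<in> V \<Longrightarrow> \<psi> x = 1"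
    "closure {x. \<psi> x \<noteq> 0} \<subseteq> U \<inter> W"
    using bump[OF o] by metis
  have \<psi>U: "closure {x. \<psi> x \<noteq> 0} \<subseteq> U" and \<psi>W: "closure {x. \<psi> x \<noteq> 0} \<subseteq> W" and VU: "V \<subseteq> U" and VW: "V \<subseteq> W"
    using \<psi>(4,6) by auto
  let ?k = "length es" and ?e = "E.cut_frame \<psi> W es" and ?y = "cut_chart \<psi> U \<phi>"
  have es: "?e i \<in> E.sec" if "i < ?k" for i by (rule E.cut_frame_section[OF W(1) \<psi>(1) \<psi>W that])
  have ys: "msmooth_at UNIV (?y b) z" for b z by (rule cut_chart_smooth[OF ch(1) \<psi>(1) \<psi>U])
  have yes: "(\<lambda>x. ?y b x *\<^sub>C ?e i x) \<in> E.sec" if "i < ?k" for b i by (rule E.section_scale[OF es[OF that] ys])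
  define C where "C i b x = P (\<lambda>x. ?y b x *\<^sub>C ?e i x) x - ?y b x *\<^sub>C P (?e i) x" for i b x
  have Cs: "C i b \<in> F.sec" if "i < ?k" for i b
    unfolding C_def[abs_def] by (intro F.section_diff F.section_scale fo_section[OF fo] yes es that ys)
  have expand: "P (\<lambda>x. f x *\<^sub>C ?e i x) x = f x *\<^sub>C P (?e i) x + (\<Sum>b\<in>Basis. chart_deriv U \<phi> f b x *\<^sub>C C i b x)"
    if "i < ?k" "x \<in> V" "\<And>x. msmooth_at UNIV f x" for f i x
    unfolding C_def by (rule fo_chart_expansion[OF fo ch(1) \<psi>(1) \<psi>U \<psi>(2) that(2) VU \<psi>(5) es[OF that(1)] that(3)])
  show ?thesis
  proof (rule exI[of _ V], intro conjI allI impI \<psi>(2,3))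
    fix \<eta> :: "'a \<Rightarrow> real" and v assume \<eta>': "\<forall>x. msmooth_at UNIV \<eta> x" and \<eta>2: "closure {x. \<eta> x \<noteq> 0} \<subseteq> V" and v: "v \<in> F.sec"
    have \<eta>: "msmooth_at UNIV \<eta> x" for x using \<eta>' by blast
    define K where "K = closure {x. \<eta> x \<noteq> 0}"
    have K: "closed K" "K \<subseteq> V" using \<eta>2 by (auto simp: K_def)
    define v1 where "v1 x = complex_of_real (\<eta> x) *\<^sub>C v x" for x
    have v1: "v1 \<in> F.sec" unfolding v1_def[abs_def] by (intro F.section_scale v msmooth_at_of_real \<eta>)
    have v10: "v1 x = 0" if "x \<notin> K" for x
      using that subsetD[OF closure_subset[of "{x. \<eta> x \<noteq> 0}"], of x] by (auto simp: K_def v1_def)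
    have ff: "s x \<in> fiber F x" if "s \<in> F.sec" for s x using F.smooth_sectionsD(1)[OF that] by simp
    have hK: "hF x (s x) (v1 x) = 0" if "s \<in> F.sec" "x \<notin> K" for s x
      using v10[OF that(2)] ff[OF that(1)] HF.h_zero_right by simp
    define c where "c i b x = hF x (C i b x) (v1 x)" for i b x
    define \<beta> where "\<beta> i x = hF x (B (?e i) x) (v1 x)" for i x
    have ffC: "C i b x \<in> fiber F x" if "i < ?k" for i b x by (rule ff[OF Cs[OF that]])
    have rel: "(\<Sum>b\<in>Basis. c i b x * chart_deriv U \<phi> (\<lambda>x. of_real (\<rho> x)) b x) = of_real (\<rho> x) * \<beta> i x"
      if i: "i < ?k" and "x \<in> U" for i x
    proof (cases "x \<in> K")
      case True
      then have xV: "x \<in> V" using K by blast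
      have Be: "B (?e i) \<in> F.sec" by (rule bfo_section[OF P es[OF i]])
      let ?D = "\<lambda>b. chart_deriv U \<phi> (\<lambda>x. of_real (\<rho> x)) b x"
      have "of_real (\<rho> x) *\<^sub>C B (?e i) x = (\<Sum>b\<in>Basis. ?D b *\<^sub>C C i b x)"
        using expand[OF i xV msmooth_at_of_real[OF rho_smooth]] bfo_rho[OF P es[OF i], of x] by (simp add: scaleC_add_right)
      then have "hF x (of_real (\<rho> x) *\<^sub>C B (?e i) x) (v1 x) = (\<Sum>b\<in>Basis. hF x (?D b *\<^sub>C C i b x) (v1 x))"
        using HF.h_sum_left[of Basis "\<lambda>b. ?D b *\<^sub>C C i b x" x "v1 x"] ff[OF v1] F.fiber_scale[OF ffC[OF i]] by simp
      then show ?thesis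
        using HF.h_scale_left[OF ff[OF Be] ff[OF v1]] HF.h_scale_left[OF ffC[OF i] ff[OF v1]]
        by (simp add: c_def \<beta>_def mult.commute)
    next
      case False
      then show ?thesis using hK[OF Cs[OF i]] hK[OF bfo_section[OF P es[OF i]]] by (simp add: c_def \<beta>_def)
    qed
    have KU: "K \<subseteq> U" using K VU by blast
    define R where "R i d \<longleftrightarrow> (\<forall>x. msmooth_at UNIV d x) \<and> (\<forall>f. (\<forall>x. msmooth_at UNIV f x) \<longrightarrow> interior_support f \<longrightarrow>
        integrable \<mu> (\<lambda>x. if x \<in> U then \<Sum>b\<in>Basis. c i b x * chart_deriv U \<phi> f b x else 0) \<and>
        (LINT x|\<mu>. (if x \<in> U then \<Sum>b\<in>Basis. c i b x * chart_deriv U \<phi> f b x else 0)) = (LINT x|\<mu>. f x * d x))" for i d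
    have ex: "\<exists>d. R i d"
      if i: "i < ?k" for i
    proof -
      have 1: "msmooth_at UNIV (c i b) x" "msmooth_at UNIV (\<beta> i) x" for b x
        unfolding c_def[abs_def] \<beta>_def[abs_def]
        by (intro HF.h_smooth Cs[OF i] v1 bfo_section[OF P es[OF i]])+
      have 2: "c i b x = 0" "\<beta> i x = 0" if "x \<notin> K" for b x
        using hK[OF Cs[OF i] that] hK[OF bfo_section[OF P es[OF i]] that] by (simp_all add: c_def \<beta>_def)
      obtain d where "\<And>x. msmooth_at UNIV d x"
        "\<And>f. (\<And>x. msmooth_at UNIV f x) \<Longrightarrow> interior_support f \<Longrightarrow>
          integrable \<mu> (\<lambda>x. if x \<in> U then \<Sum>b\<in>Basis. c i b x * chart_deriv U \<phi> f b x else 0) \<and>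
          (LINT x|\<mu>. (if x \<in> U then \<Sum>b\<in>Basis. c i b x * chart_deriv U \<phi> f b x else 0)) = (LINT x|\<mu>. f x * d x)"
        using chart_divergence[OF ch(1) K(1) KU 1(1) 2(1) 1(2) 2(2) rel[OF i]] by blast
      then show ?thesis unfolding R_def by blast
    qed
    define d where "d i = (SOME d. R i d)" for i
    have R: "R i (d i)" if "i < ?k" for i unfolding d_def by (rule someI_ex[OF ex[OF that]])
    have d: "\<And>i x. i < ?k \<Longrightarrow> msmooth_at UNIV (d i) x"
      "\<And>i f. i < ?k \<Longrightarrow> (\<And>x. msmooth_at UNIV f x) \<Longrightarrow> interior_support f \<Longrightarrow>
        integrable \<mu> (\<lambda>x. if x \<in> U then \<Sum>b\<in>Basis. c i b x * chart_deriv U \<phi> f b x else 0) \<and>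
        (LINT x|\<mu>. (if x \<in> U then \<Sum>b\<in>Basis. c i b x * chart_deriv U \<phi> f b x else 0)) = (LINT x|\<mu>. f x * d i x)"
      using R unfolding R_def by blast+
    define G0 where "G0 i x = hF x (P (?e i) x) (v1 x)" for i x
    have G0s: "msmooth_at UNIV (G0 i) x" if "i < ?k" for i x
      unfolding G0_def[abs_def] by (intro HF.h_smooth fo_section[OF fo] es that v1)
    define G where "G i x = complex_of_real (\<psi> x) * (G0 i x + d i x)" for i x
    have Gs: "msmooth_at UNIV (G i) x" if "i < ?k" for i x
      unfolding G_def[abs_def] by (intro msmooth_at_mult msmooth_at_add msmooth_at_of_real \<psi>(1) G0s d(1) that) auto
    have G00: "G i x = 0" if "x \<notin> closure {x. \<psi> x \<noteq> 0}" for i x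
      using that subsetD[OF closure_subset[of "{x. \<psi> x \<noteq> 0}"], of x] by (auto simp: G_def)
    obtain w where w: "w \<in> E.sec" "\<And>x i. x \<in> W \<Longrightarrow> i < ?k \<Longrightarrow> hE x ((es ! i) x) (w x) = G i x" "\<And>x. x \<notin> W \<Longrightarrow> w x = 0"
    proof (rule HE.riesz_section[OF W(1) closed_closure \<psi>W, where G = G])
      show "msmooth_at UNIV (G i) x" if "i < ?k" for i x by (rule Gs[OF that])
      show "G i x = 0" if "x \<notin> closure {x. \<psi> x \<noteq> 0}" for i x by (rule G00[OF that])
      fix w assume "w \<in> E.sec" "\<And>x i. x \<in> W \<Longrightarrow> i < ?k \<Longrightarrow> hE x ((es ! i) x) (w x) = G i x" "\<And>x. x \<notin> W \<Longrightarrow> w x = 0"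
      then show thesis by (rule that)
    qed
    have "adjoint_value P v1 w"
      unfolding adjoint_value_def
    proof (intro conjI ballI impI w(1))
      fix u assume u: "u \<in> E.sec" and us: "interior_support u"
      let ?u = "E.cut_coord \<psi> W es u"
      have uc: "msmooth_at UNIV (?u i) x" if "i < ?k" for i x by (rule E.cut_coord_smooth[OF W(1) u \<psi>(1) \<psi>W that])
      have ucs: "interior_support (?u i)" if "i < ?k" for i
        by (rule interior_support_mono[OF us]) (use E.coord_zero[OF W(1)] that in \<open>simp add: E.cut_coord_def\<close>)
      have ue: "(\<lambda>x. ?u i x *\<^sub>C ?e i x) \<in> E.sec" if "i < ?k" for i by (rule E.section_scale[OF es[OF that] uc[OF that]])
      define X where "X i x = (if x \<in> U then \<Sum>b\<in>Basis. c i b x * chart_deriv U \<phi> (?u i) b x else 0)" for i x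
      have L: "hF x (P u x) (v1 x) = (\<Sum>i<?k. ?u i x * G0 i x + X i x)" for x
      proof (cases "x \<in> K")
        case True
        then have xV: "x \<in> V" "x \<in> U" using K VU by blast+
        have "P u x = P (\<lambda>x. \<Sum>i<?k. ?u i x *\<^sub>C ?e i x) x"
        proof (rule fo_local[OF fo u _ \<psi>(2) xV(1)])
          show "(\<lambda>x. \<Sum>i<?k. ?u i x *\<^sub>C ?e i x) \<in> E.sec" by (rule E.section_sum) (simp add: ue)
          show "u z = (\<Sum>i<?k. ?u i z *\<^sub>C ?e i z)" if "z \<in> V" for z
            by (rule E.cut_expand[OF W(1) E.smooth_sectionsD(1)[OF u UNIV_I]]) (use that VW \<psi>(5) in auto)
        qed
        also have "\<dots> = (\<Sum>i<?k. P (\<lambda>x. ?u i x *\<^sub>C ?e i x) x)" by (rule fo_sum[OF fo]) (simp add: ue)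
        also have "\<dots> = (\<Sum>i<?k. ?u i x *\<^sub>C P (?e i) x + (\<Sum>b\<in>Basis. chart_deriv U \<phi> (?u i) b x *\<^sub>C C i b x))"
          by (intro sum.cong refl expand xV(1) uc) auto
        finally have Pu: "P u x = (\<Sum>i<?k. ?u i x *\<^sub>C P (?e i) x + (\<Sum>b\<in>Basis. chart_deriv U \<phi> (?u i) b x *\<^sub>C C i b x))" .
        have fP: "P (?e i) x \<in> fiber F x" if "i < ?k" for i by (rule ff[OF fo_section[OF fo es[OF that]]])
        have fS: "(\<Sum>b\<in>Basis. chart_deriv U \<phi> (?u i) b x *\<^sub>C C i b x) \<in> fiber F x" if "i < ?k" for i
          using that by (intro F.fiber_sum F.fiber_scale ffC)
        have "hF x (P u x) (v1 x) = (\<Sum>i<?k. hF x (?u i x *\<^sub>C P (?e i) x + (\<Sum>b\<in>Basis. chart_deriv U \<phi> (?u i) b x *\<^sub>C C i b x)) (v1 x))"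
          unfolding Pu by (rule HF.h_sum_left) (use fP fS ff[OF v1] in \<open>auto intro!: F.fiber_add F.fiber_scale\<close>)
        also have "\<dots> = (\<Sum>i<?k. ?u i x * G0 i x + X i x)"
        proof (rule sum.cong[OF refl])
          fix i assume "i \<in> {..<?k}"
          then have i: "i < ?k" by simp
          have "hF x (\<Sum>b\<in>Basis. chart_deriv U \<phi> (?u i) b x *\<^sub>C C i b x) (v1 x) = (\<Sum>b\<in>Basis. hF x (chart_deriv U \<phi> (?u i) b x *\<^sub>C C i b x) (v1 x))"
            by (rule HF.h_sum_left) (use ffC[OF i] ff[OF v1] in \<open>auto intro: F.fiber_scale\<close>)
          also have "\<dots> = X i x"
            using xV(2) HF.h_scale_left[OF ffC[OF i] ff[OF v1]] by (simp add: X_def c_def mult.commute)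
          finally show "hF x (?u i x *\<^sub>C P (?e i) x + (\<Sum>b\<in>Basis. chart_deriv U \<phi> (?u i) b x *\<^sub>C C i b x)) (v1 x) = ?u i x * G0 i x + X i x"
            using HF.h_add_left[OF F.fiber_scale[OF fP[OF i]] fS[OF i] ff[OF v1]] HF.h_scale_left[OF fP[OF i] ff[OF v1]]
            by (simp add: G0_def)
        qed
        finally show ?thesis .
      next
        case False
        have "c i b x = 0" "G0 i x = 0" if "i < ?k" for i b
          using hK[OF Cs[OF that] False] hK[OF fo_section[OF fo es[OF that]] False] by (simp_all add: c_def G0_def)
        then show ?thesis using hK[OF fo_section[OF fo u] False] by (auto simp: X_def intro!: sum.neutral)
      qed
      have R: "hE x (u x) (w x) = (\<Sum>i<?k. ?u i x * G0 i x + ?u i x * d i x)" for x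
      proof (cases "x \<in> W")
        case True
        note f = E.frame_in_fiber[OF W(1) True]
        have wf: "w x \<in> fiber E x" using E.smooth_sectionsD(1)[OF w(1)] by simp
        have "hE x (u x) (w x) = hE x (\<Sum>i<?k. coord es x (u x) i *\<^sub>C (es ! i) x) (w x)"
          using E.frame_expand[OF W(1) True E.smooth_sectionsD(1)[OF u UNIV_I]] by simp
        also have "\<dots> = (\<Sum>i<?k. hE x (coord es x (u x) i *\<^sub>C (es ! i) x) (w x))"
          by (rule HE.h_sum_left) (use f wf in \<open>auto intro: E.fiber_scale\<close>)
        also have "\<dots> = (\<Sum>i<?k. ?u i x * G0 i x + ?u i x * d i x)"
          by (rule sum.cong[OF refl])
            (use f wf w(2)[OF True] True in \<open>simp add: HE.h_scale_left E.cut_coord_def G_def algebra_simps\<close>)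
        finally show ?thesis .
      next
        case False
        then show ?thesis using w(3) HE.h_zero_right E.smooth_sectionsD(1)[OF u] by (simp add: E.cut_coord_def)
      qed
      note cont = msmooth_at_isCont[OF _ open_UNIV UNIV_I]
      have I0: "integrable \<mu> (\<lambda>x. ?u i x * G0 i x)" if "i < ?k" for i
        by (intro mu_integrable cont msmooth_at_mult uc G0s that UNIV_I interior_support_mono[OF ucs[OF that]]) simp
      have Id: "integrable \<mu> (\<lambda>x. ?u i x * d i x)" if "i < ?k" for i
        by (intro mu_integrable cont msmooth_at_mult uc d(1) that UNIV_I interior_support_mono[OF ucs[OF that]]) simp
      have IX: "integrable \<mu> (X i)" "(LINT x|\<mu>. X i x) = (LINT x|\<mu>. ?u i x * d i x)" if "i < ?k" for i
        using d(2)[OF that uc[OF that] ucs[OF that]] unfolding X_def[abs_def] by blast+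
      have "(LINT x|\<mu>. hF x (P u x) (v1 x)) = (\<Sum>i<?k. (LINT x|\<mu>. ?u i x * G0 i x) + (LINT x|\<mu>. X i x))"
        unfolding L using I0 IX(1) by (subst Bochner_Integration.integral_sum) auto
      also have "\<dots> = (\<Sum>i<?k. (LINT x|\<mu>. ?u i x * G0 i x) + (LINT x|\<mu>. ?u i x * d i x))"
        using IX(2) by simp
      also have "\<dots> = (LINT x|\<mu>. hE x (u x) (w x))"
        unfolding R using I0 Id by (subst Bochner_Integration.integral_sum) auto
      finally show "(LINT x|\<mu>. hF x (P u x) (v1 x)) = (LINT x|\<mu>. hE x (u x) (w x))" .
    qed
    then show "\<exists>w. adjoint_value P (\<lambda>x. of_real (\<eta> x) *\<^sub>C v x) w" unfolding v1_def[abs_def] by blast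
  qed
qed

lemma adjoint_value_sum:
  assumes P: "first_order P" and I: "finite I"
    and v: "\<And>i. i \<in> I \<Longrightarrow> v i \<in> F.sec" "\<And>i. i \<in> I \<Longrightarrow> \<exists>w. adjoint_value P (v i) w"
  shows "\<exists>w. adjoint_value P (\<lambda>x. \<Sum>i\<in>I. v i x) w"
proof -
  obtain w where w: "\<And>i. i \<in> I \<Longrightarrow> adjoint_value P (v i) (w i)" using v(2) by metis
  have ws: "w i \<in> E.sec" if "i \<in> I" for i using w[OF that] by (simp add: adjoint_value_def)
  have "adjoint_value P (\<lambda>x. \<Sum>i\<in>I. v i x) (\<lambda>x. \<Sum>i\<in>I. w i x)"
    unfolding adjoint_value_def
  proof (intro conjI ballI impI)
    show "(\<lambda>x. \<Sum>i\<in>I. w i x) \<in> E.sec" by (rule E.section_sum[OF ws])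
    fix u assume u: "u \<in> E.sec" and us: "interior_support u"
    note Pu = fo_section[OF P u] and Pus = fo_support[OF P u us]
    have "hF x (P u x) (\<Sum>i\<in>I. v i x) = (\<Sum>i\<in>I. hF x (P u x) (v i x))" for x
      by (rule HF.h_sum_right) (use F.smooth_sectionsD(1)[OF v(1)] F.smooth_sectionsD(1)[OF Pu] in auto)
    then have "(LINT x|\<mu>. hF x (P u x) (\<Sum>i\<in>I. v i x)) = (\<Sum>i\<in>I. LINT x|\<mu>. hF x (P u x) (v i x))"
      using Bochner_Integration.integral_sum[of I \<mu> "\<lambda>i x. hF x (P u x) (v i x)"] HF.pairing_integrable[OF Pu v(1) Pus] by simp
    also have "\<dots> = (\<Sum>i\<in>I. LINT x|\<mu>. hE x (u x) (w i x))"
      using w u us by (intro sum.cong refl) (simp add: adjoint_value_def)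
    also have "\<dots> = (LINT x|\<mu>. hE x (u x) (\<Sum>i\<in>I. w i x))"
    proof -
      have "hE x (u x) (\<Sum>i\<in>I. w i x) = (\<Sum>i\<in>I. hE x (u x) (w i x))" for x
        by (rule HE.h_sum_right) (use E.smooth_sectionsD(1)[OF ws] E.smooth_sectionsD(1)[OF u] in auto)
      then show ?thesis
        using Bochner_Integration.integral_sum[of I \<mu> "\<lambda>i x. hE x (u x) (w i x)"] HE.pairing_integrable[OF u ws us] by simp
    qed
    finally show "(LINT x|\<mu>. hF x (P u x) (\<Sum>i\<in>I. v i x)) = (LINT x|\<mu>. hE x (u x) (\<Sum>i\<in>I. w i x))" .
  qed
  then show ?thesis by blast
qed

abbreviation "adj_of P Q \<equiv> is_formal_adjoint \<A> \<mu> E hE F hF P Q"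

text \<open>The patchwise adjoints are added up with a partition of unity \<open>v = \<Sum> \<eta>\<^sub>i v\<close>.\<close>

lemma formal_adjoint_exists:
  assumes P: "b_first_order P B"
  obtains Q where "adj_of P Q"
proof -
  from choice[OF allI[OF patch_adjoint[OF P]]] obtain V where V: "\<forall>p. open (V p) \<and> p \<in> V p \<and>
    (\<forall>\<eta> v. (\<forall>x. msmooth_at UNIV \<eta> x) \<longrightarrow> closure {x. \<eta> x \<noteq> (0::real)} \<subseteq> V p \<longrightarrow> v \<in> F.sec \<longrightarrow>
      (\<exists>w. adjoint_value P (\<lambda>x. of_real (\<eta> x) *\<^sub>C v x) w))" ..
  have V1: "open (V p)" "p \<in> V p" for p using V by blast+
  have V3: "\<exists>w. adjoint_value P (\<lambda>x. of_real (\<eta> x) *\<^sub>C v x) w"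
    if "\<forall>x. msmooth_at UNIV \<eta> x" "closure {x. \<eta> x \<noteq> (0::real)} \<subseteq> V p" "v \<in> F.sec" for p \<eta> v
    using V that by blast
  obtain I and \<eta> :: "'a \<Rightarrow> 'a \<Rightarrow> real" where I: "finite I" and \<eta>: "\<And>i x. i \<in> I \<Longrightarrow> msmooth_at UNIV (\<eta> i) x"
    "\<And>i. i \<in> I \<Longrightarrow> closure {x. \<eta> i x \<noteq> 0} \<subseteq> V i" "\<And>x. (\<Sum>i\<in>I. \<eta> i x) = 1"
    using partition_of_unity[OF V1] by blast
  have "\<exists>w. adjoint_value P v w" if v: "v \<in> F.sec" for v
  proof -
    have "(\<Sum>i\<in>I. complex_of_real (\<eta> i x) *\<^sub>C v x) = v x" for x
    proof -
      have "(\<Sum>i\<in>I. complex_of_real (\<eta> i x) *\<^sub>C v x) = (\<Sum>i\<in>I. complex_of_real (\<eta> i x)) *\<^sub>C v x"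
        by (simp add: complex_vector.scale_sum_left)
      also have "(\<Sum>i\<in>I. complex_of_real (\<eta> i x)) = 1" using \<eta>(3)[of x] by (metis of_real_1 of_real_sum)
      finally show ?thesis by simp
    qed
    moreover have "\<exists>w. adjoint_value P (\<lambda>x. \<Sum>i\<in>I. complex_of_real (\<eta> i x) *\<^sub>C v x) w"
      by (rule adjoint_value_sum[OF bfo_fo[OF P] I])
        (auto intro!: F.section_scale v msmooth_at_of_real \<eta>(1) V3[OF _ \<eta>(2)])
    ultimately show ?thesis by simp
  qed
  then obtain Q where Q: "\<And>v. v \<in> F.sec \<Longrightarrow> adjoint_value P v (Q v)" by metis
  have "adj_of P Q"
    unfolding is_formal_adjoint_def using Q by (auto simp: adjoint_value_def)
  then show thesis by (rule that)
qed

lemma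
  assumes "adj_of P Q"
  shows adj_section: "v \<in> F.sec \<Longrightarrow> Q v \<in> E.sec"
    and adj_ibp: "u \<in> E.sec \<Longrightarrow> v \<in> F.sec \<Longrightarrow> interior_support u \<Longrightarrow>
      (LINT x|\<mu>. hF x (P u x) (v x)) = (LINT x|\<mu>. hE x (u x) (Q v x))"
  using assms unfolding is_formal_adjoint_def by blast+

text \<open>Moving \<open>f\<close> across the pairings before and after the integration by parts turns \<open>[Q, f]\<close> into
  \<open>- [P, cnj f]\<close>. The latter has order zero, so that test functions can be taken out and the weak
  identity becomes a pointwise one.\<close>

lemma adj_commutator:
  assumes P: "first_order P" and Q: "adj_of P Q" and u: "u \<in> E.sec" and v: "v \<in> F.sec" and f: "\<And>x. msmooth_at UNIV f x"
  shows "hE p (u p) (Q (\<lambda>x. f x *\<^sub>C v x) p - f p *\<^sub>C Q v p)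
    = - hF p (P (\<lambda>x. cnj (f x) *\<^sub>C u x) p - cnj (f p) *\<^sub>C P u p) (v p)"
proof -
  have cf: "msmooth_at UNIV (\<lambda>x. cnj (f x)) x" for x by (rule msmooth_at_cnj[OF f])
  have fv: "(\<lambda>x. f x *\<^sub>C v x) \<in> F.sec" by (rule F.section_scale[OF v f])
  define a where "a x = Q (\<lambda>x. f x *\<^sub>C v x) x - f x *\<^sub>C Q v x" for x
  have as: "a \<in> E.sec"
    unfolding a_def[abs_def] by (intro E.section_diff E.section_scale adj_section[OF Q] fv v f)
  define b where "b x = P (\<lambda>x. cnj (f x) *\<^sub>C u x) x - cnj (f x) *\<^sub>C P u x" for x
  have bs: "b \<in> F.sec"
    unfolding b_def[abs_def] by (intro F.section_diff F.section_scale fo_section[OF P] E.section_scale u cf)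
  have "hE p (u p) (a p) + hF p (b p) (v p) = 0"
  proof (rule weak_zero[where g = "\<lambda>x. hE x (u x) (a x) + hF x (b x) (v x)"])
    show "msmooth_at UNIV (\<lambda>x. hE x (u x) (a x) + hF x (b x) (v x)) x" for x
      by (intro msmooth_at_add HE.h_smooth HF.h_smooth u as bs v) auto
    fix k :: "'a \<Rightarrow> complex" assume k: "\<And>x. msmooth_at UNIV k x" "interior_support k"
    have ku: "(\<lambda>x. k x *\<^sub>C u x) \<in> E.sec" by (rule E.section_scale[OF u k(1)])
    have kus: "interior_support (\<lambda>x. k x *\<^sub>C u x)" by (rule HE.section_mult_support[OF k(2)])
    have fku: "(\<lambda>x. cnj (f x) *\<^sub>C k x *\<^sub>C u x) \<in> E.sec" by (rule E.section_scale[OF ku cf])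
    have fkus: "interior_support (\<lambda>x. cnj (f x) *\<^sub>C k x *\<^sub>C u x)" by (rule interior_support_mono[OF kus]) simp
    note E1 = E.smooth_sectionsD(1)[OF _ UNIV_I] and F1 = F.smooth_sectionsD(1)[OF _ UNIV_I]
    note Qv = adj_section[OF Q v] and Qfv = adj_section[OF Q fv]
    note Pku = fo_section[OF P ku] and Pfku = fo_section[OF P fku]
    have comm: "k x *\<^sub>C b x = P (\<lambda>x. cnj (f x) *\<^sub>C k x *\<^sub>C u x) x - cnj (f x) *\<^sub>C P (\<lambda>x. k x *\<^sub>C u x) x" for x
      unfolding b_def by (rule fo_commutator_mult[OF P u cf k(1), symmetric])
    have pt: "k x * (hE x (u x) (a x) + hF x (b x) (v x)) =
        (hE x (k x *\<^sub>C u x) (Q (\<lambda>x. f x *\<^sub>C v x) x) - hE x (cnj (f x) *\<^sub>C k x *\<^sub>C u x) (Q v x)) +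
        (hF x (P (\<lambda>x. cnj (f x) *\<^sub>C k x *\<^sub>C u x) x) (v x) - hF x (P (\<lambda>x. k x *\<^sub>C u x) x) (f x *\<^sub>C v x))" for x
    proof -
      have "k x * hF x (b x) (v x) = hF x (k x *\<^sub>C b x) (v x)"
        using F1[OF bs] F1[OF v] by (simp add: HF.h_scale_left)
      also have "\<dots> = hF x (P (\<lambda>x. cnj (f x) *\<^sub>C k x *\<^sub>C u x) x) (v x) - hF x (cnj (f x) *\<^sub>C P (\<lambda>x. k x *\<^sub>C u x) x) (v x)"
        unfolding comm by (rule HF.h_diff_left[OF F1[OF Pfku] F.fiber_scale[OF F1[OF Pku]] F1[OF v]])
      also have "hF x (cnj (f x) *\<^sub>C P (\<lambda>x. k x *\<^sub>C u x) x) (v x) = hF x (P (\<lambda>x. k x *\<^sub>C u x) x) (f x *\<^sub>C v x)"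
        unfolding HF.h_scale_left[OF F1[OF Pku] F1[OF v]] HF.h_scale_right[OF F1[OF Pku] F1[OF v]] ..
      finally have 1: "k x * hF x (b x) (v x) = hF x (P (\<lambda>x. cnj (f x) *\<^sub>C k x *\<^sub>C u x) x) (v x) - hF x (P (\<lambda>x. k x *\<^sub>C u x) x) (f x *\<^sub>C v x)" .
      have "hE x (u x) (a x) = hE x (u x) (Q (\<lambda>x. f x *\<^sub>C v x) x) - hE x (u x) (f x *\<^sub>C Q v x)"
        unfolding a_def by (rule HE.h_diff_right[OF E1[OF u] E1[OF Qfv] E.fiber_scale[OF E1[OF Qv]]])
      also have "hE x (u x) (f x *\<^sub>C Q v x) = cnj (f x) * hE x (u x) (Q v x)"
        by (rule HE.h_scale_right[OF E1[OF u] E1[OF Qv]])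
      finally have e: "hE x (u x) (a x) = hE x (u x) (Q (\<lambda>x. f x *\<^sub>C v x) x) - cnj (f x) * hE x (u x) (Q v x)" .
      have 2: "k x * hE x (u x) (a x) = hE x (k x *\<^sub>C u x) (Q (\<lambda>x. f x *\<^sub>C v x) x) - hE x (cnj (f x) *\<^sub>C k x *\<^sub>C u x) (Q v x)"
        unfolding HE.h_scale_left[OF E.fiber_scale[OF E1[OF u]] E1[OF Qv]] HE.h_scale_left[OF E1[OF u] E1[OF Qv]]
          HE.h_scale_left[OF E1[OF u] E1[OF Qfv]] e by (simp add: algebra_simps)
      show ?thesis unfolding distrib_left 1 2 ..
    qed
    have i1: "integrable \<mu> (\<lambda>x. hE x (k x *\<^sub>C u x) (Q (\<lambda>x. f x *\<^sub>C v x) x))" by (rule HE.pairing_integrable[OF ku Qfv kus])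
    have i2: "integrable \<mu> (\<lambda>x. hE x (cnj (f x) *\<^sub>C k x *\<^sub>C u x) (Q v x))" by (rule HE.pairing_integrable[OF fku Qv fkus])
    have i3: "integrable \<mu> (\<lambda>x. hF x (P (\<lambda>x. cnj (f x) *\<^sub>C k x *\<^sub>C u x) x) (v x))"
      by (rule HF.pairing_integrable[OF Pfku v fo_support[OF P fku fkus]])
    have i4: "integrable \<mu> (\<lambda>x. hF x (P (\<lambda>x. k x *\<^sub>C u x) x) (f x *\<^sub>C v x))"
      by (rule HF.pairing_integrable[OF Pku fv fo_support[OF P ku kus]])
    show "(LINT x|\<mu>. k x * (hE x (u x) (a x) + hF x (b x) (v x))) = 0"
      unfolding pt using i1 i2 i3 i4 adj_ibp[OF Q ku fv kus] adj_ibp[OF Q fku v fkus] by simp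
  qed
  then show ?thesis unfolding a_def b_def by (simp add: eq_neg_iff_add_eq_0)
qed

lemma adj_add:
  assumes P: "first_order P" and Q: "adj_of P Q" and v: "v \<in> F.sec" and v': "v' \<in> F.sec"
  shows "Q (\<lambda>x. v x + v' x) p = Q v p + Q v' p"
proof -
  note vv = F.section_add[OF v v']
  note S = adj_section[OF Q]
  note E1 = E.smooth_sectionsD(1)[OF _ UNIV_I] and F1 = F.smooth_sectionsD(1)[OF _ UNIV_I]
  have "(\<lambda>x. Q (\<lambda>x. v x + v' x) x - (Q v x + Q v' x)) p = 0"
  proof (rule HE.weak_section_zero)
    show "(\<lambda>x. Q (\<lambda>x. v x + v' x) x - (Q v x + Q v' x)) \<in> E.sec"
      by (intro E.section_diff E.section_add S v v' vv)
    fix u assume u: "u \<in> E.sec" and us: "interior_support u"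
    note Pu = fo_section[OF P u] and Pus = fo_support[OF P u us]
    have "hE x (u x) (Q (\<lambda>x. v x + v' x) x - (Q v x + Q v' x)) =
        hE x (u x) (Q (\<lambda>x. v x + v' x) x) - (hE x (u x) (Q v x) + hE x (u x) (Q v' x))" for x
      unfolding HE.h_diff_right[OF E1[OF u] E1[OF S[OF vv]] E.fiber_add[OF E1[OF S[OF v]] E1[OF S[OF v']]]]
        HE.h_add_right[OF E1[OF u] E1[OF S[OF v]] E1[OF S[OF v']]] ..
    moreover have "hF x (P u x) (v x + v' x) = hF x (P u x) (v x) + hF x (P u x) (v' x)" for x
      by (rule HF.h_add_right[OF F1[OF Pu] F1[OF v] F1[OF v']])
    ultimately show "(LINT x|\<mu>. hE x (u x) (Q (\<lambda>x. v x + v' x) x - (Q v x + Q v' x))) = 0"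
      using HE.pairing_integrable[OF u S[OF vv] us] HE.pairing_integrable[OF u S[OF v] us] HE.pairing_integrable[OF u S[OF v'] us]
        HF.pairing_integrable[OF Pu v Pus] HF.pairing_integrable[OF Pu v' Pus]
        adj_ibp[OF Q u vv us] adj_ibp[OF Q u v us] adj_ibp[OF Q u v' us] by simp
  qed
  then show ?thesis by simp
qed

text \<open>Subtracting the integrations by parts for \<open>P + B\<close> and \<open>P\<close> leaves a weak identity for \<open>B\<close>. Since \<open>B\<close>
  commutes with functions, it can be tested pointwise; so the pointwise adjoint of \<open>B\<close> exists and is smooth.\<close>

lemma adj_zero_order:
  assumes P: "b_first_order P B" and Q: "adj_of P Q" and Q': "adj_of (\<lambda>u x. P u x + B u x) Q'"
    and u: "u \<in> E.sec" and v: "v \<in> F.sec"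
  shows "hE p (u p) (Q' v p - Q v p) = hF p (B u p) (v p)"
proof -
  note fo = bfo_fo[OF P] and foB = bfo_fo_B[OF P]
  note S = adj_section[OF Q v] and S' = adj_section[OF Q' v]
  note E1 = E.smooth_sectionsD(1)[OF _ UNIV_I] and F1 = F.smooth_sectionsD(1)[OF _ UNIV_I]
  have "hE p (u p) (Q' v p - Q v p) - hF p (B u p) (v p) = 0"
  proof (rule weak_zero[where g = "\<lambda>x. hE x (u x) (Q' v x - Q v x) - hF x (B u x) (v x)"])
    show "msmooth_at UNIV (\<lambda>x. hE x (u x) (Q' v x - Q v x) - hF x (B u x) (v x)) x" for x
      by (intro msmooth_at_diff HE.h_smooth HF.h_smooth E.section_diff u v S S' bfo_section[OF P]) auto
    fix k :: "'a \<Rightarrow> complex" assume k: "\<And>x. msmooth_at UNIV k x" "interior_support k"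
    have ku: "(\<lambda>x. k x *\<^sub>C u x) \<in> E.sec" by (rule E.section_scale[OF u k(1)])
    have kus: "interior_support (\<lambda>x. k x *\<^sub>C u x)" by (rule HE.section_mult_support[OF k(2)])
    let ?P = "P (\<lambda>x. k x *\<^sub>C u x)" and ?B = "B (\<lambda>x. k x *\<^sub>C u x)"
    note Ps = fo_section[OF fo ku] and Bs = fo_section[OF foB ku]
    have "k x * (hE x (u x) (Q' v x - Q v x) - hF x (B u x) (v x)) =
        (hE x (k x *\<^sub>C u x) (Q' v x) - hE x (k x *\<^sub>C u x) (Q v x)) - hF x (?B x) (v x)" for x
      unfolding bfo_mult[OF P u k(1)] HF.h_scale_left[OF F1[OF bfo_section[OF P u]] F1[OF v]]
        HE.h_diff_right[OF E1[OF u] E1[OF S'] E1[OF S]] HE.h_scale_left[OF E1[OF u] E1[OF S]] HE.h_scale_left[OF E1[OF u] E1[OF S']]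
      by (simp add: algebra_simps)
    moreover have "hF x (?P x + ?B x) (v x) = hF x (?P x) (v x) + hF x (?B x) (v x)" for x
      by (rule HF.h_add_left[OF F1[OF Ps] F1[OF Bs] F1[OF v]])
    ultimately show "(LINT x|\<mu>. k x * (hE x (u x) (Q' v x - Q v x) - hF x (B u x) (v x))) = 0"
      using HE.pairing_integrable[OF ku S kus] HE.pairing_integrable[OF ku S' kus]
        HF.pairing_integrable[OF Ps v fo_support[OF fo ku kus]] HF.pairing_integrable[OF Bs v fo_support[OF foB ku kus]]
        adj_ibp[OF Q ku v kus] adj_ibp[OF Q' ku v kus] by (simp add: diff_eq_eq add.commute)
  qed
  then show ?thesis by simp
qed

text \<open>By the commutator formula \<open>[Q, f]\<close> vanishes where \<open>d f\<close> does, so \<open>Q\<close> is of first order. For \<open>f = \<rho>\<close> it reads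
  \<open>[Q, \<rho>] = - \<rho> B\<^sup>*\<close>, so \<open>Q\<close> is totally characteristic with \<open>B' = - B\<^sup>*\<close>.\<close>

lemma adj_b_first_order:
  assumes P: "b_first_order P B" and Q: "adj_of P Q"
  obtains B' where "sw.b_first_order Q B'"
proof -
  note fo = bfo_fo[OF P]
  obtain Q' where Q': "adj_of (\<lambda>u x. P u x + B u x) Q'" using formal_adjoint_exists[OF bfo_shift[OF P]] .
  note S = adj_section[OF Q] and S' = adj_section[OF Q']
  note E1 = E.smooth_sectionsD(1)[OF _ UNIV_I] and F1 = F.smooth_sectionsD(1)[OF _ UNIV_I]
  define T where "T v x = Q' v x - Q v x" for v x
  have T: "hE p (u p) (T v p) = hF p (B u p) (v p)" if "u \<in> E.sec" "v \<in> F.sec" for u v p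
    unfolding T_def by (rule adj_zero_order[OF P Q Q' that])
  have Ts: "T v \<in> E.sec" if "v \<in> F.sec" for v
    unfolding T_def[abs_def] by (intro E.section_diff S S' that)
  have neg: "- w \<in> fiber E x" "hE x u (- w) = - hE x u w" if "w \<in> fiber E x" "u \<in> fiber E x" for w u x
    using E.fiber_scale[OF that(1), of "-1"] HE.h_scale_right[OF that(2,1), of "-1"]
    by (simp_all add: complex_vector.scale_minus_left)
  define B' where "B' v x = - T v x" for v x
  have B's: "B' v \<in> E.sec" if "v \<in> F.sec" for v
    using E.section_scale[OF Ts[OF that] msmooth_at_const[of UNIV "-1"]]
    by (simp add: B'_def[abs_def] complex_vector.scale_minus_left)
  have "sw.first_order Q"
    unfolding sw.first_order_def
  proof (intro conjI ballI allI impI S)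
    fix v v' :: "'a \<Rightarrow> 'e" and f :: "'a \<Rightarrow> complex" and p assume v: "v \<in> F.sec"
    show "Q (\<lambda>x. v x + v' x) p = Q v p + Q v' p" if "v' \<in> F.sec" by (rule adj_add[OF fo Q v that])
    assume f: "\<forall>x. msmooth_at UNIV f x" and d: "critical_at f p"
    have cf: "msmooth_at UNIV (\<lambda>x. cnj (f x)) x" for x by (rule msmooth_at_cnj) (simp add: f)
    have fv: "(\<lambda>x. f x *\<^sub>C v x) \<in> F.sec" by (rule F.section_scale[OF v]) (simp add: f)
    show "Q (\<lambda>x. f x *\<^sub>C v x) p = f p *\<^sub>C Q v p"
    proof (rule HE.eq_by_pairing)
      fix u assume u: "u \<in> E.sec"
      have "P (\<lambda>x. cnj (f x) *\<^sub>C u x) p - cnj (f p) *\<^sub>C P u p = 0"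
        using fo_mult[OF fo u cf critical_at_cnj[OF d]] by simp
      then have "hE p (u p) (Q (\<lambda>x. f x *\<^sub>C v x) p - f p *\<^sub>C Q v p) = 0"
        using adj_commutator[OF fo Q u v, of f p] f HF.h_zero_left[OF F1[OF v]] by simp
      then show "hE p (u p) (Q (\<lambda>x. f x *\<^sub>C v x) p) = hE p (u p) (f p *\<^sub>C Q v p)"
        using HE.h_diff_right[OF E1[OF u] E1[OF S[OF fv]] E.fiber_scale[OF E1[OF S[OF v]]]] by simp
    qed (use E1[OF S[OF fv]] E.fiber_scale[OF E1[OF S[OF v]]] in auto)
  qed
  moreover have "B' (\<lambda>x. v x + v' x) p = B' v p + B' v' p" if v: "v \<in> F.sec" and v': "v' \<in> F.sec" for v v' p
  proof -
    have "T (\<lambda>x. v x + v' x) p = T v p + T v' p"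
    proof (rule HE.eq_by_pairing)
      fix u assume u: "u \<in> E.sec"
      show "hE p (u p) (T (\<lambda>x. v x + v' x) p) = hE p (u p) (T v p + T v' p)"
        unfolding T[OF u F.section_add[OF v v']] HE.h_add_right[OF E1[OF u] E1[OF Ts[OF v]] E1[OF Ts[OF v']]]
          T[OF u v] T[OF u v'] by (rule HF.h_add_right[OF F1[OF bfo_section[OF P u]] F1[OF v] F1[OF v']])
    qed (use E1[OF Ts[OF F.section_add[OF v v']]] E.fiber_add[OF E1[OF Ts[OF v]] E1[OF Ts[OF v']]] in auto)
    then show ?thesis by (simp add: B'_def)
  qed
  moreover have "B' (\<lambda>x. f x *\<^sub>C v x) p = f p *\<^sub>C B' v p" if v: "v \<in> F.sec" and f: "\<forall>x. msmooth_at UNIV f x" for v f p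
  proof -
    have fv: "(\<lambda>x. f x *\<^sub>C v x) \<in> F.sec" by (rule F.section_scale[OF v]) (simp add: f)
    have "T (\<lambda>x. f x *\<^sub>C v x) p = f p *\<^sub>C T v p"
    proof (rule HE.eq_by_pairing)
      fix u assume u: "u \<in> E.sec"
      show "hE p (u p) (T (\<lambda>x. f x *\<^sub>C v x) p) = hE p (u p) (f p *\<^sub>C T v p)"
        unfolding T[OF u fv] HE.h_scale_right[OF E1[OF u] E1[OF Ts[OF v]]] T[OF u v]
        by (rule HF.h_scale_right[OF F1[OF bfo_section[OF P u]] F1[OF v]])
    qed (use E1[OF Ts[OF fv]] E.fiber_scale[OF E1[OF Ts[OF v]]] in auto)
    then show ?thesis by (simp add: B'_def complex_vector.scale_minus_right)
  qed
  moreover have "Q (\<lambda>x. of_real (\<rho> x) *\<^sub>C v x) p = of_real (\<rho> p) *\<^sub>C (Q v p + B' v p)" if v: "v \<in> F.sec" for v p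
  proof -
    have r: "msmooth_at UNIV (\<lambda>x. complex_of_real (\<rho> x)) x" for x by (intro msmooth_at_of_real rho_smooth)
    have rv: "(\<lambda>x. complex_of_real (\<rho> x) *\<^sub>C v x) \<in> F.sec" by (rule F.section_scale[OF v r])
    let ?r = "complex_of_real (\<rho> p)"
    have fQ: "Q v p \<in> fiber E p" and fT: "T v p \<in> fiber E p" and fQr: "Q (\<lambda>x. of_real (\<rho> x) *\<^sub>C v x) p \<in> fiber E p"
      by (intro E1 S v Ts rv)+
    have "Q (\<lambda>x. of_real (\<rho> x) *\<^sub>C v x) p - ?r *\<^sub>C Q v p = - (?r *\<^sub>C T v p)"
    proof (rule HE.eq_by_pairing)
      fix u assume u: "u \<in> E.sec"
      have "P (\<lambda>x. cnj (complex_of_real (\<rho> x)) *\<^sub>C u x) p - cnj ?r *\<^sub>C P u p = ?r *\<^sub>C B u p"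
        using bfo_rho[OF P u, of p] by (simp add: scaleC_add_right)
      then have "hE p (u p) (Q (\<lambda>x. of_real (\<rho> x) *\<^sub>C v x) p - ?r *\<^sub>C Q v p) = - hF p (?r *\<^sub>C B u p) (v p)"
        using adj_commutator[OF fo Q u v r, of p] by simp
      also have "\<dots> = - (?r * hE p (u p) (T v p))"
        unfolding HF.h_scale_left[OF F1[OF bfo_section[OF P u]] F1[OF v]] T[OF u v] ..
      also have "\<dots> = hE p (u p) (- (?r *\<^sub>C T v p))"
        using neg(2)[OF E.fiber_scale[OF fT] E1[OF u]] HE.h_scale_right[OF E1[OF u] fT, of ?r] by simp
      finally show "hE p (u p) (Q (\<lambda>x. of_real (\<rho> x) *\<^sub>C v x) p - ?r *\<^sub>C Q v p) = hE p (u p) (- (?r *\<^sub>C T v p))" .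
    qed (use fQ fT fQr neg(1)[OF E.fiber_scale[OF fT] E.fiber_zero] in \<open>auto intro: E.fiber_diff E.fiber_scale\<close>)
    then show ?thesis
      by (simp add: B'_def scaleC_add_right complex_vector.scale_minus_right algebra_simps)
  qed
  ultimately have "sw.b_first_order Q B'"
    unfolding sw.b_first_order_def using B's by blast
  then show thesis by (rule that)
qed

end

section \<open>Indicial families\<close>

context bundle_on
begin

text \<open>Along \<open>N\<close> the coefficients of a smooth section are locally restrictions of smooth functions, which gives
  local extensions. Outside \<open>N\<close> there is nothing to match, and a partition of unity glues.\<close>

lemma section_extension:
  assumes N: "closed N" and s: "s \<in> smooth_sections \<A> E N"
  obtains t where "t \<in> sec" "\<And>x. x \<in> N \<Longrightarrow> t x = s x"
proof -
  have "\<exists>O'. open O' \<and> p \<in> O' \<and> (\<exists>t\<in>sec. \<forall>x\<in>N \<inter> O'. t x = s x)" for p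
  proof (cases "p \<in> N")
    case False
    then show ?thesis using N zero_section[of UNIV] by (intro exI[of _ "- N"]) auto
  next
    case True
    obtain W es where W: "(W, es) \<in> frames E" "p \<in> W" by (rule frame_exists)
    obtain U \<phi> where ch: "(U, \<phi>) \<in> \<A>" "p \<in> U" by (rule chart_exists)
    have "\<exists>G g. open G \<and> \<phi> p \<in> G \<and> (\<forall>k. Ck_on k G g) \<and>
        (\<forall>y\<in>\<phi> ` (U \<inter> (W \<inter> N)) \<inter> G. coord es (inv_into U \<phi> y) (s (inv_into U \<phi> y)) i = g y)"
      if i: "i < length es" for i
      using msmooth_at_chart[OF smooth_sectionsD(3)[OF s W True i] _ ch] W(2) True unfolding smooth_at_def by auto
    then obtain G g where G: "\<And>i. i < length es \<Longrightarrow> open (G i)" "\<And>i. i < length es \<Longrightarrow> \<phi> p \<in> G i"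
      "\<And>i k. i < length es \<Longrightarrow> Ck_on k (G i) (g i)"
      "\<And>i y. i < length es \<Longrightarrow> y \<in> \<phi> ` (U \<inter> (W \<inter> N)) \<Longrightarrow> y \<in> G i \<Longrightarrow>
        coord es (inv_into U \<phi> y) (s (inv_into U \<phi> y)) i = g i y"
      by (metis IntI)
    define G0 where "G0 = (\<Inter>i<length es. G i)"
    have G0: "open G0" "\<phi> p \<in> G0" unfolding G0_def using G(1,2) by (auto intro!: open_INT)
    define Z where "Z = W \<inter> {x \<in> U. \<phi> x \<in> G0}"
    have Z: "open Z" "p \<in> Z" unfolding Z_def using chart_preimage_open[OF ch(1) G0(1)] frame_open[OF W(1)] W(2) ch(2) G0(2) by auto
    obtain \<eta> :: "'a \<Rightarrow> real" and V where \<eta>: "\<And>x. msmooth_at UNIV \<eta> x" "open V" "p \<in> V" "V \<subseteq> Z" "\<And>x. x \<in> V \<Longrightarrow> \<eta> x = 1"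
      "closure {x. \<eta> x \<noteq> 0} \<subseteq> Z"
      using bump[OF Z] by metis
    define c where "c i x = (if x \<in> Z then complex_of_real (\<eta> x) * g i (\<phi> x) else 0)" for i x
    have c: "msmooth_at UNIV (c i) x" if i: "i < length es" for i x
      unfolding c_def[abs_def]
    proof (rule msmooth_at_cut[OF Z(1) _ \<eta>(1,6)])
      fix x assume x: "x \<in> Z"
      then have xU: "x \<in> U" "\<phi> x \<in> G i" using i by (auto simp: Z_def G0_def)
      show "msmooth_at Z (\<lambda>x. g i (\<phi> x)) x"
        by (rule msmooth_atI[OF ch(1) xU(1)], rule smooth_atI[OF G(1)[OF i] xU(2) G(3)[OF i]]) (use ch(1) in auto)
    qed
    define t where "t x = (if x \<in> W then \<Sum>i<length es. c i x *\<^sub>C (es ! i) x else 0)" for x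
    have "t \<in> sec"
      unfolding t_def[abs_def]
    proof (rule section_from_coords[OF W(1) closed_closure[of "{x. \<eta> x \<noteq> 0}"]])
      show "closure {x. \<eta> x \<noteq> 0} \<subseteq> W" using \<eta>(6) by (auto simp: Z_def)
      show "msmooth_at W (c i) x" if "i < length es" for i x by (rule msmooth_at_cong[OF c[OF that] open_UNIV]) auto
      show "c i x = 0" if "x \<notin> closure {x. \<eta> x \<noteq> 0}" for i x
        using that subsetD[OF closure_subset[of "{x. \<eta> x \<noteq> 0}"], of x] by (auto simp: c_def)
    qed
    moreover have "t x = s x" if x: "x \<in> N" "x \<in> V" for x
    proof -
      have xZ: "x \<in> Z" "x \<in> W" "x \<in> U" "\<phi> x \<in> G0" using x \<eta>(4) by (auto simp: Z_def)
      have "c i x = coord es x (s x) i" if i: "i < length es" for i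
      proof -
        have "\<phi> x \<in> G i" using xZ(4) i by (auto simp: G0_def)
        moreover have "\<phi> x \<in> \<phi> ` (U \<inter> (W \<inter> N))" using xZ x by blast
        ultimately show ?thesis using G(4)[OF i, of "\<phi> x"] ch(1) xZ x \<eta>(5) by (simp add: c_def)
      qed
      then have "t x = (\<Sum>i<length es. coord es x (s x) i *\<^sub>C (es ! i) x)" using xZ(2) by (simp add: t_def)
      then show ?thesis using frame_expand[OF W(1) xZ(2) smooth_sectionsD(1)[OF s x(1)]] by simp
    qed
    ultimately show ?thesis using \<eta>(2,3) by blast
  qed
  then obtain O' t where Ot: "\<And>p. open (O' p)" "\<And>p. p \<in> O' p" "\<And>p. t p \<in> sec" "\<And>p x. x \<in> N \<Longrightarrow> x \<in> O' p \<Longrightarrow> t p x = s x"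
    by (metis IntI)
  obtain I and \<eta> :: "'a \<Rightarrow> 'a \<Rightarrow> real" where I: "finite I" and \<eta>: "\<And>i x. i \<in> I \<Longrightarrow> msmooth_at UNIV (\<eta> i) x"
    "\<And>i. i \<in> I \<Longrightarrow> closure {x. \<eta> i x \<noteq> 0} \<subseteq> O' i" "\<And>x. (\<Sum>i\<in>I. \<eta> i x) = 1"
    using partition_of_unity[OF Ot(1,2)] by blast
  show thesis
  proof (rule that)
    show "(\<lambda>x. \<Sum>i\<in>I. complex_of_real (\<eta> i x) *\<^sub>C t i x) \<in> sec"
      by (intro section_sum section_scale Ot msmooth_at_of_real \<eta>(1))
    fix x assume x: "x \<in> N"
    have "(\<Sum>i\<in>I. complex_of_real (\<eta> i x) *\<^sub>C t i x) = (\<Sum>i\<in>I. complex_of_real (\<eta> i x) *\<^sub>C s x)"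
    proof (rule sum.cong[OF refl])
      fix i assume i: "i \<in> I"
      show "complex_of_real (\<eta> i x) *\<^sub>C t i x = complex_of_real (\<eta> i x) *\<^sub>C s x"
        using Ot(4)[OF x, of i] \<eta>(2)[OF i] closure_subset[of "{x. \<eta> i x \<noteq> 0}"] by (cases "\<eta> i x = 0") auto
    qed
    also have "\<dots> = (\<Sum>i\<in>I. complex_of_real (\<eta> i x)) *\<^sub>C s x" by (simp add: complex_vector.scale_sum_left)
    also have "(\<Sum>i\<in>I. complex_of_real (\<eta> i x)) = 1" using \<eta>(3)[of x] by (metis of_real_1 of_real_sum)
    finally show "(\<Sum>i\<in>I. complex_of_real (\<eta> i x) *\<^sub>C t i x) = s x" by simp
  qed
qed

lemma section_restrict:
  assumes "s \<in> sec"
  shows "(\<lambda>x. if x \<in> N then s x else 0) \<in> smooth_sections \<A> E N"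
proof (rule smooth_sectionsI)
  fix p assume p: "p \<in> N"
  show "smooth_section_at N (\<lambda>x. if x \<in> N then s x else 0) p"
    by (rule smooth_section_at_cong[OF smooth_sections_at[OF assms UNIV_I] open_UNIV UNIV_I]) auto
qed (use smooth_sectionsD(1)[OF assms] in auto)

end

context bmanifold
begin

text \<open>The function \<open>\<rho>\<^sup>i\<^sup>\<sigma>\<close>, of interest only in the interior.\<close>

definition rpow :: "complex \<Rightarrow> 'a \<Rightarrow> complex" where
  "rpow \<sigma> x = of_real (\<rho> x) powr (\<i> * \<sigma>)"

lemma rpow_exp: "x \<notin> bd \<Longrightarrow> rpow \<sigma> x = exp (\<i> * \<sigma> * of_real (ln (\<rho> x)))"
  using rho_pos[of x] by (simp add: rpow_def powr_def Ln_of_real)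

lemma rpow_nonzero: "x \<notin> bd \<Longrightarrow> rpow \<sigma> x \<noteq> 0"
  by (simp add: rpow_exp)

lemma rpow_smooth: "x \<notin> bd \<Longrightarrow> msmooth_at (- bd) (rpow \<sigma>) x"
proof -
  assume x: "x \<notin> bd"
  have r: "msmooth_at (- bd) \<rho> x" by (rule msmooth_at_cong[OF rho_smooth open_UNIV]) auto
  have "msmooth_at (- bd) (\<lambda>x. ln (\<rho> x)) x"
    by (rule msmooth_at_compose[OF r]) (use rho_pos[OF x] x in \<open>auto intro: smooth_at_Ck[of "{0<..}"] Ck_on_ln\<close>)
  then have "msmooth_at (- bd) (\<lambda>x. \<i> * \<sigma> * of_real (ln (\<rho> x))) x" using x by (intro msmooth_at_mult msmooth_at_const msmooth_at_of_real) auto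
  then have "msmooth_at (- bd) (\<lambda>x. exp (\<i> * \<sigma> * of_real (ln (\<rho> x)))) x"
    by (rule msmooth_at_compose) (use x in \<open>auto intro: smooth_at_Ck[of UNIV] Ck_on_exp\<close>)
  then show ?thesis by (rule msmooth_at_cong[OF _ open_UNIV]) (auto simp: rpow_exp)
qed

text \<open>Differentiate \<open>\<rho>\<^sup>i\<^sup>\<sigma> = exp (i\<sigma> ln \<rho>)\<close> in a chart.\<close>

lemma rpow_critical_at:
  assumes x: "x \<notin> bd"
  shows "critical_at (\<lambda>y. rpow \<sigma> y - (\<i> * \<sigma> * rpow \<sigma> x / of_real (\<rho> x)) * of_real (\<rho> y)) x"
proof -
  obtain U \<phi> where ch: "(U, \<phi>) \<in> \<A>" "x \<in> U" by (rule chart_exists)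
  let ?r = "\<rho> \<circ> inv_into U \<phi>"
  let ?c = "\<i> * \<sigma> * rpow \<sigma> x / of_real (\<rho> x)"
  define D where "D = frechet_derivative ?r (at (\<phi> x) within \<phi> ` U)"
  have D: "(?r has_derivative D) (at (\<phi> x) within \<phi> ` U)"
    unfolding D_def by (rule chart_has_derivative[OF rho_smooth ch])
  have rx: "?r (\<phi> x) = \<rho> x" and pos: "?r (\<phi> x) > 0" using ch rho_pos[OF x] by auto
  have "((\<lambda>y. ln (?r y)) has_derivative (\<lambda>v. D v / \<rho> x)) (at (\<phi> x) within \<phi> ` U)"
    using has_derivative_ln[OF pos D] rx by (simp add: divide_inverse)
  then have "((\<lambda>y. \<i> * \<sigma> * complex_of_real (ln (?r y))) has_derivative (\<lambda>v. \<i> * \<sigma> * complex_of_real (D v / \<rho> x))) (at (\<phi> x) within \<phi> ` U)"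
    by (intro has_derivative_mult_right bounded_linear.has_derivative[OF bounded_linear_of_real])
  from has_derivative_compose[OF this DERIV_exp[unfolded has_field_derivative_def]]
  have "((\<lambda>y. exp (\<i> * \<sigma> * complex_of_real (ln (?r y)))) has_derivative
      (\<lambda>v. \<i> * \<sigma> * complex_of_real (D v / \<rho> x) * exp (\<i> * \<sigma> * complex_of_real (ln (\<rho> x))))) (at (\<phi> x) within \<phi> ` U)"
    unfolding rx by (simp add: mult.commute)
  moreover have "((\<lambda>y. ?c * complex_of_real (?r y)) has_derivative (\<lambda>v. ?c * complex_of_real (D v))) (at (\<phi> x) within \<phi> ` U)"
    by (intro has_derivative_mult_right bounded_linear.has_derivative[OF bounded_linear_of_real D])
  ultimately have "((\<lambda>y. exp (\<i> * \<sigma> * complex_of_real (ln (?r y))) - ?c * complex_of_real (?r y)) has_derivative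
      (\<lambda>v. \<i> * \<sigma> * complex_of_real (D v / \<rho> x) * exp (\<i> * \<sigma> * complex_of_real (ln (\<rho> x))) - ?c * complex_of_real (D v)))
      (at (\<phi> x) within \<phi> ` U)"
    by (rule has_derivative_diff)
  moreover have "(\<lambda>v. \<i> * \<sigma> * complex_of_real (D v / \<rho> x) * exp (\<i> * \<sigma> * complex_of_real (ln (\<rho> x))) - ?c * complex_of_real (D v))
      = (\<lambda>_. 0)"
    using rpow_exp[OF x, of \<sigma>] by (intro ext) simp
  ultimately have "((\<lambda>y. exp (\<i> * \<sigma> * complex_of_real (ln (?r y))) - ?c * complex_of_real (?r y)) has_derivative (\<lambda>_. 0))
      (at (\<phi> x) within \<phi> ` U)"
    by (simp only:)
  then have "critical_at (\<lambda>y. exp (\<i> * \<sigma> * complex_of_real (ln (\<rho> y))) - ?c * complex_of_real (\<rho> y)) x"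
    by (intro critical_atI[OF ch]) (simp add: o_def)
  then show ?thesis
    by (rule critical_at_cong[OF _ open_Compl[OF closed_bd]]) (use x in \<open>simp_all add: rpow_exp\<close>)
qed

lemma rpow_cutoff:
  assumes x: "x \<notin> bd"
  obtains f V where "\<And>y. msmooth_at UNIV f y" "open V" "x \<in> V" "V \<subseteq> - bd" "\<And>y. y \<in> V \<Longrightarrow> f y = rpow \<sigma> y"
proof -
  have obd: "open (- bd)" "x \<in> - bd" using closed_bd x by auto
  obtain \<eta> :: "'a \<Rightarrow> real" and V where \<eta>: "\<And>x. msmooth_at UNIV \<eta> x" "open V" "x \<in> V" "V \<subseteq> - bd"
    "\<And>x. x \<in> V \<Longrightarrow> \<eta> x = 1" "closure {x. \<eta> x \<noteq> 0} \<subseteq> - bd"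
    using bump[OF obd] by metis
  show thesis
  proof (rule that[OF msmooth_at_cut[OF obd(1) _ \<eta>(1,6)] \<eta>(2,3,4)])
    show "msmooth_at (- bd) (rpow \<sigma>) y" if "y \<in> - bd" for y using that rpow_smooth by blast
    show "(if y \<in> - bd then complex_of_real (\<eta> y) * rpow \<sigma> y else 0) = rpow \<sigma> y" if "y \<in> V" for y
      using that \<eta>(4,5) by auto
  qed
qed

text \<open>The operator \<open>T\<close> is \<open>\<rho>\<^sup>-\<^sup>i\<^sup>\<sigma> P \<rho>\<^sup>i\<^sup>\<sigma>\<close>, acting on sections smooth up to the boundary, and it induces
  an operator over the boundary component \<open>N\<close>.\<close>

definition conjugated ::
    "'a set \<Rightarrow> complex \<Rightarrow> ('a, 'e::complex_vector) vbundle \<Rightarrow> ('a, 'e) vbundle \<Rightarrow>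
     (('a \<Rightarrow> 'e) \<Rightarrow> 'a \<Rightarrow> 'e) \<Rightarrow> (('a \<Rightarrow> 'e) \<Rightarrow> 'a \<Rightarrow> 'e) \<Rightarrow> bool" where
  "conjugated N \<sigma> E F P T \<longleftrightarrow>
     (\<forall>s\<in>smooth_sections \<A> E UNIV. T s \<in> smooth_sections \<A> F UNIV) \<and>
     (\<forall>s\<in>smooth_sections \<A> E UNIV. \<forall>t\<in>smooth_sections \<A> E UNIV. \<forall>x. T (\<lambda>x. s x - t x) x = T s x - T t x) \<and>
     (\<forall>s\<in>smooth_sections \<A> E UNIV. (\<forall>x\<in>N. s x = 0) \<longrightarrow> (\<forall>x\<in>N. T s x = 0)) \<and>
     (\<forall>s\<in>smooth_sections \<A> E UNIV. \<forall>u\<in>smooth_sections \<A> E UNIV. \<forall>x V. x \<notin> bd \<longrightarrow> open V \<longrightarrow> x \<in> V \<longrightarrow>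
        (\<forall>y\<in>V. u y = rpow \<sigma> y *\<^sub>C s y) \<longrightarrow> P u x = rpow \<sigma> x *\<^sub>C T s x)"

lemma
  assumes "conjugated N \<sigma> E F P T"
  shows conj_section: "s \<in> smooth_sections \<A> E UNIV \<Longrightarrow> T s \<in> smooth_sections \<A> F UNIV"
    and conj_diff: "s \<in> smooth_sections \<A> E UNIV \<Longrightarrow> t \<in> smooth_sections \<A> E UNIV \<Longrightarrow> T (\<lambda>x. s x - t x) x = T s x - T t x"
    and conj_vanish: "s \<in> smooth_sections \<A> E UNIV \<Longrightarrow> (\<And>x. x \<in> N \<Longrightarrow> s x = 0) \<Longrightarrow> x \<in> N \<Longrightarrow> T s x = 0"
    and conj_intertwines: "s \<in> smooth_sections \<A> E UNIV \<Longrightarrow> u \<in> smooth_sections \<A> E UNIV \<Longrightarrow> x \<notin> bd \<Longrightarrow> open V \<Longrightarrow> x \<in> V \<Longrightarrow>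
        (\<And>y. y \<in> V \<Longrightarrow> u y = rpow \<sigma> y *\<^sub>C s y) \<Longrightarrow> P u x = rpow \<sigma> x *\<^sub>C T s x"
proof -
  note c = assms[unfolded conjugated_def]
  show "s \<in> smooth_sections \<A> E UNIV \<Longrightarrow> T s \<in> smooth_sections \<A> F UNIV" using c[THEN conjunct1] by blast
  show "s \<in> smooth_sections \<A> E UNIV \<Longrightarrow> t \<in> smooth_sections \<A> E UNIV \<Longrightarrow> T (\<lambda>x. s x - t x) x = T s x - T t x"
    using c[THEN conjunct2, THEN conjunct1] by blast
  show "T s x = 0" if "s \<in> smooth_sections \<A> E UNIV" "\<And>x. x \<in> N \<Longrightarrow> s x = 0" "x \<in> N"
    using c[THEN conjunct2, THEN conjunct2, THEN conjunct1] that by blast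
  show "P u x = rpow \<sigma> x *\<^sub>C T s x"
    if "s \<in> smooth_sections \<A> E UNIV" "u \<in> smooth_sections \<A> E UNIV" "x \<notin> bd" "open V" "x \<in> V"
      "\<And>y. y \<in> V \<Longrightarrow> u y = rpow \<sigma> y *\<^sub>C s y"
    using c[THEN conjunct2, THEN conjunct2, THEN conjunct2, rule_format, OF that(1-5)] that(6) by fast
qed

text \<open>So \<open>T\<close> descends to sections over \<open>N\<close>: the choice of an extension does not matter.\<close>

lemma conj_eq_on:
  assumes "conjugated N \<sigma> E F P T" "vector_bundle \<A> E" "s \<in> smooth_sections \<A> E UNIV" "t \<in> smooth_sections \<A> E UNIV"
    and "\<And>x. x \<in> N \<Longrightarrow> s x = t x" "x \<in> N"
  shows "T s x = T t x"
proof -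
  interpret bundle_on \<A> \<rho> E by unfold_locales fact
  show ?thesis
    using conj_vanish[OF assms(1) section_diff[OF assms(3,4)] _ assms(6)] conj_diff[OF assms(1,3,4)] assms(5) by simp
qed

text \<open>Conjugation by \<open>\<rho>\<^sup>i\<^sup>\<sigma>\<close> is multiplicative, so identities between compositions of operators pass to their
  indicial families.\<close>

lemma conj_comp:
  fixes E F G :: "('a, 'e::complex_vector) vbundle"
  assumes P: "conjugated N \<sigma> E F P T" and R: "conjugated N \<sigma> F G R S"
    and sec: "\<And>u. u \<in> smooth_sections \<A> E UNIV \<Longrightarrow> P u \<in> smooth_sections \<A> F UNIV"
  shows "conjugated N \<sigma> E G (\<lambda>u. R (P u)) (\<lambda>s. S (T s))"
  unfolding conjugated_def
proof (intro conjI ballI allI impI)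
  fix s t u :: "'a \<Rightarrow> 'e" and x V assume s: "s \<in> smooth_sections \<A> E UNIV"
  show "S (T s) \<in> smooth_sections \<A> G UNIV" by (intro conj_section[OF R] conj_section[OF P] s)
  show "S (T (\<lambda>x. s x - t x)) x = S (T s) x - S (T t) x" if t: "t \<in> smooth_sections \<A> E UNIV"
  proof -
    have "T (\<lambda>x. s x - t x) = (\<lambda>x. T s x - T t x)" using conj_diff[OF P s t] by blast
    then show ?thesis using conj_diff[OF R conj_section[OF P s] conj_section[OF P t]] by simp
  qed
  show "S (T s) x = 0" if "\<forall>x\<in>N. s x = 0" "x \<in> N"
    using that conj_vanish[OF P s] by (intro conj_vanish[OF R conj_section[OF P s]]) auto
  assume u: "u \<in> smooth_sections \<A> E UNIV" and x: "x \<notin> bd" "open V" "x \<in> V" "\<forall>y\<in>V. u y = rpow \<sigma> y *\<^sub>C s y"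
  show "R (P u) x = rpow \<sigma> x *\<^sub>C S (T s) x"
  proof (rule conj_intertwines[OF R conj_section[OF P s] sec[OF u] x(1)])
    show "open (V - bd)" "x \<in> V - bd" using x closed_bd by auto
    show "P u y = rpow \<sigma> y *\<^sub>C T s y" if "y \<in> V - bd" for y
      by (rule conj_intertwines[OF P s u _ x(2)]) (use that x(4) in auto)
  qed
qed

lemma conj_add:
  fixes E F :: "('a, 'e::complex_vector) vbundle"
  assumes P: "conjugated N \<sigma> E F P T" and R: "conjugated N \<sigma> E F R S" and F: "vector_bundle \<A> F"
  shows "conjugated N \<sigma> E F (\<lambda>u x. P u x + R u x) (\<lambda>s x. T s x + S s x)"
proof -
  interpret bundle_on \<A> \<rho> F by unfold_locales fact
  show ?thesis
    unfolding conjugated_def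
  proof (intro conjI ballI allI impI)
    fix s t u :: "'a \<Rightarrow> 'e" and x V assume s: "s \<in> smooth_sections \<A> E UNIV"
    show "(\<lambda>x. T s x + S s x) \<in> smooth_sections \<A> F UNIV"
      by (intro section_add conj_section[OF P s] conj_section[OF R s])
    show "T (\<lambda>x. s x - t x) x + S (\<lambda>x. s x - t x) x = T s x + S s x - (T t x + S t x)" if t: "t \<in> smooth_sections \<A> E UNIV"
      using conj_diff[OF P s t] conj_diff[OF R s t] by simp
    show "T s x + S s x = 0" if "\<forall>x\<in>N. s x = 0" "x \<in> N"
      using conj_vanish[OF P s _ that(2)] conj_vanish[OF R s _ that(2)] that(1) by simp
    assume u: "u \<in> smooth_sections \<A> E UNIV" and x: "x \<notin> bd" "open V" "x \<in> V" "\<forall>y\<in>V. u y = rpow \<sigma> y *\<^sub>C s y"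
    have y: "\<And>y. y \<in> V \<Longrightarrow> u y = rpow \<sigma> y *\<^sub>C s y" using x(4) by blast
    show "P u x + R u x = rpow \<sigma> x *\<^sub>C (T s x + S s x)"
      using conj_intertwines[OF P s u x(1-3) y] conj_intertwines[OF R s u x(1-3) y] by (simp add: scaleC_add_right)
  qed
qed

lemma rpow_section:
  assumes E: "vector_bundle \<A> E" and s: "s \<in> smooth_sections \<A> E UNIV" and x: "x \<notin> bd"
  obtains u V where "u \<in> smooth_sections \<A> E UNIV" "open V" "x \<in> V" "\<And>y. y \<in> V \<Longrightarrow> u y = rpow \<sigma> y *\<^sub>C s y"
proof -
  interpret bundle_on \<A> \<rho> E by unfold_locales fact
  obtain f V where f: "\<And>y. msmooth_at UNIV f y" "open V" "x \<in> V" "V \<subseteq> - bd" "\<And>y. y \<in> V \<Longrightarrow> f y = rpow \<sigma> y"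
    using rpow_cutoff[OF x] by blast
  show thesis
    by (rule that[OF section_scale[OF s f(1)] f(2,3)]) (simp add: f(5))
qed

lemma conj_of_zero:
  assumes P: "conjugated N \<sigma> E F P T" and E: "vector_bundle \<A> E" and F: "vector_bundle \<A> F"
    and zero: "\<And>u x. u \<in> smooth_sections \<A> E UNIV \<Longrightarrow> P u x = 0" and s: "s \<in> smooth_sections \<A> E UNIV"
  shows "T s p = 0"
proof -
  interpret bundle_on \<A> \<rho> F by unfold_locales fact
  show ?thesis
  proof (rule section_zero_by_density[OF conj_section[OF P s] open_UNIV UNIV_I])
    fix x assume x: "x \<notin> bd"
    obtain u V where u: "u \<in> smooth_sections \<A> E UNIV" "open V" "x \<in> V" "\<And>y. y \<in> V \<Longrightarrow> u y = rpow \<sigma> y *\<^sub>C s y"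
      using rpow_section[OF E s x] by blast
    have "0 = rpow \<sigma> x *\<^sub>C T s x" using conj_intertwines[OF P s u(1) x u(2-4)] zero[OF u(1)] by simp
    then show "T s x = 0" using rpow_nonzero[OF x] by simp
  qed
qed

lemma apply_local_rpow:
  assumes P: "conjugated N \<sigma> E F P T" and E: "vector_bundle \<A> E" and s: "s \<in> smooth_sections \<A> E UNIV" and x: "x \<notin> bd"
  shows "apply_local \<A> E P (\<lambda>y. rpow \<sigma> y *\<^sub>C s y) x = rpow \<sigma> x *\<^sub>C T s x"
  unfolding apply_local_def
proof (rule some_equality)
  obtain u V where u: "u \<in> smooth_sections \<A> E UNIV" "open V" "x \<in> V" "\<And>y. y \<in> V \<Longrightarrow> u y = rpow \<sigma> y *\<^sub>C s y"
    using rpow_section[OF E s x] by blast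
  show "\<exists>u\<in>smooth_sections \<A> E UNIV. \<exists>V. open V \<and> x \<in> V \<and> (\<forall>y\<in>V. u y = rpow \<sigma> y *\<^sub>C s y) \<and> rpow \<sigma> x *\<^sub>C T s x = P u x"
    using u conj_intertwines[OF P s u(1) x u(2-4)] by metis
next
  fix z assume "\<exists>u\<in>smooth_sections \<A> E UNIV. \<exists>V. open V \<and> x \<in> V \<and> (\<forall>y\<in>V. u y = rpow \<sigma> y *\<^sub>C s y) \<and> z = P u x"
  then show "z = rpow \<sigma> x *\<^sub>C T s x" using conj_intertwines[OF P s _ x] by blast
qed

text \<open>In the interior \<open>\<Psi> = T \<Phi>\<close>, and therefore also on \<open>N\<close> by density; the extension \<open>\<Phi>\<close> only enters through its
  values on \<open>N\<close>.\<close>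

lemma indicial_family_conjugated:
  assumes P: "conjugated N \<sigma> E F P T" and E: "vector_bundle \<A> E" and F: "vector_bundle \<A> F"
    and s: "s \<in> smooth_sections \<A> E UNIV" and \<phi>: "\<And>p. p \<in> N \<Longrightarrow> s p = \<phi> p"
  shows "indicial_family \<A> \<rho> N E F P \<sigma> \<phi> = (\<lambda>p. if p \<in> N then T s p else 0)"
proof -
  interpret F: bundle_on \<A> \<rho> F by unfold_locales fact
  have key: "of_real (\<rho> x) powr (- \<i> * \<sigma>) *\<^sub>C apply_local \<A> E P (\<lambda>y. of_real (\<rho> y) powr (\<i> * \<sigma>) *\<^sub>C s y) x = T s x"
    if s: "s \<in> smooth_sections \<A> E UNIV" and x: "x \<notin> bd" for s x
  proof -
    have "of_real (\<rho> x) powr (- \<i> * \<sigma>) * of_real (\<rho> x) powr (\<i> * \<sigma>) = (1::complex)"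
      using rho_pos[OF x] by (simp add: powr_add[symmetric])
    then show ?thesis
      using apply_local_rpow[OF P E s x] by (simp add: rpow_def scaleC_scaleC)
  qed
  show ?thesis
    unfolding indicial_family_def
  proof (rule some_equality)
    show "\<exists>\<Phi>\<in>smooth_sections \<A> E UNIV. \<exists>\<Psi>\<in>smooth_sections \<A> F UNIV. (\<forall>p\<in>N. \<Phi> p = \<phi> p) \<and>
        (\<forall>x. x \<notin> bd \<longrightarrow> \<Psi> x = of_real (\<rho> x) powr (- \<i> * \<sigma>) *\<^sub>C
            apply_local \<A> E P (\<lambda>y. of_real (\<rho> y) powr (\<i> * \<sigma>) *\<^sub>C \<Phi> y) x) \<and>
        (\<lambda>p. if p \<in> N then T s p else 0) = (\<lambda>p. if p \<in> N then \<Psi> p else 0)"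
      by (rule bexI[OF _ s], rule bexI[OF _ conj_section[OF P s]]) (use \<phi> key[OF s] in simp)
  next
    fix g assume "\<exists>\<Phi>\<in>smooth_sections \<A> E UNIV. \<exists>\<Psi>\<in>smooth_sections \<A> F UNIV. (\<forall>p\<in>N. \<Phi> p = \<phi> p) \<and>
        (\<forall>x. x \<notin> bd \<longrightarrow> \<Psi> x = of_real (\<rho> x) powr (- \<i> * \<sigma>) *\<^sub>C
            apply_local \<A> E P (\<lambda>y. of_real (\<rho> y) powr (\<i> * \<sigma>) *\<^sub>C \<Phi> y) x) \<and>
        g = (\<lambda>p. if p \<in> N then \<Psi> p else 0)"
    then obtain \<Phi> \<Psi> where g: "\<Phi> \<in> smooth_sections \<A> E UNIV" "\<Psi> \<in> smooth_sections \<A> F UNIV" "\<forall>p\<in>N. \<Phi> p = \<phi> p"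
      "\<forall>x. x \<notin> bd \<longrightarrow> \<Psi> x = of_real (\<rho> x) powr (- \<i> * \<sigma>) *\<^sub>C
            apply_local \<A> E P (\<lambda>y. of_real (\<rho> y) powr (\<i> * \<sigma>) *\<^sub>C \<Phi> y) x"
      "g = (\<lambda>p. if p \<in> N then \<Psi> p else 0)" by blast
    have "\<Psi> p = T \<Phi> p" for p
      by (rule F.section_eq_by_density[OF g(2) conj_section[OF P g(1)] open_UNIV UNIV_I]) (use g(4) key[OF g(1)] in simp)
    moreover have "T \<Phi> p = T s p" if "p \<in> N" for p
      by (rule conj_eq_on[OF P E g(1) s _ that]) (use g(3) \<phi> in simp)
    ultimately show "g = (\<lambda>p. if p \<in> N then T s p else 0)" unfolding g(5) by auto
  qed
qed

text \<open>If the Laplacian \<open>L = S\<^sub>1 T\<^sub>1 + T\<^sub>0 S\<^sub>0\<close> is bijective and \<open>\<phi> = L \<psi>\<close>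
  with \<open>T\<^sub>1 \<phi> = 0\<close>, then \<open>L (S\<^sub>1 T\<^sub>1 \<psi>) = S\<^sub>1 T\<^sub>1 S\<^sub>1 T\<^sub>1 \<psi> = S\<^sub>1 T\<^sub>1 \<phi> = 0\<close>. So
  \<open>S\<^sub>1 T\<^sub>1 \<psi> = 0\<close> and \<open>\<phi> = T\<^sub>0 S\<^sub>0 \<psi>\<close>.\<close>

lemma cocycle_is_coboundary:
  fixes E0 E1 E2 :: "('a, 'e::complex_vector) vbundle"
  assumes N: "closed N" and E: "vector_bundle \<A> E0" "vector_bundle \<A> E1" "vector_bundle \<A> E2"
    and T0: "conjugated N \<sigma> E0 E1 A0 T0" and T1: "conjugated N \<sigma> E1 E2 A1 T1"
    and S0: "conjugated N \<sigma> E1 E0 Q0 S0" and S1: "conjugated N \<sigma> E2 E1 Q1 S1"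
    and L: "conjugated N \<sigma> E1 E1 L (\<lambda>s x. S1 (T1 s) x + T0 (S0 s) x)"
    and TT: "\<And>s x. s \<in> smooth_sections \<A> E0 UNIV \<Longrightarrow> T1 (T0 s) x = 0"
    and SS: "\<And>s x. s \<in> smooth_sections \<A> E2 UNIV \<Longrightarrow> S0 (S1 s) x = 0"
    and bij: "bij_betw (indicial_family \<A> \<rho> N E1 E1 L \<sigma>) (smooth_sections \<A> E1 N) (smooth_sections \<A> E1 N)"
    and \<phi>: "\<phi> \<in> smooth_sections \<A> E1 N" "indicial_family \<A> \<rho> N E1 E2 A1 \<sigma> \<phi> = (\<lambda>_. 0)"
  shows "\<phi> \<in> indicial_family \<A> \<rho> N E0 E1 A0 \<sigma> ` smooth_sections \<A> E0 N"
proof -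
  interpret E0: bundle_on \<A> \<rho> E0 by unfold_locales fact
  interpret E1: bundle_on \<A> \<rho> E1 by unfold_locales fact
  interpret E2: bundle_on \<A> \<rho> E2 by unfold_locales fact
  obtain \<psi> where \<psi>: "\<psi> \<in> smooth_sections \<A> E1 N" "\<phi> = indicial_family \<A> \<rho> N E1 E1 L \<sigma> \<psi>"
    using bij \<phi>(1) unfolding bij_betw_def by blast
  obtain s where s: "s \<in> E1.sec" "\<And>x. x \<in> N \<Longrightarrow> s x = \<phi> x" using E1.section_extension[OF N \<phi>(1)] by blast
  obtain t where t: "t \<in> E1.sec" "\<And>x. x \<in> N \<Longrightarrow> t x = \<psi> x" using E1.section_extension[OF N \<psi>(1)] by blast
  define X where "X = S1 (T1 t)"
  define Y where "Y = T0 (S0 t)"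
  have X: "X \<in> E1.sec" and Y: "Y \<in> E1.sec"
    unfolding X_def Y_def by (intro conj_section[OF S1] conj_section[OF T1] conj_section[OF T0] conj_section[OF S0] t)+
  have sXY: "s x = X x + Y x" if "x \<in> N" for x
    using indicial_family_conjugated[OF L E(2,2) t] that s(2) \<psi>(2) by (simp add: X_def Y_def)
  have T1s: "T1 s x = 0" if "x \<in> N" for x
    using fun_cong[OF indicial_family_conjugated[OF T1 E(2,3) s], of x] \<phi>(2) that by simp
  have "T1 X x = 0" if x: "x \<in> N" for x
  proof -
    have "T1 (\<lambda>x. s x - Y x) x = T1 X x"
      by (rule conj_eq_on[OF T1 E(2) E1.section_diff[OF s(1) Y] X _ x]) (simp add: sXY)
    moreover have "T1 (\<lambda>x. s x - Y x) x = T1 s x - T1 Y x" by (rule conj_diff[OF T1 s(1) Y])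
    moreover have "T1 Y x = 0" unfolding Y_def by (rule TT[OF conj_section[OF S0 t(1)]])
    ultimately show ?thesis using T1s[OF x] by simp
  qed
  then have S1T1X: "S1 (T1 X) x = 0" if "x \<in> N" for x
    using that by (intro conj_vanish[OF S1 conj_section[OF T1 X]]) auto
  have "S0 X x = 0" for x unfolding X_def by (rule SS[OF conj_section[OF T1 t(1)]])
  then have T0S0X: "T0 (S0 X) x = 0" if "x \<in> N" for x
    using that by (intro conj_vanish[OF T0 conj_section[OF S0 X]]) auto
  let ?X = "\<lambda>x. if x \<in> N then X x else 0"
  have Xr: "?X \<in> smooth_sections \<A> E1 N" by (rule E1.section_restrict[OF X])
  have "indicial_family \<A> \<rho> N E1 E1 L \<sigma> ?X = (\<lambda>_. 0)"
    using S1T1X T0S0X by (subst indicial_family_conjugated[OF L E(2,2) X]) auto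
  moreover have "indicial_family \<A> \<rho> N E1 E1 L \<sigma> (\<lambda>_. 0) = (\<lambda>_. 0)"
    using conj_vanish[OF L E1.zero_section] by (subst indicial_family_conjugated[OF L E(2,2) E1.zero_section]) auto
  ultimately have "?X = (\<lambda>_. 0)"
    using bij Xr E1.zero_section unfolding bij_betw_def inj_on_def by metis
  then have X0: "X x = 0" if "x \<in> N" for x using that by (metis (mono_tags))
  have "\<phi> = indicial_family \<A> \<rho> N E0 E1 A0 \<sigma> (\<lambda>x. if x \<in> N then S0 t x else 0)"
  proof
    fix x
    show "\<phi> x = indicial_family \<A> \<rho> N E0 E1 A0 \<sigma> (\<lambda>x. if x \<in> N then S0 t x else 0) x"
      using E1.smooth_sectionsD(2)[OF \<phi>(1), of x] sXY X0 s(2)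
      by (subst indicial_family_conjugated[OF T0 E(1,2) conj_section[OF S0 t(1)]]) (auto simp: Y_def)
  qed
  then show ?thesis using E0.section_restrict[OF conj_section[OF S0 t(1)]] by blast
qed

end

context bundle_pair
begin

text \<open>By the chain rule \<open>[P, \<rho>\<^sup>i\<^sup>\<sigma>] = i\<sigma> \<rho>\<^sup>i\<^sup>\<sigma>\<^sup>-\<^sup>1 [P, \<rho>] = i\<sigma> \<rho>\<^sup>i\<^sup>\<sigma> B\<close>.\<close>

lemma bfo_conjugated:
  assumes P: "b_first_order P B" and N: "N \<in> components bd"
  shows "conjugated N \<sigma> E F P (\<lambda>s x. P s x + (\<i> * \<sigma>) *\<^sub>C B s x)"
proof -
  note fo = bfo_fo[OF P] and foB = bfo_fo_B[OF P]
  show ?thesis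
    unfolding conjugated_def
  proof (intro conjI ballI allI impI)
    fix s t u :: "'a \<Rightarrow> 'e" and x V assume s: "s \<in> E.sec"
    show "(\<lambda>x. P s x + (\<i> * \<sigma>) *\<^sub>C B s x) \<in> F.sec"
      by (intro F.section_add F.section_scale fo_section[OF fo s] fo_section[OF foB s] msmooth_at_const)
    show "P (\<lambda>x. s x - t x) x + (\<i> * \<sigma>) *\<^sub>C B (\<lambda>x. s x - t x) x =
        P s x + (\<i> * \<sigma>) *\<^sub>C B s x - (P t x + (\<i> * \<sigma>) *\<^sub>C B t x)" if t: "t \<in> E.sec"
      unfolding fo_diff[OF fo s t] fo_diff[OF foB s t] by (simp add: complex_vector.scale_right_diff_distrib)
    show "P s x + (\<i> * \<sigma>) *\<^sub>C B s x = 0" if "\<forall>x\<in>N. s x = 0" "x \<in> N"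
      using bfo_vanish[OF P N that(2) s] that(1) by simp
    assume u: "u \<in> E.sec" and x: "x \<notin> bd" "open V" "x \<in> V" "\<forall>y\<in>V. u y = rpow \<sigma> y *\<^sub>C s y"
    obtain f V' where f: "\<And>y. msmooth_at UNIV f y" "open V'" "x \<in> V'" "V' \<subseteq> - bd" "\<And>y. y \<in> V' \<Longrightarrow> f y = rpow \<sigma> y"
      using rpow_cutoff[OF x(1)] by blast
    let ?c = "\<i> * \<sigma> * rpow \<sigma> x / of_real (\<rho> x)"
    have "P u x = P (\<lambda>x. f x *\<^sub>C s x) x"
      by (rule fo_local[OF fo u E.section_scale[OF s f(1)] open_Int[OF x(2) f(2)]]) (use x f in auto)
    also have "\<dots> = f x *\<^sub>C P s x + (?c * of_real (\<rho> x)) *\<^sub>C B s x"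
    proof (rule bfo_rule[OF P s f(1)])
      show "critical_at (\<lambda>y. f y - ?c * of_real (\<rho> y)) x"
        by (rule critical_at_cong[OF rpow_critical_at[OF x(1)] f(2,3)]) (simp add: f(5))
    qed
    also have "\<dots> = rpow \<sigma> x *\<^sub>C (P s x + (\<i> * \<sigma>) *\<^sub>C B s x)"
      using f(3,5) rho_pos[OF x(1)] by (simp add: scaleC_add_right scaleC_scaleC mult.commute)
    finally show "P u x = rpow \<sigma> x *\<^sub>C (P s x + (\<i> * \<sigma>) *\<^sub>C B s x)" .
  qed
qed

end

context hermitian_pair
begin

lemma b_diff_operator_adjoint_conjugated:
  assumes P: "b_diff_operator \<A> \<rho> E F 1 P" and N: "N \<in> components bd"
  defines "Q \<equiv> formal_adjoint \<A> \<mu> E hE F hF P"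
  shows "adj_of P Q" "\<exists>T. conjugated N \<sigma> E F P T" "\<exists>S. conjugated N \<sigma> F E Q S"
    "u \<in> E.sec \<Longrightarrow> P u \<in> F.sec" "u \<in> E.sec \<Longrightarrow> interior_support u \<Longrightarrow> interior_support (P u)"
proof -
  obtain B where B: "b_first_order P B" using b_diff_operator_b_first_order[OF P] .
  obtain Q' where "adj_of P Q'" using formal_adjoint_exists[OF B] .
  then show Q: "adj_of P Q" unfolding Q_def formal_adjoint_def by (rule someI[where P = "\<lambda>Q. adj_of P Q"])
  obtain B' where B': "sw.b_first_order Q B'" using adj_b_first_order[OF B Q] .
  show "\<exists>T. conjugated N \<sigma> E F P T" using bfo_conjugated[OF B N] by blast
  show "\<exists>S. conjugated N \<sigma> F E Q S" using sw.bfo_conjugated[OF B' N] by blast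
  show "u \<in> E.sec \<Longrightarrow> P u \<in> F.sec" by (rule fo_section[OF bfo_fo[OF B]])
  show "u \<in> E.sec \<Longrightarrow> interior_support u \<Longrightarrow> interior_support (P u)" by (rule fo_support[OF bfo_fo[OF B]])
qed

end

section \<open>The boundary spectrum of the complex and of the Laplacian\<close>

theorem proposition6p7:
  fixes \<A> :: "('a::t2_space, 'v::euclidean_space) atlas"
    and \<rho> :: "'a \<Rightarrow> real"
    and N :: "'a set"
    and E :: "int \<Rightarrow> ('a, 'e::complex_vector) vbundle"
    and A :: "int \<Rightarrow> ('a \<Rightarrow> 'e) \<Rightarrow> ('a \<Rightarrow> 'e)"
    and r :: nat
    and \<mu> :: "'a measure"
    and h :: "int \<Rightarrow> 'a \<Rightarrow> 'e \<Rightarrow> 'e \<Rightarrow> complex"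
    and q :: int
  assumes "compact (UNIV :: 'a set)" and "smooth_atlas \<A>"
    and "N \<in> components (mboundary \<A>)"
    and "defining_function \<A> \<rho>"
    and "\<And>j. vector_bundle \<A> (E j)"
    and "\<And>j x. j < 0 \<or> j > int r + 1 \<Longrightarrow> fiber (E j) x = {0}"
    and "\<And>j. b_diff_operator \<A> \<rho> (E j) (E (j + 1)) 1 (A j)"
    and "b_elliptic_complex \<A> E A"
    and "smooth_positive_b_density \<A> \<rho> \<mu>"
    and "\<And>j. hermitian_metric \<A> (E j) (h j)"
  shows "b_spec_complex \<A> \<rho> N E A q \<subseteq> b_spec_operator \<A> \<rho> N (E q) (laplacian \<A> \<mu> E h A q)"
proof
  interpret bmanifold \<A> \<rho> by unfold_locales (use assms in blast)+
  fix \<sigma> assume sigma: "\<sigma> \<in> b_spec_complex \<A> \<rho> N E A q"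
  note vb = assms(5) and Ncomp = assms(3)
  have Ncl: "closed N" by (rule closed_component[OF Ncomp])
  have pair: "hermitian_pair \<A> \<rho> (E i) (E j) (h i) (h j) \<mu>" for i j
    by unfold_locales (use assms in blast)+
  interpret E0: hermitian_b \<A> \<rho> "E (q - 1)" "h (q - 1)" \<mu> by unfold_locales (use assms in blast)+
  interpret E1: hermitian_b \<A> \<rho> "E q" "h q" \<mu> by unfold_locales (use assms in blast)+
  interpret E2: hermitian_b \<A> \<rho> "E (q + 1)" "h (q + 1)" \<mu> by unfold_locales (use assms in blast)+
  define Q0 where "Q0 = formal_adjoint \<A> \<mu> (E (q - 1)) (h (q - 1)) (E q) (h q) (A (q - 1))"
  define Q1 where "Q1 = formal_adjoint \<A> \<mu> (E q) (h q) (E (q + 1)) (h (q + 1)) (A q)"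
  have op0: "b_diff_operator \<A> \<rho> (E (q - 1)) (E q) 1 (A (q - 1))" using assms(7)[of "q - 1"] by simp
  have op1: "b_diff_operator \<A> \<rho> (E q) (E (q + 1)) 1 (A q)" by (rule assms(7))
  note A0 = hermitian_pair.b_diff_operator_adjoint_conjugated[OF pair op0 Ncomp, folded Q0_def]
  note A1 = hermitian_pair.b_diff_operator_adjoint_conjugated[OF pair op1 Ncomp, folded Q1_def]
  obtain T0 where T0: "conjugated N \<sigma> (E (q - 1)) (E q) (A (q - 1)) T0" using A0(2) by blast
  obtain T1 where T1: "conjugated N \<sigma> (E q) (E (q + 1)) (A q) T1" using A1(2) by blast
  obtain S0 where S0: "conjugated N \<sigma> (E q) (E (q - 1)) Q0 S0" using A0(3) by blast
  obtain S1 where S1: "conjugated N \<sigma> (E (q + 1)) (E q) Q1 S1" using A1(3) by blast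
  note Q0 = hermitian_pair.adj_section[OF pair A0(1)] hermitian_pair.adj_ibp[OF pair A0(1)]
  note Q1 = hermitian_pair.adj_section[OF pair A1(1)] hermitian_pair.adj_ibp[OF pair A1(1)]
  have AA: "A q (A (q - 1) u) x = 0" if "u \<in> E0.sec" for u x
  proof -
    have "\<forall>q. \<forall>u\<in>smooth_sections \<A> (E q) UNIV. A (q + 1) (A q u) = (\<lambda>_. 0)"
      using assms(8) unfolding b_elliptic_complex_def by (rule conjunct1)
    from bspec[OF spec[OF this, of "q - 1"] that] show ?thesis by simp
  qed
  have QQ: "Q0 (Q1 v) x = 0" if v: "v \<in> E2.sec" for v x
  proof (rule E0.weak_section_zero)
    show "Q0 (Q1 v) \<in> E0.sec" by (intro Q0(1) Q1(1) v)
    fix u assume u: "u \<in> E0.sec" "E0.interior_support u"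
    have "(LINT x|\<mu>. h (q - 1) x (u x) (Q0 (Q1 v) x)) = (LINT x|\<mu>. h q x (A (q - 1) u x) (Q1 v x))"
      by (rule Q0(2)[OF u(1) Q1(1)[OF v] u(2), symmetric])
    also have "\<dots> = (LINT x|\<mu>. h (q + 1) x (A q (A (q - 1) u) x) (v x))"
      by (rule Q1(2)[OF A0(4)[OF u(1)] v A0(5)[OF u], symmetric])
    also have "\<dots> = 0" using AA[OF u(1)] E2.h_zero_left E2.smooth_sectionsD(1)[OF v] by simp
    finally show "(LINT x|\<mu>. h (q - 1) x (u x) (Q0 (Q1 v) x)) = 0" .
  qed
  have TT: "T1 (T0 s) x = 0" if "s \<in> E0.sec" for s x
    by (rule conj_of_zero[OF conj_comp[OF T0 T1 A0(4)] vb vb AA that])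
  have SS: "S0 (S1 s) x = 0" if "s \<in> E2.sec" for s x
    by (rule conj_of_zero[OF conj_comp[OF S1 S0 Q1(1)] vb vb QQ that])
  have L: "conjugated N \<sigma> (E q) (E q) (laplacian \<A> \<mu> E h A q) (\<lambda>s x. S1 (T1 s) x + T0 (S0 s) x)"
    unfolding laplacian_def Q0_def[symmetric] Q1_def[symmetric]
    by (rule conj_add[OF conj_comp[OF T1 S1 A1(4)] conj_comp[OF S0 T0 Q0(1)] vb])
  show "\<sigma> \<in> b_spec_operator \<A> \<rho> N (E q) (laplacian \<A> \<mu> E h A q)"
  proof (rule ccontr)
    assume "\<sigma> \<notin> b_spec_operator \<A> \<rho> N (E q) (laplacian \<A> \<mu> E h A q)"
    then have bij: "bij_betw (indicial_family \<A> \<rho> N (E q) (E q) (laplacian \<A> \<mu> E h A q) \<sigma>)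
        (smooth_sections \<A> (E q) N) (smooth_sections \<A> (E q) N)"
      by (simp add: b_spec_operator_def)
    \<comment> \<open>If every cocycle is a coboundary, all cocycles form a single class, namely that of \<open>0\<close>.\<close>
    let ?Z = "cocycles \<A> \<rho> N E A \<sigma> q" and ?R = "cohomologous \<A> \<rho> N E A \<sigma> q"
    let ?I = "indicial_family \<A> \<rho> N (E q) (E (q + 1)) (A q) \<sigma>"
    have exact: "\<phi> \<in> coboundaries \<A> \<rho> N E A \<sigma> q" if "\<phi> \<in> ?Z" for \<phi>
      unfolding coboundaries_def
      by (rule cocycle_is_coboundary[OF Ncl vb vb vb T0 T1 S0 S1 L TT SS bij])
        (use that in \<open>simp_all add: cocycles_def\<close>)
    have diff: "(\<lambda>x. \<phi> x - \<psi> x) \<in> ?Z" if \<phi>: "\<phi> \<in> ?Z" and \<psi>: "\<psi> \<in> ?Z" for \<phi> \<psi>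
    proof -
      have sec: "\<phi> \<in> smooth_sections \<A> (E q) N" "\<psi> \<in> smooth_sections \<A> (E q) N"
        and zero: "?I \<phi> = (\<lambda>_. 0)" "?I \<psi> = (\<lambda>_. 0)" using \<phi> \<psi> by (simp_all add: cocycles_def)
      obtain s where s: "s \<in> E1.sec" "\<And>x. x \<in> N \<Longrightarrow> s x = \<phi> x" using E1.section_extension[OF Ncl sec(1)] by blast
      obtain t where t: "t \<in> E1.sec" "\<And>x. x \<in> N \<Longrightarrow> t x = \<psi> x" using E1.section_extension[OF Ncl sec(2)] by blast
      have "T1 s x = 0" "T1 t x = 0" if "x \<in> N" for x
        using fun_cong[OF indicial_family_conjugated[OF T1 vb vb s], of x] fun_cong[OF indicial_family_conjugated[OF T1 vb vb t], of x]
          zero that by simp_all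
      moreover have "?I (\<lambda>x. \<phi> x - \<psi> x) = (\<lambda>x. if x \<in> N then T1 (\<lambda>x. s x - t x) x else 0)"
        by (rule indicial_family_conjugated[OF T1 vb vb E1.section_diff[OF s(1) t(1)]]) (simp add: s(2) t(2))
      ultimately have "?I (\<lambda>x. \<phi> x - \<psi> x) = (\<lambda>_. 0)" using conj_diff[OF T1 s(1) t(1)] by auto
      then show ?thesis using E1.section_diff[OF sec] by (simp add: cocycles_def)
    qed
    obtain c where c: "c \<in> ?Z // ?R" "c \<noteq> ?R `` {\<lambda>_. 0}"
      using sigma by (auto simp: b_spec_complex_def cohomology_def)
    then obtain \<phi> where \<phi>: "\<phi> \<in> ?Z" "c = ?R `` {\<phi>}" by (auto elim: quotientE)
    have "?R `` {\<psi>} = ?Z" if "\<psi> \<in> ?Z" for \<psi>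
      using that exact diff by (auto simp: cohomologous_def)
    moreover have "(\<lambda>_. 0) \<in> ?Z" using diff[OF \<phi>(1) \<phi>(1)] by simp
    ultimately show False using \<phi> c(2) by simp
  qed
qed

end
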